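(* Let $X$ be the Iwasawa manifold. There are canonical injections $H^{2,1}_{[\gamma]}(X,\mathbb C)\hookrightarrow H^3_{DR}(X,\mathbb C)$ and $H^{1,2}_{[\gamma]}(X,\mathbb C)\hookrightarrow H^3_{DR}(X,\mathbb C)$ giving rise to a canonical isomorphism $$H^3_{DR}(X,\mathbb C)\simeq H^{3,0}_{\bar\partial}(X,\mathbb C)\oplus H^{2,1}_{[\gamma]}(X,\mathbb C)\oplus H^{1,2}_{[\gamma]}(X,\mathbb C)\oplus H^{0,3}_{\bar\partial}(X,\mathbb C).$$ Moreover, there are canonical isomorphisms given by conjugation $$H^{3,0}_{\bar\partial}(X,\mathbb C)\simeq\overline{H^{0,3}_{\bar\partial}(X,\mathbb C)}\quad\text{and}\quad H^{2,1}_{[\gamma]}(X,\mathbb C)\simeq\overline{H^{1,2}_{[\gamma]}(X,\mathbb C)}.$$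
   Context: Iwasawa manifold: $X=G/\Gamma$, $G$ the Heisenberg group of upper unitriangular complex $3\times3$ matrices $\begin{pmatrix}1&z_1&z_3\\0&1&z_2\\0&0&1\end{pmatrix}$, $\Gamma\subset G$ the subgroup with entries in $\mathbb Z[i]$. $\alpha,\beta,\gamma$ are the holomorphic $1$-forms on $X$ induced by $dz_1,dz_2,dz_3-z_1dz_2$; $d\alpha=d\beta=0$, $d\gamma=-\alpha\wedge\beta$. $H^{2,1}_{[\gamma]}(X,\mathbb C):=\langle[\alpha\wedge\gamma\wedge\bar\alpha]_{\bar\partial},[\alpha\wedge\gamma\wedge\bar\beta]_{\bar\partial},[\beta\wedge\gamma\wedge\bar\alpha]_{\bar\partial},[\beta\wedge\gamma\wedge\bar\beta]_{\bar\partial}\rangle\subset H^{2,1}_{\bar\partial}(X,\mathbb C)$ and $H^{1,2}_{[\gamma]}(X,\mathbb C):=\langle[\alpha\wedge\bar\alpha\wedge\bar\gamma]_{\bar\partial},[\alpha\wedge\bar\beta\wedge\bar\gamma]_{\bar\partial},[\beta\wedge\bar\alpha\wedge\bar\gamma]_{\bar\partial},[\beta\wedge\bar\beta\wedge\bar\gamma]_{\bar\partial}\rangle\subset H^{1,2}_{\bar\partial}(X,\mathbb C)$. Also $H^{3,0}_{\bar\partial}(X,\mathbb C)=\langle[\alpha\wedge\beta\wedge\gamma]_{\bar\partial}\rangle$ and $H^{0,3}_{\bar\partial}(X,\mathbb C)=\langle[\bar\alpha\wedge\bar\beta\wedge\bar\gamma]_{\bar\partial}\rangle$. "Canonical" means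 defined, without arbitrary choices, by the forms $\alpha,\beta,\gamma$; here the injections send the Dolbeault class of each listed generating form to the De Rham class of the same form, and the conjugation isomorphisms are induced by conjugating these forms. *)

theory Defs
  imports "HOL-Analysis.Analysis" "HOL-Combinatorics.Permutations" "HOL-Algebra.Module"
    "HOL-Algebra.AbelCoset"
begin

section \<open>The Heisenberg group and its lattice\<close>

type_synonym cvec = "complex ^ 3"

definition heis :: "cvec \<Rightarrow> complex ^ 3 ^ 3" where
  "heis z = vector [vector [1, z $ 1, z $ 3], vector [0, 1, z $ 2], vector [0, 0, 1]]"

definition heis_coord :: "complex ^ 3 ^ 3 \<Rightarrow> cvec" where
  "heis_coord A = vector [A $ 1 $ 2, A $ 2 $ 3, A $ 1 $ 3]"

definition heis_group :: "(complex ^ 3 ^ 3) set" where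
  "heis_group = range heis"

definition gaussian_ints :: "complex set" where
  "gaussian_ints = {w. Re w \<in> \<int> \<and> Im w \<in> \<int>}"

definition heis_lattice :: "(complex ^ 3 ^ 3) set" where
  "heis_lattice = {A \<in> heis_group. \<forall>i j. A $ i $ j \<in> gaussian_ints}"

text \<open>Left translation by a group element, in the global coordinates \<open>(z\<^sub>1, z\<^sub>2, z\<^sub>3)\<close>.\<close>

definition ltrans :: "complex ^ 3 ^ 3 \<Rightarrow> cvec \<Rightarrow> cvec" where
  "ltrans g z = heis_coord (g ** heis z)"


section \<open>Differential forms on the Iwasawa manifold\<close>

text \<open>
  A complex-valued covector of degree \<open>k\<close> on the real vector space underlying \<open>cvec\<close> is encoded as
  a function of a sequence of vectors that depends on the first \<open>k\<close> of them only, in which it is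
  real-multilinear and alternating.  The values of a form of degree \<open>k\<close> are such covectors.
\<close>

type_synonym covector = "(nat \<Rightarrow> cvec) \<Rightarrow> complex"
type_synonym form = "cvec \<Rightarrow> covector"

definition is_covector :: "nat \<Rightarrow> covector \<Rightarrow> bool" where
  "is_covector k \<phi> \<longleftrightarrow>
     (\<forall>v w. (\<forall>i<k. v i = w i) \<longrightarrow> \<phi> v = \<phi> w) \<and>
     (\<forall>v. \<forall>i<k. linear (\<lambda>u. \<phi> (v(i := u)))) \<and>
     (\<forall>v. \<forall>i<k. \<forall>j<k. i \<noteq> j \<and> v i = v j \<longrightarrow> \<phi> v = 0)"

fun times_differentiable :: "nat \<Rightarrow> (cvec \<Rightarrow> complex) \<Rightarrow> bool" where
  "times_differentiable 0 f \<longleftrightarrow> continuous_on UNIV f"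
| "times_differentiable (Suc n) f \<longleftrightarrow>
     f differentiable_on UNIV \<and>
     (\<forall>v. times_differentiable n (\<lambda>x. frechet_derivative f (at x) v))"

definition smooth :: "(cvec \<Rightarrow> complex) \<Rightarrow> bool" where
  "smooth f \<longleftrightarrow> (\<forall>n. times_differentiable n f)"

definition pullback :: "(cvec \<Rightarrow> cvec) \<Rightarrow> form \<Rightarrow> form" where
  "pullback F \<omega> = (\<lambda>x v. \<omega> (F x) (\<lambda>i. frechet_derivative F (at x) (v i)))"

text \<open>
  The Iwasawa manifold \<open>X\<close> is the orbit space of the free and properly discontinuous action of the
  lattice by left translations, the action for which \<open>dz\<^sub>1\<close>, \<open>dz\<^sub>2\<close>, \<open>dz\<^sub>3 - z\<^sub>1 dz\<^sub>2\<close> descend.  Pullback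
  along the holomorphic covering \<open>G \<rightarrow> X\<close> identifies the smooth forms on \<open>X\<close> with the smooth forms on
  \<open>G\<close> invariant under this action, compatibly with \<open>d\<close>, the bidegree and the Dolbeault operator;
  forms on \<open>X\<close> are represented in this way throughout.
\<close>

definition is_form :: "nat \<Rightarrow> form \<Rightarrow> bool" where
  "is_form k \<omega> \<longleftrightarrow>
     (\<forall>x. is_covector k (\<omega> x)) \<and>
     (\<forall>v. smooth (\<lambda>x. \<omega> x v)) \<and>
     (\<forall>g\<in>heis_lattice. pullback (ltrans g) \<omega> = \<omega>)"

text \<open>Exterior product of covectors of degree one: \<open>(\<phi>\<^sub>1 \<and> \<dots> \<and> \<phi>\<^sub>k)(v\<^sub>1, \<dots>, v\<^sub>k) = det (\<phi>\<^sub>i(v\<^sub>j))\<close>.\<close>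

definition wedge_covectors :: "(cvec \<Rightarrow> complex) list \<Rightarrow> covector" where
  "wedge_covectors \<phi>s = (\<lambda>v. \<Sum>\<sigma> | \<sigma> permutes {..<length \<phi>s}.
     of_int (sign \<sigma>) * (\<Prod>i<length \<phi>s. (\<phi>s ! i) (v (\<sigma> i))))"

definition wedge :: "(cvec \<Rightarrow> cvec \<Rightarrow> complex) list \<Rightarrow> form" where
  "wedge \<omega>s = (\<lambda>x. wedge_covectors (map (\<lambda>\<omega>. \<omega> x) \<omega>s))"

definition dz :: "3 \<Rightarrow> cvec \<Rightarrow> complex" where
  "dz i v = v $ i"

definition dzbar :: "3 \<Rightarrow> cvec \<Rightarrow> complex" where
  "dzbar i v = cnj (v $ i)"

definition bidegree :: "nat \<Rightarrow> nat \<Rightarrow> covector \<Rightarrow> bool" where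
  "bidegree p q \<phi> \<longleftrightarrow> (\<exists>c :: 3 list \<Rightarrow> 3 list \<Rightarrow> complex. \<phi> = (\<lambda>v.
     \<Sum>I | length I = p. \<Sum>J | length J = q.
       c I J * wedge_covectors (map dz I @ map dzbar J) v))"

definition cnj_form :: "form \<Rightarrow> form" where
  "cnj_form \<omega> = (\<lambda>x v. cnj (\<omega> x v))"


section \<open>The operators\<close>

definition omit :: "nat \<Rightarrow> (nat \<Rightarrow> 'a) \<Rightarrow> nat \<Rightarrow> 'a" where
  "omit i v = (\<lambda>j. if j < i then v j else v (Suc j))"

definition ext_deriv :: "nat \<Rightarrow> form \<Rightarrow> form" where
  "ext_deriv k \<omega> = (\<lambda>x v. \<Sum>i\<le>k.
     (- 1) ^ i * frechet_derivative (\<lambda>y. \<omega> y (omit i v)) (at x) (v i))"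

text \<open>
  For a function \<open>f\<close>, \<open>dbar_fun f x\<close> is the complex-antilinear part of the differential of \<open>f\<close> at
  \<open>x\<close>, that is, the sum over \<open>j\<close> of the Wirtinger derivatives of \<open>f\<close> with respect to the conjugate
  of \<open>z\<^sub>j\<close> times \<open>dzbar j\<close>.  Replacing the differential by it in the formula for \<open>d\<close> sends
  \<open>f dz\<^sub>I \<and> dzbar\<^sub>J\<close> to \<open>dbar_fun f \<and> dz\<^sub>I \<and> dzbar\<^sub>J\<close>; so on forms of type \<open>(p, q)\<close> this is the
  component of type \<open>(p, q + 1)\<close> of \<open>d\<close>.
\<close>

definition dbar_fun :: "(cvec \<Rightarrow> complex) \<Rightarrow> cvec \<Rightarrow> cvec \<Rightarrow> complex" where
  "dbar_fun f x u =
     (frechet_derivative f (at x) u + \<i> * frechet_derivative f (at x) (\<i> *s u)) / 2"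

definition dbar :: "nat \<Rightarrow> form \<Rightarrow> form" where
  "dbar k \<omega> = (\<lambda>x v. \<Sum>i\<le>k. (- 1) ^ i * dbar_fun (\<lambda>y. \<omega> y (omit i v)) x (v i))"


section \<open>Complex vector spaces\<close>

text \<open>
  Complex vector spaces are modules over \<open>complex_ring\<close>.  The fields \<open>mult\<close> and \<open>one\<close> of the module
  record carry no information.
\<close>

definition complex_ring :: "complex ring" where
  "complex_ring = \<lparr>carrier = UNIV, mult = (*), one = 1, zero = 0, add = (+)\<rparr>"

definition quotient_module :: "(complex, 'a) module \<Rightarrow> 'a set \<Rightarrow> (complex, 'a set) module" where
  "quotient_module M N =
     \<lparr>carrier = a_rcosets\<^bsub>M\<^esub> N, mult = undefined, one = undefined, zero = N, add = set_add M,
      smult = (\<lambda>c A. \<Union>a\<in>A. N +>\<^bsub>M\<^esub> (c \<odot>\<^bsub>M\<^esub> a))\<rparr>"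

definition span_module :: "(complex, 'a) module \<Rightarrow> 'a set \<Rightarrow> (complex, 'a) module" where
  "span_module M S = M\<lparr>carrier := \<Inter>{N. submodule N complex_ring M \<and> S \<subseteq> N}\<rparr>"

definition direct_sum ::
    "(complex, 'a) module \<Rightarrow> (complex, 'b) module \<Rightarrow> (complex, 'a \<times> 'b) module" (infixr "\<oplus>\<^sub>m" 65)
  where
  "M \<oplus>\<^sub>m N =
     \<lparr>carrier = carrier M \<times> carrier N, mult = undefined, one = undefined,
      zero = (\<zero>\<^bsub>M\<^esub>, \<zero>\<^bsub>N\<^esub>),
      add = (\<lambda>(a, b) (a', b'). (a \<oplus>\<^bsub>M\<^esub> a', b \<oplus>\<^bsub>N\<^esub> b')),
      smult = (\<lambda>c (a, b). (c \<odot>\<^bsub>M\<^esub> a, c \<odot>\<^bsub>N\<^esub> b))\<rparr>"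

text \<open>The conjugate vector space: same group, scalars acting through their conjugates.\<close>

definition conjugate_module :: "(complex, 'a) module \<Rightarrow> (complex, 'a) module" where
  "conjugate_module M = M\<lparr>smult := \<lambda>c a. cnj c \<odot>\<^bsub>M\<^esub> a\<rparr>"

definition linear_maps :: "(complex, 'a) module \<Rightarrow> (complex, 'b) module \<Rightarrow> ('a \<Rightarrow> 'b) set" where
  "linear_maps M N = {f \<in> carrier M \<rightarrow> carrier N.
     (\<forall>a\<in>carrier M. \<forall>b\<in>carrier M. f (a \<oplus>\<^bsub>M\<^esub> b) = f a \<oplus>\<^bsub>N\<^esub> f b) \<and>
     (\<forall>c. \<forall>a\<in>carrier M. f (c \<odot>\<^bsub>M\<^esub> a) = c \<odot>\<^bsub>N\<^esub> f a)}"

definition linear_isos :: "(complex, 'a) module \<Rightarrow> (complex, 'b) module \<Rightarrow> ('a \<Rightarrow> 'b) set" where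
  "linear_isos M N = {f \<in> linear_maps M N. bij_betw f (carrier M) (carrier N)}"


section \<open>De Rham and Dolbeault cohomology\<close>

definition zero_form :: form where
  "zero_form = (\<lambda>x v. 0)"

text \<open>The ambient space of all functions of the type of a form; only its operations matter.\<close>

definition form_space :: "(complex, form) module" where
  "form_space =
     \<lparr>carrier = UNIV, mult = undefined, one = undefined, zero = zero_form,
      add = (\<lambda>\<omega> \<eta> x v. \<omega> x v + \<eta> x v), smult = (\<lambda>c \<omega> x v. c * \<omega> x v)\<rparr>"

definition closed_forms :: "nat \<Rightarrow> form set" where
  "closed_forms k = {\<omega>. is_form k \<omega> \<and> ext_deriv k \<omega> = zero_form}"

definition exact_forms :: "nat \<Rightarrow> form set" where
  "exact_forms k = (case k of 0 \<Rightarrow> {zero_form} | Suc l \<Rightarrow> ext_deriv l ` {\<eta>. is_form l \<eta>})"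

definition H_DR :: "nat \<Rightarrow> (complex, form set) module" where
  "H_DR k = quotient_module (form_space\<lparr>carrier := closed_forms k\<rparr>) (exact_forms k)"

definition class_DR :: "nat \<Rightarrow> form \<Rightarrow> form set" where
  "class_DR k \<omega> = exact_forms k +>\<^bsub>form_space\<^esub> \<omega>"

definition pq_forms :: "nat \<Rightarrow> nat \<Rightarrow> form set" where
  "pq_forms p q = {\<omega>. is_form (p + q) \<omega> \<and> (\<forall>x. bidegree p q (\<omega> x))}"

definition dbar_closed_forms :: "nat \<Rightarrow> nat \<Rightarrow> form set" where
  "dbar_closed_forms p q = {\<omega> \<in> pq_forms p q. dbar (p + q) \<omega> = zero_form}"

definition dbar_exact_forms :: "nat \<Rightarrow> nat \<Rightarrow> form set" where
  "dbar_exact_forms p q =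
     (case q of 0 \<Rightarrow> {zero_form} | Suc r \<Rightarrow> dbar (p + r) ` pq_forms p r)"

definition H_Dolb :: "nat \<Rightarrow> nat \<Rightarrow> (complex, form set) module" where
  "H_Dolb p q =
     quotient_module (form_space\<lparr>carrier := dbar_closed_forms p q\<rparr>) (dbar_exact_forms p q)"

definition class_Dolb :: "nat \<Rightarrow> nat \<Rightarrow> form \<Rightarrow> form set" where
  "class_Dolb p q \<omega> = dbar_exact_forms p q +>\<^bsub>form_space\<^esub> \<omega>"


section \<open>The forms \<open>\<alpha>\<close>, \<open>\<beta>\<close>, \<open>\<gamma>\<close> and the spaces they generate\<close>

definition form_\<alpha> :: "cvec \<Rightarrow> cvec \<Rightarrow> complex" ("\<alpha>") where
  "\<alpha> = (\<lambda>x. dz 1)"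

definition form_\<beta> :: "cvec \<Rightarrow> cvec \<Rightarrow> complex" ("\<beta>") where
  "\<beta> = (\<lambda>x. dz 2)"

definition form_\<gamma> :: "cvec \<Rightarrow> cvec \<Rightarrow> complex" ("\<gamma>") where
  "\<gamma> = (\<lambda>x v. dz 3 v - x $ 1 * dz 2 v)"

definition bar :: "(cvec \<Rightarrow> cvec \<Rightarrow> complex) \<Rightarrow> cvec \<Rightarrow> cvec \<Rightarrow> complex" where
  "bar \<omega> = (\<lambda>x v. cnj (\<omega> x v))"

definition gens30 :: "form set" where
  "gens30 = {wedge [\<alpha>, \<beta>, \<gamma>]}"

definition gens21 :: "form set" where
  "gens21 = {wedge [\<alpha>, \<gamma>, bar \<alpha>], wedge [\<alpha>, \<gamma>, bar \<beta>], wedge [\<beta>, \<gamma>, bar \<alpha>], wedge [\<beta>, \<gamma>, bar \<beta>]}"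

definition gens12 :: "form set" where
  "gens12 = {wedge [\<alpha>, bar \<alpha>, bar \<gamma>], wedge [\<alpha>, bar \<beta>, bar \<gamma>],
             wedge [\<beta>, bar \<alpha>, bar \<gamma>], wedge [\<beta>, bar \<beta>, bar \<gamma>]}"

definition gens03 :: "form set" where
  "gens03 = {wedge [bar \<alpha>, bar \<beta>, bar \<gamma>]}"

definition H21_\<gamma> :: "(complex, form set) module" where
  "H21_\<gamma> = span_module (H_Dolb 2 1) (class_Dolb 2 1 ` gens21)"

definition H12_\<gamma> :: "(complex, form set) module" where
  "H12_\<gamma> = span_module (H_Dolb 1 2) (class_Dolb 1 2 ` gens12)"

text \<open>
  \<open>f\<close> is canonical: it is the only linear map from \<open>M\<close> to \<open>N\<close> (as a function on the carrier of
  \<open>M\<close>) that sends the class of each generating form \<open>\<omega> \<in> S\<close> to the class of the form \<open>T \<omega>\<close>.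
\<close>

definition canonical_map ::
    "(complex, 'a) module \<Rightarrow> (complex, 'b) module \<Rightarrow> form set \<Rightarrow> (form \<Rightarrow> form) \<Rightarrow>
     (form \<Rightarrow> 'a) \<Rightarrow> (form \<Rightarrow> 'b) \<Rightarrow> ('a \<Rightarrow> 'b) \<Rightarrow> bool" where
  "canonical_map M N S T clM clN f \<longleftrightarrow>
     f \<in> linear_maps M N \<and> (\<forall>\<omega>\<in>S. f (clM \<omega>) = clN (T \<omega>)) \<and>
     (\<forall>g\<in>linear_maps M N. (\<forall>\<omega>\<in>S. g (clM \<omega>) = clN (T \<omega>)) \<longrightarrow> (\<forall>a\<in>carrier M. g a = f a))"

end

theory Submission
  imports Defs "HOL-Complex_Analysis.Cauchy_Integral_Formula"
begin

text \<open>
  A closed form of degree three is cohomologous to its average over left translations.  By Cartan's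
  formula, averaging along a one-parameter subgroup changes it by an exact form and by the action
  of a nilpotent endomorphism on the values, and iterating gets rid of the latter.  The average is
  left-invariant, so the De Rham side becomes linear algebra in the exterior powers of
  \<open>\<alpha>, \<beta>, \<gamma>\<close> and their conjugates: the forms generating the four summands span the closed forms modulo exact
  ones, and no nontrivial combination of them is \<open>d\<close>- or \<open>dbar\<close>-exact, since a primitive could be
  averaged as well.
  For the Dolbeault spaces, the coefficient of a form of type \<open>(3, 0)\<close> in the kernel of \<open>dbar\<close> is a
  bounded entire function, hence constant.  The coefficient of a form of type \<open>(0, 3)\<close> is averaged
  over tori, first in the central direction and then in the two others; on each torus, Fourier
  series invert the Dolbeault operator off the mean value.
\<close>

section \<open>Smooth functions\<close>

text \<open>A form is known to be invariant only under the lattice, and pulling it back along left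
  translation by another group element normally destroys this invariance, because that element need
  not commute with the lattice. Commutators lie in the center, however. So the average over the
  center is taken first; on forms invariant under the center all left translations commute with the
  lattice, and they can be averaged one real direction at a time. The vector field generating left
  translations does not descend to X either, so the contraction in Cartan's formula uses the
  left-invariant field, which generates right translations. On forms invariant under the center both
  flows move the base point alike and differ only in their action on the values; the infinitesimal
  difference is the bracket with the direction, and this is the nilpotent endomorphism. The
  operators d and dbar are treated together as \<open>ext_gen p q\<close>, so a single averaging
  argument excludes primitives for both.\<close>

definition dd :: "cvec \<Rightarrow> (cvec \<Rightarrow> complex) \<Rightarrow> cvec \<Rightarrow> complex" where
  "dd v f x = frechet_derivative f (at x) v"

lemma dd_eqI: "(f has_derivative f') (at x) \<Longrightarrow> dd v f x = f' v"
  unfolding dd_def using frechet_derivative_at by metis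

lemma smooth_differentiable: "smooth f \<Longrightarrow> f differentiable (at x)"
  unfolding smooth_def
  by (metis times_differentiable.simps(2) differentiable_on_def UNIV_I)

lemma smooth_has_derivative: "smooth f \<Longrightarrow> (f has_derivative (\<lambda>v. dd v f x)) (at x)"
  unfolding dd_def using smooth_differentiable frechet_derivative_works by blast

lemma smooth_dd: "smooth f \<Longrightarrow> smooth (dd v f)"
  unfolding smooth_def dd_def by (metis times_differentiable.simps(2))

lemma smooth_continuous_on: "smooth f \<Longrightarrow> continuous_on S f"
  unfolding smooth_def by (metis times_differentiable.simps(1) continuous_on_subset subset_UNIV)

text \<open>\<open>times_differentiable\<close> is defined by recursion on the order, so a direct
  proof of smoothness would be an induction for every construction. It is enough to name a class of
  differentiable functions that is closed under directional derivatives.\<close>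

lemma smooth_coinduct:
  assumes "P f" and d: "\<And>f x. P f \<Longrightarrow> f differentiable (at x)" and "\<And>f v. P f \<Longrightarrow> P (dd v f)"
  shows "smooth f"
proof -
  have "P f \<Longrightarrow> times_differentiable n f" for n f
  proof (induction n arbitrary: f)
    case 0
    then show ?case
      using d differentiable_imp_continuous_on[of f UNIV] by (simp add: differentiable_on_def)
  next
    case (Suc n)
    then show ?case using assms by (auto simp: differentiable_on_def dd_def[abs_def])
  qed
  then show ?thesis using assms(1) by (simp add: smooth_def)
qed

lemma linear_dd: "smooth f \<Longrightarrow> linear (\<lambda>v. dd v f x)"
  using smooth_has_derivative has_derivative_linear by blast

lemma dd_add_dir: "smooth f \<Longrightarrow> dd (u + v) f x = dd u f x + dd v f x"
  by (simp add: linear_add[OF linear_dd])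

lemma dd_scaleR_dir: "smooth f \<Longrightarrow> dd (r *\<^sub>R v) f x = r * dd v f x"
  using linear_scale[OF linear_dd, of f r v x] by (simp add: scaleR_conv_of_real)

lemma dd_const [simp]: "dd v (\<lambda>x. c) = (\<lambda>x. 0)"
  by (rule ext, rule dd_eqI) auto

lemma smooth_const [simp]: "smooth (\<lambda>x. c)"
  by (rule smooth_coinduct[where P = "\<lambda>f. \<exists>c. f = (\<lambda>x. c)"]) auto

lemma dd_add: "smooth f \<Longrightarrow> smooth g \<Longrightarrow> dd v (\<lambda>x. f x + g x) = (\<lambda>x. dd v f x + dd v g x)"
  by (rule ext, rule dd_eqI) (auto intro!: derivative_eq_intros smooth_has_derivative)

lemma smooth_add [simp]: "smooth f \<Longrightarrow> smooth g \<Longrightarrow> smooth (\<lambda>x. f x + g x)"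
proof (rule smooth_coinduct[where P = "\<lambda>h. \<exists>f g. smooth f \<and> smooth g \<and> h = (\<lambda>x. f x + g x)"], goal_cases)
  case (2 h x)
  then show ?case using differentiable_add smooth_differentiable by blast
next
  case (3 h v)
  then show ?case by (metis dd_add smooth_dd)
qed blast+

lemma dd_mult: "smooth f \<Longrightarrow> smooth g \<Longrightarrow> dd v (\<lambda>x. f x * g x) = (\<lambda>x. f x * dd v g x + dd v f x * g x)"
  by (rule ext, rule dd_eqI) (auto intro!: derivative_eq_intros smooth_has_derivative)

text \<open>The class of products is not closed under \<open>dd\<close>, because the product rule
  yields a sum of two products; hence an induction on the order instead of
  \<open>smooth_coinduct\<close>.\<close>

lemma times_differentiable_mult:
  "smooth f \<Longrightarrow> smooth g \<Longrightarrow> times_differentiable n (\<lambda>x. f x * g x)"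
proof (induction n arbitrary: f g)
  case 0
  then show ?case by (simp add: continuous_on_mult smooth_continuous_on[of f] smooth_continuous_on[of g])
next
  case (Suc n)
  \<comment> \<open>Additivity is needed at the single order \<open>n\<close>, since the induction
    hypothesis says nothing about higher orders.\<close>
  have add: "times_differentiable n f \<Longrightarrow> times_differentiable n g \<Longrightarrow> times_differentiable n (\<lambda>x. f x + g x)"
    for n f g
  proof (induction n arbitrary: f g)
    case 0
    then show ?case by (auto intro!: continuous_intros)
  next
    case (Suc n)
    then have *: "(f has_derivative frechet_derivative f (at x)) (at x)"
      "(g has_derivative frechet_derivative g (at x)) (at x)" for x
      by (auto simp: differentiable_on_def frechet_derivative_works)
    have "frechet_derivative (\<lambda>x. f x + g x) (at x) v = frechet_derivative f (at x) v + frechet_derivative g (at x) v" for x v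
      using dd_eqI[OF has_derivative_add[OF *]] by (simp add: dd_def)
    then show ?case using Suc by (auto intro!: differentiable_on_add)
  qed
  have "times_differentiable n (dd v (\<lambda>x. f x * g x))" for v
    unfolding dd_mult[OF Suc.prems] by (intro add Suc.IH Suc.prems smooth_dd)
  then show ?case
    using Suc.prems using differentiable_mult[OF smooth_differentiable smooth_differentiable]
    by (auto simp: dd_def[abs_def] differentiable_on_def)
qed

lemma smooth_mult [simp]: "smooth f \<Longrightarrow> smooth g \<Longrightarrow> smooth (\<lambda>x. f x * g x)"
  unfolding smooth_def[of "\<lambda>x. f x * g x"] using times_differentiable_mult by blast

lemma dd_cmult [simp]: "smooth f \<Longrightarrow> dd v (\<lambda>x. c * f x) = (\<lambda>x. c * dd v f x)"
  by (simp add: dd_mult)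

lemma smooth_minus [simp]: "smooth f \<Longrightarrow> smooth (\<lambda>x. - f x)"
  using smooth_mult[of "\<lambda>x. - 1" f] by simp

lemma dd_minus [simp]: "smooth f \<Longrightarrow> dd v (\<lambda>x. - f x) = (\<lambda>x. - dd v f x)"
  using dd_cmult[of f v "- 1"] by simp

lemma smooth_diff [simp]: "smooth f \<Longrightarrow> smooth g \<Longrightarrow> smooth (\<lambda>x. f x - g x)"
  using smooth_add[of f "\<lambda>x. - g x"] by simp

lemma dd_diff: "smooth f \<Longrightarrow> smooth g \<Longrightarrow> dd v (\<lambda>x. f x - g x) = (\<lambda>x. dd v f x - dd v g x)"
  using dd_add[of f "\<lambda>x. - g x"] by simp

lemma smooth_sum [simp]: "(\<And>i. i \<in> I \<Longrightarrow> smooth (f i)) \<Longrightarrow> smooth (\<lambda>x. \<Sum>i\<in>I. f i x)"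
  by (induction I rule: infinite_finite_induct) auto

lemma dd_sum: "(\<And>i. i \<in> I \<Longrightarrow> smooth (f i)) \<Longrightarrow> dd v (\<lambda>x. \<Sum>i\<in>I. f i x) = (\<lambda>x. \<Sum>i\<in>I. dd v (f i) x)"
  by (induction I rule: infinite_finite_induct) (auto simp: dd_add)

lemma dd_linear: "bounded_linear f \<Longrightarrow> dd v f = (\<lambda>x. f v)"
  by (rule ext, rule dd_eqI) (rule bounded_linear_imp_has_derivative)

lemma smooth_linear: "bounded_linear f \<Longrightarrow> smooth f"
proof (rule smooth_coinduct[where P = "\<lambda>h. smooth h \<or> bounded_linear h"], goal_cases)
  case (2 f x)
  then show ?case
    using smooth_differentiable bounded_linear_imp_differentiable by blast
qed (auto simp: dd_linear smooth_dd)

lemma dd_cnj: "smooth f \<Longrightarrow> dd v (\<lambda>x. cnj (f x)) = (\<lambda>x. cnj (dd v f x))"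
  by (rule ext, rule dd_eqI) (auto intro!: derivative_eq_intros smooth_has_derivative)

lemma smooth_cnj: "smooth f \<Longrightarrow> smooth (\<lambda>x. cnj (f x))"
proof (rule smooth_coinduct[where P = "\<lambda>h. \<exists>f. smooth f \<and> h = (\<lambda>x. cnj (f x))"], goal_cases)
  case (2 h x)
  then obtain f where f: "smooth f" "h = (\<lambda>x. cnj (f x))" by blast
  have "((\<lambda>x. cnj (f x)) has_derivative (\<lambda>v. cnj (dd v f x))) (at x)"
    by (auto intro!: derivative_eq_intros smooth_has_derivative f(1))
  then show ?case using f(2) differentiableI by blast
next
  case (3 h v)
  then show ?case by (metis dd_cnj smooth_dd)
qed auto

lemma smooth_line_derivative:
  assumes "smooth f"
  shows "((\<lambda>s. f (x + s *\<^sub>R a)) has_vector_derivative dd a f (x + s *\<^sub>R a)) (at s within S)"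
proof -
  have "((\<lambda>s. x + s *\<^sub>R a) has_derivative (\<lambda>s. s *\<^sub>R a)) (at s within S)"
    by (auto intro!: derivative_eq_intros)
  from has_derivative_compose[OF this smooth_has_derivative[OF assms]]
  show ?thesis
    unfolding has_vector_derivative_def using dd_scaleR_dir[OF assms] by (simp add: scaleR_conv_of_real)
qed

lemma bounded_linear_component: "bounded_linear (\<lambda>x::cvec. x $ i)"
  by (rule bounded_linear_vec_nth)

lemma smooth_component [simp]: "smooth (\<lambda>x. x $ i)"
  by (rule smooth_linear[OF bounded_linear_component])

lemma dd_component [simp]: "dd v (\<lambda>x. x $ i) = (\<lambda>x. v $ i)"
  by (rule dd_linear[OF bounded_linear_component])

lemma zero_dd_imp_constant:
  assumes "smooth f" and "\<And>x. dd a f x = 0"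
  shows "f (x + a) = f x"
proof -
  have "((\<lambda>s. f (x + s *\<^sub>R a)) has_vector_derivative 0) (at s within {0..1})" for s
    using smooth_line_derivative[OF assms(1), of x a s "{0..1}"] assms(2) by simp
  then have "f (x + s *\<^sub>R a) = f (x + 0 *\<^sub>R a)" if "s \<in> {0..1}" for s
    using has_vector_derivative_zero_constant[of "{0..1}" "\<lambda>s. f (x + s *\<^sub>R a)"] that
    by (metis atLeastAtMost_iff convex_real_interval(5) order.refl zero_le_one)
  from this[of 1] show ?thesis by simp
qed

section \<open>Integrals over parameters\<close>

text \<open>The weight \<open>k\<close> and the displacement \<open>l\<close> are left open so that
  one differentiation lemma serves averages along segments, Fourier coefficients, and convolutions
  over the unit square.\<close>

definition pint ::
    "'t::euclidean_space set \<Rightarrow> ('t \<Rightarrow> complex) \<Rightarrow> ('t \<Rightarrow> cvec) \<Rightarrow> (cvec \<Rightarrow> complex) \<Rightarrow> cvec \<Rightarrow> complex" where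
  "pint C k l f x = integral C (\<lambda>t. k t * f (x + l t))"

lemma pint_has_derivative:
  fixes k :: "'t::euclidean_space \<Rightarrow> complex"
  assumes f: "smooth f" and k: "continuous_on (cbox a b) k" and l: "continuous_on (cbox a b) l"
  shows "(pint (cbox a b) k l f has_derivative (\<lambda>v. pint (cbox a b) k l (dd v f) x)) (at x)"
proof -
  \<comment> \<open>The Leibniz rule takes the derivative as an element of the space of bounded
    linear maps, jointly continuous in point and parameter; in finite dimensions it is enough to
    check this on each vector.\<close>
  define fx where "fx x t = Blinfun (\<lambda>v. k t * dd v f (x + l t))" for x t
  have bl: "bounded_linear (\<lambda>v. k t * dd v f (x + l t))" for x t
    using linear_conv_bounded_linear linear_dd[OF f]
    by (metis bounded_linear_const_mult)
  have ap: "blinfun_apply (fx x t) = (\<lambda>v. k t * dd v f (x + l t))" for x t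
    unfolding fx_def by (rule bounded_linear_Blinfun_apply[OF bl])
  have c1: "continuous_on (UNIV \<times> cbox a b) (\<lambda>(x, t). k t * g (x + l t))" if "smooth g" for g
    unfolding case_prod_unfold
    by (intro continuous_intros continuous_on_compose2[OF k] continuous_on_compose2[OF l]
        continuous_on_compose2[OF smooth_continuous_on[OF that, of UNIV]]) auto
  have cont: "continuous_on (UNIV \<times> cbox a b) (\<lambda>(x, t). fx x t)"
    unfolding case_prod_unfold
    by (rule continuous_on_blinfun_componentwise)
      (use c1[OF smooth_dd[OF f]] in \<open>simp add: ap case_prod_unfold\<close>)
  have ct: "continuous_on (cbox a b) (\<lambda>t. fx x t)" for x
    using continuous_on_compose2[OF cont continuous_on_Pair[OF continuous_on_const continuous_on_id], of  x "cbox a b"]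
    by auto
  have ci: "continuous_on (cbox a b) (\<lambda>t. k t * f (x + l t))" for x
    using continuous_on_compose2[OF c1[OF f] continuous_on_Pair[OF continuous_on_const continuous_on_id], of  x "cbox a b"]
    by auto
  have "((\<lambda>x. integral (cbox a b) (\<lambda>t. k t * f (x + l t))) has_derivative
      integral (cbox a b) (fx x)) (at x within UNIV)"
  proof (rule leibniz_rule[OF _ _ cont])
    fix x t
    have "((\<lambda>x. x + l t) has_derivative (\<lambda>x. x)) (at x)"
      by (auto intro!: derivative_eq_intros)
    from has_derivative_compose[OF this smooth_has_derivative[OF f]]
    show "((\<lambda>x. k t * f (x + l t)) has_derivative blinfun_apply (fx x t)) (at x within UNIV)"
      unfolding ap by (auto intro!: derivative_eq_intros)
  qed (auto intro: integrable_continuous[OF ci])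
  moreover have "blinfun_apply (integral (cbox a b) (fx x)) v = pint (cbox a b) k l (dd v f) x" for v
    using integral_linear[OF integrable_continuous[OF ct], of "\<lambda>B. blinfun_apply B v" x]
    by (simp add: pint_def o_def ap blinfun.bounded_linear_left)
  ultimately show ?thesis unfolding pint_def[abs_def] by (metis (no_types, lifting) ext pint_def)
qed

lemma dd_pint:
  fixes k :: "'t::euclidean_space \<Rightarrow> complex"
  assumes "smooth f" "continuous_on (cbox a b) k" "continuous_on (cbox a b) l"
  shows "dd v (pint (cbox a b) k l f) = pint (cbox a b) k l (dd v f)"
  by (rule ext, rule dd_eqI, rule pint_has_derivative[OF assms])

lemma smooth_pint:
  fixes k :: "'t::euclidean_space \<Rightarrow> complex"
  assumes "smooth f" and k: "continuous_on (cbox a b) k" and l: "continuous_on (cbox a b) l"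
  shows "smooth (pint (cbox a b) k l f)"
proof (rule smooth_coinduct[where P = "\<lambda>h. \<exists>f. smooth f \<and> h = pint (cbox a b) k l f"], goal_cases)
  case (2 h x)
  then show ?case using pint_has_derivative[OF _ k l] differentiableI by blast
next
  case (3 h v)
  then show ?case by (metis dd_pint[OF _ k l] smooth_dd)
qed (use assms in auto)

lemma pint_integrable:
  fixes k :: "'t::euclidean_space \<Rightarrow> complex"
  assumes "smooth f" "continuous_on (cbox a b) k" "continuous_on (cbox a b) l"
  shows "(\<lambda>t. k t * f (x + l t)) integrable_on (cbox a b)"
  by (intro integrable_continuous continuous_intros assms
      continuous_on_compose2[OF smooth_continuous_on[OF assms(1), of UNIV]]) auto

lemma pint_add:
  fixes k :: "'t::euclidean_space \<Rightarrow> complex"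
  assumes "smooth f" "smooth g" "continuous_on (cbox a b) k" "continuous_on (cbox a b) l"
  shows "pint (cbox a b) k l (\<lambda>x. f x + g x) x = pint (cbox a b) k l f x + pint (cbox a b) k l g x"
  unfolding pint_def
  by (subst integral_add[symmetric]) (auto simp: algebra_simps intro: pint_integrable assms)

lemma pint_cmult: "pint C k l (\<lambda>x. c * f x) x = c * pint C k l f x"
  unfolding pint_def by (subst integral_mult_right[symmetric]) (simp add: mult.left_commute)

lemma pint_zero [simp]: "pint C k l (\<lambda>x. 0) x = 0"
  by (simp add: pint_def)

lemma pint_sum:
  fixes k :: "'t::euclidean_space \<Rightarrow> complex"
  assumes "\<And>i. i \<in> I \<Longrightarrow> smooth (f i)" "continuous_on (cbox a b) k" "continuous_on (cbox a b) l"
  shows "pint (cbox a b) k l (\<lambda>x. \<Sum>i\<in>I. f i x) x = (\<Sum>i\<in>I. pint (cbox a b) k l (f i) x)"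
  using assms by (induction I rule: infinite_finite_induct) (auto simp: pint_add)

section \<open>Invariant forms in coordinates\<close>

text \<open>The center of the group consists of the elements with z1 = z2 = 0; in coordinates it
  acts by plain translation.\<close>

definition zc :: "complex \<Rightarrow> cvec" where
  "zc c = axis 3 c"

lemma zc_nth [simp]: "zc c $ i = (if i = 3 then c else 0)"
  by (simp add: zc_def axis_def)

lemma zc_nth' [simp]: "zc c $ 1 = 0" "zc c $ 2 = 0" "zc c $ 3 = c"
  by (simp_all add: zc_def axis_def)

lemma zc_0 [simp]: "zc 0 = 0"
  by (simp add: vec_eq_iff)

lemma zc_scaleR: "zc (r *\<^sub>R c) = r *\<^sub>R zc c"
  by (simp add: vec_eq_iff)

lemma zc_expand: "zc c = Re c *\<^sub>R zc 1 + Im c *\<^sub>R zc \<i>"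
  by (simp add: vec_eq_iff complex_eq_iff)

text \<open>The differential of left translation by an element with first coordinate
  \<open>c\<close>; it is the same at every point.\<close>

definition sh :: "complex \<Rightarrow> cvec \<Rightarrow> cvec" where
  "sh c u = u + zc (c * u $ 2)"

definition gvec :: "cvec \<Rightarrow> bool" where
  "gvec w \<longleftrightarrow> (\<forall>i. w $ i \<in> gaussian_ints)"

definition ginv :: "form \<Rightarrow> bool" where
  "ginv \<omega> \<longleftrightarrow> (\<forall>w x v. gvec w \<longrightarrow> \<omega> (x + w + zc (w $ 1 * x $ 2)) (\<lambda>i. sh (w $ 1) (v i)) = \<omega> x v)"

lemma ltrans_heis: "ltrans (heis w) z = z + w + zc (w $ 1 * z $ 2)"
  by (simp add: ltrans_def heis_def heis_coord_def matrix_matrix_mult_def vec_eq_iff forall_3 sum_3)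

lemma frechet_ltrans_heis: "frechet_derivative (ltrans (heis w)) (at x) = sh (w $ 1)"
proof -
  have "linear (\<lambda>z::cvec. zc (w $ 1 * z $ 2))"
    by (rule linearI) (simp_all add: vec_eq_iff distrib_left)
  then have "((\<lambda>z. zc (w $ 1 * z $ 2)) has_derivative (\<lambda>z. zc (w $ 1 * z $ 2))) (at (x::cvec))"
    by (simp add: linear_conv_bounded_linear bounded_linear_imp_has_derivative)
  then have "((\<lambda>z. z + w + zc (w $ 1 * z $ 2)) has_derivative (\<lambda>z. z + 0 + zc (w $ 1 * z $ 2))) (at x)"
    by (rule has_derivative_add[OF has_derivative_add[OF has_derivative_ident has_derivative_const]])
  then have "((\<lambda>z. z + w + zc (w $ 1 * z $ 2)) has_derivative sh (w $ 1)) (at x)"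
    unfolding sh_def[abs_def] by simp
  then show ?thesis
    unfolding ltrans_heis[abs_def] by (rule frechet_derivative_at[symmetric])
qed

lemma heis_lattice_eq: "heis_lattice = heis ` {w. gvec w}"
proof -
  have "0 \<in> gaussian_ints" "1 \<in> gaussian_ints" by (auto simp: gaussian_ints_def)
  then have "(\<forall>i j. heis w $ i $ j \<in> gaussian_ints) \<longleftrightarrow> gvec w" for w
    by (auto simp: heis_def gvec_def forall_3)
  then show ?thesis by (auto simp: heis_lattice_def heis_group_def)
qed

definition smoothf :: "form \<Rightarrow> bool" where
  "smoothf \<omega> \<longleftrightarrow> (\<forall>v. smooth (\<lambda>x. \<omega> x v))"

lemma smoothfD: "smoothf \<omega> \<Longrightarrow> smooth (\<lambda>x. \<omega> x v)"
  by (simp add: smoothf_def)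

lemma is_form_iff: "is_form k \<omega> \<longleftrightarrow> (\<forall>x. is_covector k (\<omega> x)) \<and> smoothf \<omega> \<and> ginv \<omega>"
proof -
  have "(\<forall>g\<in>heis_lattice. pullback (ltrans g) \<omega> = \<omega>) \<longleftrightarrow> ginv \<omega>"
    unfolding heis_lattice_eq ginv_def pullback_def
    by (auto simp: frechet_ltrans_heis ltrans_heis fun_eq_iff)
  then show ?thesis by (simp add: is_form_def smoothf_def)
qed

lemma is_formD:
  assumes "is_form k \<omega>"
  shows "is_covector k (\<omega> x)" "smoothf \<omega>" "ginv \<omega>"
  using assms by (auto simp: is_form_iff)

lemma is_covectorI:
  assumes "\<And>v w. (\<And>i. i < k \<Longrightarrow> v i = w i) \<Longrightarrow> \<phi> v = \<phi> w"
    and "\<And>v i. i < k \<Longrightarrow> linear (\<lambda>u. \<phi> (v(i := u)))"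
    and "\<And>v i j. i < k \<Longrightarrow> j < k \<Longrightarrow> i \<noteq> j \<Longrightarrow> v i = v j \<Longrightarrow> \<phi> v = 0"
  shows "is_covector k \<phi>"
  unfolding is_covector_def using assms by metis

lemma is_covectorD:
  assumes "is_covector k \<phi>"
  shows "(\<And>i. i < k \<Longrightarrow> v i = w i) \<Longrightarrow> \<phi> v = \<phi> w"
    and "i < k \<Longrightarrow> linear (\<lambda>u. \<phi> (v(i := u)))"
    and "i < k \<Longrightarrow> j < k \<Longrightarrow> i \<noteq> j \<Longrightarrow> v i = v j \<Longrightarrow> \<phi> v = 0"
  using assms unfolding is_covector_def by metis+

lemma is_covector_add:
  "is_covector k \<phi> \<Longrightarrow> is_covector k \<psi> \<Longrightarrow> is_covector k (\<lambda>v. \<phi> v + \<psi> v)"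
proof (rule is_covectorI)
  fix v w :: "nat \<Rightarrow> cvec"
  assume "is_covector k \<phi>" "is_covector k \<psi>" "\<And>i. i < k \<Longrightarrow> v i = w i"
  then show "\<phi> v + \<psi> v = \<phi> w + \<psi> w" using is_covectorD(1) by metis
next
  fix v i
  assume "is_covector k \<phi>" "is_covector k \<psi>" "i < k"
  then show "linear (\<lambda>u. \<phi> (v(i := u)) + \<psi> (v(i := u)))"
    by (intro linear_compose_add is_covectorD(2))
next
  fix v :: "nat \<Rightarrow> cvec" and i j
  assume "is_covector k \<phi>" "is_covector k \<psi>" "i < k" "j < k" "i \<noteq> j" "v i = v j"
  then show "\<phi> v + \<psi> v = 0" using is_covectorD(3) by (metis add.right_neutral)
qed

lemma is_covector_cmult: "is_covector k \<phi> \<Longrightarrow> is_covector k (\<lambda>v. c * \<phi> v)"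
proof (rule is_covectorI)
  fix v i
  assume "is_covector k \<phi>" "i < k"
  from is_covectorD(2)[OF this, of v] show "linear (\<lambda>u. c * \<phi> (v(i := u)))"
    by (simp add: linear_iff distrib_left)
next
  fix v w :: "nat \<Rightarrow> cvec"
  assume "is_covector k \<phi>" "\<And>i. i < k \<Longrightarrow> v i = w i"
  then show "c * \<phi> v = c * \<phi> w" using is_covectorD(1) by metis
next
  fix v :: "nat \<Rightarrow> cvec" and i j
  assume "is_covector k \<phi>" "i < k" "j < k" "i \<noteq> j" "v i = v j"
  then show "c * \<phi> v = 0" using is_covectorD(3) by (metis mult_zero_right)
qed

lemma is_covector_zero: "is_covector k (\<lambda>v. 0)"
  by (auto simp: is_covector_def linear_iff)

lemma is_form_add: "is_form k \<omega> \<Longrightarrow> is_form k \<eta> \<Longrightarrow> is_form k (\<lambda>x v. \<omega> x v + \<eta> x v)"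
  by (auto simp: is_form_iff is_covector_add smoothf_def ginv_def)

lemma is_form_cmult: "is_form k \<omega> \<Longrightarrow> is_form k (\<lambda>x v. c * \<omega> x v)"
  by (auto simp: is_form_iff is_covector_cmult smoothf_def ginv_def)

lemma is_form_zero: "is_form k (\<lambda>x v. 0)"
  by (auto simp: is_form_iff is_covector_zero smoothf_def ginv_def)

lemma is_form_sum: "(\<And>i. i \<in> I \<Longrightarrow> is_form k (\<omega> i)) \<Longrightarrow> is_form k (\<lambda>x v. \<Sum>i\<in>I. \<omega> i x v)"
  by (induction I rule: infinite_finite_induct) (auto simp: is_form_zero is_form_add)

text \<open>A common generalization of \<open>d\<close> and \<open>dbar\<close>; see \<open>ext_deriv_eq\<close> and \<open>dbar_eq\<close>.\<close>

definition dg :: "complex \<Rightarrow> complex \<Rightarrow> cvec \<Rightarrow> (cvec \<Rightarrow> complex) \<Rightarrow> cvec \<Rightarrow> complex" where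
  "dg p q u f x = p * dd u f x + q * dd (\<i> *s u) f x"

definition ext_gen :: "complex \<Rightarrow> complex \<Rightarrow> nat \<Rightarrow> form \<Rightarrow> form" where
  "ext_gen p q k \<omega> = (\<lambda>x v. \<Sum>i\<le>k. (- 1) ^ i * dg p q (v i) (\<lambda>y. \<omega> y (omit i v)) x)"

lemma ext_deriv_eq: "ext_deriv = ext_gen 1 0"
  by (simp add: fun_eq_iff ext_deriv_def ext_gen_def dg_def dd_def)

lemma dbar_fun_eq: "dbar_fun f x u = dg (1/2) (\<i>/2) u f x"
  by (simp add: dbar_fun_def dg_def dd_def add_divide_distrib)

lemma dbar_eq: "dbar = ext_gen (1/2) (\<i>/2)"
  by (simp add: fun_eq_iff dbar_def ext_gen_def dbar_fun_eq)

lemma dg_add: "smooth f \<Longrightarrow> smooth g \<Longrightarrow> dg p q u (\<lambda>x. f x + g x) x = dg p q u f x + dg p q u g x"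
  by (simp add: dg_def dd_add algebra_simps)

lemma dg_cmult: "smooth f \<Longrightarrow> dg p q u (\<lambda>x. c * f x) x = c * dg p q u f x"
  by (simp add: dg_def algebra_simps)

lemma dg_mult: "smooth f \<Longrightarrow> smooth g \<Longrightarrow>
    dg p q u (\<lambda>x. f x * g x) x = f x * dg p q u g x + dg p q u f x * g x"
  by (simp add: dg_def dd_mult algebra_simps)

lemma dg_const [simp]: "dg p q u (\<lambda>x. c) x = 0"
  by (simp add: dg_def)

lemma dg_sum: "(\<And>i. i \<in> I \<Longrightarrow> smooth (f i)) \<Longrightarrow> dg p q u (\<lambda>x. \<Sum>i\<in>I. f i x) x = (\<Sum>i\<in>I. dg p q u (f i) x)"
  by (induction I rule: infinite_finite_induct) (auto simp: dg_add)

lemma smooth_dg [simp]: "smooth f \<Longrightarrow> smooth (dg p q u f)"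
  unfolding dg_def[abs_def] by (simp add: smooth_dd)

lemma dg_pint:
  fixes k :: "'t::euclidean_space \<Rightarrow> complex"
  assumes "smooth f" "continuous_on (cbox a b) k" "continuous_on (cbox a b) l"
  shows "dg p q u (pint (cbox a b) k l f) x = pint (cbox a b) k l (dg p q u f) x"
  using assms unfolding dg_def[abs_def]
  by (simp add: dd_pint pint_add pint_cmult smooth_dd)

lemma ext_gen_add:
  "smoothf \<omega> \<Longrightarrow> smoothf \<eta> \<Longrightarrow>
    ext_gen p q k (\<lambda>x v. \<omega> x v + \<eta> x v) = (\<lambda>x v. ext_gen p q k \<omega> x v + ext_gen p q k \<eta> x v)"
  by (simp add: ext_gen_def dg_add smoothfD sum.distrib algebra_simps fun_eq_iff)

lemma ext_gen_cmult:
  "smoothf \<omega> \<Longrightarrow> ext_gen p q k (\<lambda>x v. c * \<omega> x v) = (\<lambda>x v. c * ext_gen p q k \<omega> x v)"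
  by (simp add: ext_gen_def dg_cmult smoothfD sum_distrib_left algebra_simps fun_eq_iff)

lemma ext_gen_zero: "ext_gen p q k (\<lambda>x v. 0) = (\<lambda>x v. 0)"
  by (simp add: ext_gen_def)

section \<open>Averages and insertions\<close>

text \<open>Only the base point is translated. For a central \<open>a\<close> this is already the
  average over left translations; in other directions the shear of the arguments has to be added,
  which \<open>LA\<close> does.\<close>

definition avg :: "(real \<Rightarrow> complex) \<Rightarrow> cvec \<Rightarrow> form \<Rightarrow> form" where
  "avg k a \<omega> = (\<lambda>x v. pint (cbox 0 1) k (\<lambda>s. s *\<^sub>R a) (\<lambda>y. \<omega> y v) x)"

definition Zinv :: "form \<Rightarrow> bool" where
  "Zinv \<omega> \<longleftrightarrow> (\<forall>x c. \<omega> (x + zc c) = \<omega> x)"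

lemma continuous_scaleR_line [simp]: "continuous_on S (\<lambda>s::real. s *\<^sub>R (a::cvec))"
  by (intro continuous_intros)

lemma smoothf_avg: "smoothf \<omega> \<Longrightarrow> continuous_on (cbox 0 1) k \<Longrightarrow> smoothf (avg k a \<omega>)"
  unfolding smoothf_def avg_def by (auto intro!: smooth_pint simp del: box_real)

lemma Zinv_avg: "Zinv \<omega> \<Longrightarrow> Zinv (avg k a \<omega>)"
proof -
  assume "Zinv \<omega>"
  then have "\<omega> (x + zc c + u) = \<omega> (x + u)" for x c u
    unfolding Zinv_def by (metis add.assoc add.commute)
  then show ?thesis unfolding Zinv_def avg_def pint_def by simp
qed

lemma is_covector_avg:
  assumes "\<And>x. is_covector n (\<omega> x)" "smoothf \<omega>" "continuous_on (cbox 0 1) k"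
  shows "is_covector n (avg k a \<omega> x)"
proof -
  have "avg k a \<omega> x v = avg k a \<omega> x w" if "\<forall>i<n. v i = w i" for v w
  proof -
    have "\<omega> y v = \<omega> y w" for y
      using is_covectorD(1)[OF assms(1)[of y]] that by blast
    then show ?thesis by (simp add: avg_def)
  qed
  moreover have "linear (\<lambda>u. avg k a \<omega> x (v(i := u)))" if "i < n" for v i
  proof -
    have l: "linear (\<lambda>u. \<omega> y (v(i := u)))" for y
      using is_covectorD(2)[OF assms(1)[of y] that] .
    show ?thesis
      unfolding avg_def
      by (rule linearI)
        (simp_all add: linear_add[OF l] linear_scale[OF l] pint_add smoothfD[OF assms(2)] assms(3)
         scaleR_conv_of_real[where 'a = complex] pint_cmult del: box_real)
  qed
  moreover have "avg k a \<omega> x v = 0" if "i < n" "j < n" "i \<noteq> j" "v i = v j" for v i j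
  proof -
    have "\<omega> y v = 0" for y
      using is_covectorD(3)[where v = v, OF assms(1)[of y] that] .
    then show ?thesis by (simp add: avg_def)
  qed
  ultimately show ?thesis by (intro is_covectorI) blast+
qed

text \<open>Translation by \<open>s *\<^sub>R a\<close> commutes with the action of a lattice
  element up to the central vector \<open>zc (w $ 1 * (s *\<^sub>R a) $ 2)\<close>, which vanishes
  in the first case and acts trivially in the second.\<close>

lemma ginv_avg:
  fixes a :: cvec
  assumes "ginv \<omega>" "a $ 2 = 0 \<or> Zinv \<omega>"
  shows "ginv (avg k a \<omega>)"
proof -
  have "\<omega> (x + w + zc (w $ 1 * x $ 2) + s *\<^sub>R a) (\<lambda>i. sh (w $ 1) (v i)) = \<omega> (x + s *\<^sub>R a) v"
    if "gvec w" for w x v s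
  proof -
    have "\<omega> (x + w + zc (w $ 1 * x $ 2) + s *\<^sub>R a) =
        \<omega> (x + s *\<^sub>R a + w + zc (w $ 1 * (x + s *\<^sub>R a) $ 2))"
    proof (cases "a $ 2 = 0")
      case False
      then have "Zinv \<omega>" using assms by simp
      moreover have "x + w + zc (w $ 1 * x $ 2) + s *\<^sub>R a = x + s *\<^sub>R a + w + zc (w $ 1 * x $ 2)"
        by (simp add: algebra_simps)
      ultimately show ?thesis unfolding Zinv_def by metis
    qed (simp add: algebra_simps)
    then show ?thesis using assms(1) that unfolding ginv_def by metis
  qed
  then show ?thesis unfolding ginv_def avg_def pint_def by simp
qed

lemma is_form_avg:
  fixes a :: cvec
  assumes "is_form n \<omega>" "a $ 2 = 0 \<or> Zinv \<omega>" "continuous_on (cbox 0 1) k"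
  shows "is_form n (avg k a \<omega>)"
  using assms is_covector_avg ginv_avg smoothf_avg unfolding is_form_iff by blast

lemma avg_add: "smoothf \<omega> \<Longrightarrow> smoothf \<eta> \<Longrightarrow> continuous_on (cbox 0 1) k \<Longrightarrow>
   avg k a (\<lambda>x v. \<omega> x v + \<eta> x v) x v = avg k a \<omega> x v + avg k a \<eta> x v"
  unfolding avg_def by (simp add: pint_add smoothfD del: box_real)

lemma avg_sum: "(\<And>i. i \<in> I \<Longrightarrow> smoothf (\<omega> i)) \<Longrightarrow> continuous_on (cbox 0 1) k \<Longrightarrow>
   avg k a (\<lambda>x v. \<Sum>i\<in>I. \<omega> i x v) x v = (\<Sum>i\<in>I. avg k a (\<omega> i) x v)"
  unfolding avg_def by (simp add: pint_sum smoothfD del: box_real)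

lemma ext_gen_avg:
  assumes "smoothf \<omega>" "continuous_on (cbox 0 1) k"
  shows "ext_gen p q n (avg k a \<omega>) = avg k a (ext_gen p q n \<omega>)"
proof (intro ext)
  fix x v
  have "ext_gen p q n (avg k a \<omega>) x v = (\<Sum>i\<le>n. (- 1) ^ i *
      pint (cbox 0 1) k (\<lambda>s. s *\<^sub>R a) (dg p q (v i) (\<lambda>y. \<omega> y (omit i v))) x)"
    unfolding ext_gen_def avg_def
    by (intro sum.cong refl arg_cong[where f = "\<lambda>z. _ * z"] dg_pint smoothfD assms continuous_scaleR_line)
  also have "\<dots> = avg k a (ext_gen p q n \<omega>) x v"
    unfolding ext_gen_def avg_def using assms
    by (subst pint_sum) (auto simp: pint_cmult smoothfD simp del: box_real intro!: smooth_mult smooth_dg)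
  finally show "ext_gen p q n (avg k a \<omega>) x v = avg k a (ext_gen p q n \<omega>) x v" .
qed

text \<open>The derivation of the exterior algebra induced by an endomorphism \<open>B\<close> of
  the tangent space: the derivative at s = 0 of applying 1 + s B to all arguments.\<close>

definition ins :: "nat \<Rightarrow> (cvec \<Rightarrow> cvec) \<Rightarrow> form \<Rightarrow> form" where
  "ins k B \<omega> = (\<lambda>x v. \<Sum>j<k. \<omega> x (v(j := B (v j))))"

text \<open>The product of any two such endomorphisms is zero, so their derivations commute, and
  they are nilpotent in degrees two and three.\<close>

definition central :: "(cvec \<Rightarrow> cvec) \<Rightarrow> bool" where
  "central B \<longleftrightarrow> linear B \<and> (\<forall>u. \<exists>c. B u = zc c) \<and> (\<forall>c. B (zc c) = 0)"

lemma central_linear: "central B \<Longrightarrow> linear B"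
  by (simp add: central_def)

lemma central_sh: "central B \<Longrightarrow> B (sh c u) = B u"
  by (simp add: central_def sh_def linear_add)

lemma sh_central: "central B \<Longrightarrow> sh c (B u) = B u"
  unfolding central_def by (metis add.right_neutral mult_zero_right sh_def zc_0 zc_nth'(2))

lemma central_central: "central B \<Longrightarrow> central C \<Longrightarrow> B (C u) = 0"
  unfolding central_def by metis

lemma smoothf_ins: "smoothf \<omega> \<Longrightarrow> smoothf (ins k B \<omega>)"
  by (simp add: smoothf_def ins_def)

lemma Zinv_ins: "Zinv \<omega> \<Longrightarrow> Zinv (ins k B \<omega>)"
  by (simp add: Zinv_def ins_def fun_eq_iff)

lemma ginv_ins:
  assumes "ginv \<omega>" "central B"
  shows "ginv (ins k B \<omega>)"
proof -
  have "(\<lambda>i. sh c (v i))(j := B (sh c (v j))) = (\<lambda>i. sh c ((v(j := B (v j))) i))" for c v j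
    using assms(2) by (auto simp: central_sh sh_central fun_eq_iff)
  note e = this
  have "\<omega> (x + w + zc (w $ 1 * x $ 2)) ((\<lambda>i. sh (w $ 1) (v i))(j := B (sh (w $ 1) (v j)))) = \<omega> x (v(j := B (v j)))"
    if "gvec w" for w x v j
    using assms(1) that unfolding e ginv_def by blast
  then show ?thesis
    unfolding ginv_def ins_def by simp
qed

lemma is_covector_alt_swap:
  assumes "is_covector k \<phi>" "i < k" "j < k" "i \<noteq> j"
  shows "\<phi> (v(i := a, j := b)) = - \<phi> (v(i := b, j := a))"
proof -
  have l: "linear (\<lambda>u. \<phi> (v(i := u)))" if "i < k" for v i
    using is_covectorD(2)[OF assms(1) that] .
  have z: "\<phi> (v(i := u, j := u)) = 0" for u
    by (rule is_covectorD(3)[OF assms(1-3)]) (use assms(4) in auto)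
  have e1: "\<phi> (v(i := u, j := a + b)) = \<phi> (v(i := u, j := a)) + \<phi> (v(i := u, j := b))" for u
    using linear_add[OF l[OF assms(3)]] by metis
  have e2: "\<phi> (v(i := a + b, j := u)) = \<phi> (v(i := a, j := u)) + \<phi> (v(i := b, j := u))" for u
    using linear_add[OF l[OF assms(2), of "v(j := u)"], of a b] assms(4)
    by (simp add: fun_upd_twist)
  show ?thesis
    using z[of "a + b"] z[of a] z[of b] unfolding e1 e2 by (simp add: eq_neg_iff_add_eq_0 add.commute)
qed

lemma is_covector_ins:
  assumes c: "is_covector k (\<omega> x)" and B: "linear B"
  shows "is_covector k (ins k B \<omega> x)"
proof -
  have l: "linear (\<lambda>u. \<omega> x (v(i := u)))" if "i < k" for v i
    using is_covectorD(2)[OF c that] .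
  have ex: "\<omega> x v = \<omega> x w" if "\<forall>i<k. v i = w i" for v w
    using is_covectorD(1)[OF c] that by blast
  have z: "\<omega> x v = 0" if "i < k" "j < k" "i \<noteq> j" "v i = v j" for v i j
    using is_covectorD(3)[OF c that(1-3), of v] that(4) .
  have "ins k B \<omega> x v = ins k B \<omega> x w" if "\<forall>i<k. v i = w i" for v w
    unfolding ins_def by (rule sum.cong) (auto intro!: ex simp: that)
  moreover have "linear (\<lambda>u. ins k B \<omega> x (v(i := u)))" if i: "i < k" for v i
    unfolding ins_def
  proof (rule linear_compose_sum, rule ballI)
    fix j assume j: "j \<in> {..<k}"
    show "linear (\<lambda>u. \<omega> x ((v(i := u))(j := B ((v(i := u)) j))))"
    proof (cases "j = i")
      case True
      then show ?thesis using linear_compose[OF B l[OF i, of v]] by (simp add: o_def)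
    next
      case False
      then show ?thesis using l[OF i, of "v(j := B (v j))"] by (simp add: fun_upd_twist)
    qed
  qed
  moreover have "ins k B \<omega> x v = 0" if ij: "i < k" "j < k" "i \<noteq> j" "v i = v j" for v i j
  proof -
    \<comment> \<open>With \<open>v i = v j\<close>, an insertion elsewhere keeps two equal
      arguments, and the insertions at \<open>i\<close> and \<open>j\<close> cancel by
      antisymmetry.\<close>
    have "\<omega> x (v(l := B (v l))) = 0" if "l < k" "l \<noteq> i" "l \<noteq> j" for l
      using z[of i j "v(l := B (v l))"] that ij by auto
    moreover have "\<omega> x (v(i := B (v i))) = - \<omega> x (v(j := B (v j)))"
      using is_covector_alt_swap[OF c ij(1-3), of v "B (v i)" "v i"] ij(4) fun_upd_triv[of v i]
        fun_upd_twist[OF ij(3), of v "B (v i)"] by simp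
    ultimately show ?thesis
      unfolding ins_def
      by (subst sum.mono_neutral_right[of _ "{i, j}"]) (use ij in auto)
  qed
  ultimately show ?thesis by (intro is_covectorI) blast+
qed

lemma is_form_ins: "is_form k \<omega> \<Longrightarrow> central B \<Longrightarrow> is_form k (ins k B \<omega>)"
  unfolding is_form_iff using is_covector_ins ginv_ins smoothf_ins central_linear by blast

lemma ins_avg:
  "smoothf \<omega> \<Longrightarrow> continuous_on (cbox 0 1) w \<Longrightarrow> ins k B (avg w a \<omega>) = avg w a (ins k B \<omega>)"
  unfolding ins_def fun_eq_iff
  by (subst avg_sum) (auto simp: smoothf_def avg_def)

text \<open>Two insertions in the same slot give zero in either order, because the product of the
  endomorphisms is zero; insertions in different slots commute.\<close>

lemma ins_commute:
  assumes "\<And>x. is_covector k (\<omega> x)" "central B" "central C"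
  shows "ins k B (ins k C \<omega>) = ins k C (ins k B \<omega>)"
proof (intro ext)
  fix x v
  have 0: "\<omega> x (v(j := 0)) = 0" if "j < k" for v j
    using linear_0[OF is_covectorD(2)[OF assms(1)[of x] that]] .
  have "\<omega> x (v(j := B (v j), i := C ((v(j := B (v j))) i))) =
      \<omega> x (v(i := C (v i), j := B ((v(i := C (v i))) j)))" if "i < k" "j < k" for i j
    using that assms(2,3) by (cases "i = j") (auto simp: central_central 0 fun_upd_twist)
  then show "ins k B (ins k C \<omega>) x v = ins k C (ins k B \<omega>) x v"
    unfolding ins_def by (subst sum.swap) (auto intro!: sum.cong)
qed

text \<open>The increasing enumeration of the indices other than \<open>i\<close>;
  \<open>omit i v\<close> is \<open>v\<close> composed with it, so a sum over the slots of
  \<open>v\<close> can be compared with one over the slots of \<open>omit i v\<close>.\<close>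

definition skip :: "nat \<Rightarrow> nat \<Rightarrow> nat" where
  "skip i j = (if j < i then j else Suc j)"

lemma omit_skip: "omit i v j = v (skip i j)"
  by (simp add: omit_def skip_def)

lemma omit_upd_skip: "omit i (v(skip i j := u)) = (omit i v)(j := u)"
  by (auto simp: omit_def skip_def fun_eq_iff)

lemma sum_skip:
  fixes f :: "nat \<Rightarrow> complex"
  assumes "i \<le> k"
  shows "(\<Sum>l<Suc k. f l) = f i + (\<Sum>j<k. f (skip i j))"
proof -
  have inj: "inj_on (skip i) {..<k}" by (auto simp: inj_on_def skip_def split: if_splits)
  have "{..<Suc k} - {i} = skip i ` {..<k}"
  proof
    show "{..<Suc k} - {i} \<subseteq> skip i ` {..<k}"
    proof
      fix l assume l: "l \<in> {..<Suc k} - {i}"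
      show "l \<in> skip i ` {..<k}"
      proof (cases "l < i")
        case True then show ?thesis using assms by (intro image_eqI[of _ _ l]) (auto simp: skip_def)
      next
        case False then show ?thesis using l by (intro image_eqI[of _ _ "l - 1"]) (auto simp: skip_def)
      qed
    qed
  qed (use assms in \<open>auto simp: skip_def split: if_splits\<close>)
  then show ?thesis
    using assms by (subst sum.remove[of _ i]) (auto simp: sum.reindex[OF inj])
qed

lemma dg_central_dir:
  assumes "Zinv \<omega>" "smoothf \<omega>"
  shows "dg p q (zc c) (\<lambda>y. \<omega> y v) x = 0"
proof -
  have d: "dd (zc c) (\<lambda>y. \<omega> y v) x = 0" for c
  proof -
    have "((\<lambda>s. \<omega> (x + s *\<^sub>R zc c) v) has_vector_derivative dd (zc c) (\<lambda>y. \<omega> y v) (x + 0 *\<^sub>R zc c)) (at 0)"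
      by (rule smooth_line_derivative[OF smoothfD[OF assms(2)]])
    moreover have "(\<lambda>s. \<omega> (x + s *\<^sub>R zc c) v) = (\<lambda>s. \<omega> x v)"
      using assms(1) unfolding Zinv_def by (metis zc_scaleR)
    ultimately show ?thesis
      using has_vector_derivative_const vector_derivative_at by (metis add.right_neutral scaleR_zero_left)
  qed
  moreover have "\<i> *s zc c = zc (\<i> * c)" by (simp add: vec_eq_iff)
  ultimately show ?thesis by (simp add: dg_def)
qed

text \<open>\<open>B\<close> has constant coefficients, so it could fail to commute with the
  operator only where it hits the argument along which the form is differentiated. There it produces
  a derivative in a central direction, which is zero for a form invariant under the center.\<close>

lemma ext_gen_ins:
  assumes "Zinv \<omega>" "smoothf \<omega>" "central B"
  shows "ext_gen p q k (ins k B \<omega>) = ins (Suc k) B (ext_gen p q k \<omega>)"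
proof (intro ext)
  fix x v
  let ?t = "\<lambda>l i. (- 1) ^ i * dg p q ((v(l := B (v l))) i) (\<lambda>y. \<omega> y (omit i (v(l := B (v l))))) x"
  have "?t i i = 0" for i
    using assms(3) dg_central_dir[OF assms(1,2)] unfolding central_def by (metis fun_upd_same mult_zero_right)
  moreover have "?t (skip i j) i = (- 1) ^ i * dg p q (v i) (\<lambda>y. \<omega> y ((omit i v)(j := B (omit i v j)))) x" for i j
    by (simp only: omit_upd_skip omit_skip) (simp add: skip_def)
  ultimately have "(\<Sum>l<Suc k. ?t l i) =
      (\<Sum>j<k. (- 1) ^ i * dg p q (v i) (\<lambda>y. \<omega> y ((omit i v)(j := B (omit i v j)))) x)" if "i \<le> k" for i
    using sum_skip[OF that, of "\<lambda>l. ?t l i"] by simp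
  moreover have "ins (Suc k) B (ext_gen p q k \<omega>) x v = (\<Sum>i\<le>k. \<Sum>l<Suc k. ?t l i)"
    unfolding ins_def ext_gen_def by (rule sum.swap)
  ultimately show "ext_gen p q k (ins k B \<omega>) x v = ins (Suc k) B (ext_gen p q k \<omega>) x v"
    unfolding ins_def[of k] ext_gen_def
    by (simp add: dg_sum smoothfD[OF assms(2)] sum_distrib_left del: sum.lessThan_Suc)
qed

section \<open>Covectors of degree two and three\<close>

definition pr :: "cvec \<Rightarrow> cvec \<Rightarrow> nat \<Rightarrow> cvec" where
  "pr a b = (\<lambda>i. if i = 0 then a else b)"

definition tri :: "cvec \<Rightarrow> cvec \<Rightarrow> cvec \<Rightarrow> nat \<Rightarrow> cvec" where
  "tri a b c = (\<lambda>i. if i = 0 then a else if i = 1 then b else c)"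

lemma cov2: "is_covector 2 \<phi> \<Longrightarrow> \<phi> v = \<phi> (pr (v 0) (v 1))"
  by (rule is_covectorD(1)) (auto simp: pr_def numeral_2_eq_2 less_Suc_eq)

lemma cov3: "is_covector 3 \<phi> \<Longrightarrow> \<phi> v = \<phi> (tri (v 0) (v 1) (v 2))"
  by (rule is_covectorD(1)) (auto simp: tri_def numeral_3_eq_3 numeral_2_eq_2 less_Suc_eq)

lemma cov2_linear:
  assumes "is_covector 2 \<phi>"
  shows "linear (\<lambda>u. \<phi> (pr u b))" "linear (\<lambda>u. \<phi> (pr a u))"
proof -
  show "linear (\<lambda>u. \<phi> (pr u b))"
    using is_covectorD(2)[OF assms, of 0 "pr b b"] cov2[OF assms, of "(pr b b)(0 := _)"] by (simp add: pr_def)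
  show "linear (\<lambda>u. \<phi> (pr a u))"
    using is_covectorD(2)[OF assms, of 1 "pr a a"] cov2[OF assms, of "(pr a a)(Suc 0 := _)"] by (simp add: pr_def)
qed

lemma cov3_linear:
  assumes "is_covector 3 \<phi>"
  shows "linear (\<lambda>u. \<phi> (tri u b c))" "linear (\<lambda>u. \<phi> (tri a u c))" "linear (\<lambda>u. \<phi> (tri a b u))"
proof -
  show "linear (\<lambda>u. \<phi> (tri u b c))"
    using is_covectorD(2)[OF assms, of 0 "tri b b c"] cov3[OF assms, of "(tri b b c)(0 := _)"] by (simp add: tri_def)
  show "linear (\<lambda>u. \<phi> (tri a u c))"
    using is_covectorD(2)[OF assms, of 1 "tri a a c"] cov3[OF assms, of "(tri a a c)(Suc 0 := _)"] by (simp add: tri_def)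
  show "linear (\<lambda>u. \<phi> (tri a b u))"
    using is_covectorD(2)[OF assms, of 2 "tri a b c"] cov3[OF assms, of "(tri a b c)(2 := _)"] by (simp add: tri_def)
qed

lemmas cov2_add = cov2_linear(1)[THEN linear_add] cov2_linear(2)[THEN linear_add]
lemmas cov2_0 = cov2_linear(1)[THEN linear_0] cov2_linear(2)[THEN linear_0]
lemmas cov3_add = cov3_linear(1)[THEN linear_add] cov3_linear(2)[THEN linear_add] cov3_linear(3)[THEN linear_add]
lemmas cov3_scaleR = cov3_linear(1)[THEN linear_scale] cov3_linear(2)[THEN linear_scale] cov3_linear(3)[THEN linear_scale]
lemmas cov3_0 = cov3_linear(1)[THEN linear_0] cov3_linear(2)[THEN linear_0] cov3_linear(3)[THEN linear_0]

lemma cov2_alt: "is_covector 2 \<phi> \<Longrightarrow> \<phi> (pr a a) = 0"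
  by (rule is_covectorD(3)[of 2 \<phi> 0 1]) (auto simp: pr_def)

lemma cov3_alt:
  assumes "is_covector 3 \<phi>"
  shows "\<phi> (tri a a b) = 0" "\<phi> (tri a b a) = 0" "\<phi> (tri b a a) = 0"
  using is_covectorD(3)[OF assms, of 0 1 "tri a a b"] is_covectorD(3)[OF assms, of 0 2 "tri a b a"]
    is_covectorD(3)[OF assms, of 1 2 "tri b a a"] by (auto simp: tri_def)

lemma cov2_swap: "is_covector 2 \<phi> \<Longrightarrow> \<phi> (pr b a) = - \<phi> (pr a b)"
  using cov2_alt[of \<phi> "a + b"] by (simp add: cov2_add cov2_alt eq_neg_iff_add_eq_0 add.commute)

lemma cov3_swap:
  assumes "is_covector 3 \<phi>"
  shows "\<phi> (tri b a c) = - \<phi> (tri a b c)" "\<phi> (tri a c b) = - \<phi> (tri a b c)" "\<phi> (tri c b a) = - \<phi> (tri a b c)"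
  using cov3_alt(1)[OF assms, of "a + b" c] cov3_alt(3)[OF assms, of a "b + c"] cov3_alt(2)[OF assms, of "a + c" b]
  by (simp_all add: assms cov3_add cov3_alt eq_neg_iff_add_eq_0 add.commute)

text \<open>The center is two-dimensional over the reals.\<close>

lemma cov3_central: "is_covector 3 \<phi> \<Longrightarrow> \<phi> (tri (zc p) (zc q) (zc r)) = 0"
  unfolding zc_expand[of p] zc_expand[of q] zc_expand[of r]
  by (simp add: cov3_add cov3_scaleR cov3_alt)

lemma ins2: "is_covector 2 (\<omega> x) \<Longrightarrow> ins 2 B \<omega> x (pr a b) = \<omega> x (pr (B a) b) + \<omega> x (pr a (B b))"
  by (simp add: ins_def numeral_2_eq_2 cov2[of "\<omega> x" "(pr a b)(_ := _)"]) (simp add: pr_def)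

lemma ins3: "is_covector 3 (\<omega> x) \<Longrightarrow>
    ins 3 B \<omega> x (tri a b c) = \<omega> x (tri (B a) b c) + \<omega> x (tri a (B b) c) + \<omega> x (tri a b (B c))"
  by (simp add: ins_def numeral_3_eq_3 cov3[of "\<omega> x" "(tri a b c)(_ := _)", unfolded numeral_2_eq_2 numeral_3_eq_3] )
     (simp add: tri_def)

text \<open>Inserting twice in the same slot gives zero, so each application fills a new slot with a
  central vector. Three applications are too many in degree two, and in degree three they leave
  three central arguments, where \<open>cov3_central\<close> applies.\<close>

lemma ins_pow3:
  assumes k: "k = 2 \<or> k = 3" and c: "is_covector k (\<omega> x)" and B: "central B"
  shows "ins k B (ins k B (ins k B \<omega>)) x v = 0"
proof -
  have c': "is_covector n (ins n B \<eta> x)" if "is_covector n (\<eta> x)" for n \<eta>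
    by (rule is_covector_ins[where \<omega> = \<eta>, OF that central_linear[OF B]])
  obtain b where b: "B u = zc (b u)" for u using B unfolding central_def by metis
  have b0: "zc (b (zc p)) = 0" "B 0 = 0" "zc (b 0) = 0" for p
    using B b linear_0[OF central_linear[OF B]] unfolding central_def by metis+
  have bb: "B (B u) = 0" for u using central_central[OF B B] .
  show ?thesis
  proof (cases "k = 2")
    case True
    note c2 = c[unfolded True]
    note i1 = c'[of 2 \<omega>, OF c2] note i2 = c'[of 2 "ins 2 B \<omega>", OF i1]
      note i3 = c'[of 2 "ins 2 B (ins 2 B \<omega>)", OF i2]
    show ?thesis
      unfolding True by (subst cov2) (auto intro!: i3 simp: i1 i2 c2 ins2 bb b0 cov2_0[OF c2])
  next
    case False
    with k have k: "k = 3" by simp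
    note c3 = c[unfolded k]
    note i1 = c'[of 3 \<omega>, OF c3] note i2 = c'[of 3 "ins 3 B \<omega>", OF i1]
      note i3 = c'[of 3 "ins 3 B (ins 3 B \<omega>)", OF i2]
    show ?thesis
      unfolding k by (subst cov3) (auto intro!: i3 simp: i1 i2 c3 ins3 bb b0 cov3_0[OF c3] b cov3_central[OF c3])
  qed
qed

text \<open>Since \<open>B\<close> squares to zero, 1 + B is its exponential and acts on covectors
  by the exponential series of the derivation \<open>ins k B\<close>; by \<open>ins_pow3\<close> the
  series stops after the quadratic term.\<close>

lemma shear_expand:
  assumes k: "k = 2 \<or> k = 3" and c: "is_covector k (\<omega> x)" and B: "central B"
  shows "\<omega> x (\<lambda>i. v i + B (v i)) = \<omega> x v + ins k B \<omega> x v + ins k B (ins k B \<omega>) x v / 2"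
proof -
  have c': "is_covector n (ins n B \<eta> x)" if "is_covector n (\<eta> x)" for n \<eta>
    by (rule is_covector_ins[where \<omega> = \<eta>, OF that central_linear[OF B]])
  obtain b where b: "B u = zc (b u)" for u using B unfolding central_def by metis
  have b0: "zc (b (zc p)) = 0" "B 0 = 0" "zc (b 0) = 0" for p
    using B b linear_0[OF central_linear[OF B]] unfolding central_def by metis+
  have bb: "B (B u) = 0" for u using central_central[OF B B] .
  show ?thesis
  proof (cases "k = 2")
    case True
    note c2 = c[unfolded True]
    note i1 = c'[of 2 \<omega>, OF c2] note i2 = c'[of 2 "ins 2 B \<omega>", OF i1]
    show ?thesis
      unfolding True cov2[OF c2, of "\<lambda>i. _ i + _ i"] cov2[OF c2, of v] cov2[OF i1, of v] cov2[OF i2, of v]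
      by (simp add: ins2 i1 i2 c2 bb b0 cov2_0[OF c2] cov2_add[OF c2])
  next
    case False
    with k have k: "k = 3" by simp
    note c3 = c[unfolded k]
    note i1 = c'[of 3 \<omega>, OF c3] note i2 = c'[of 3 "ins 3 B \<omega>", OF i1]
    show ?thesis
      unfolding k cov3[OF c3, of "\<lambda>i. _ i + _ i"] cov3[OF c3, of v] cov3[OF i1, of v] cov3[OF i2, of v]
      by (simp add: ins3 i1 i2 c3 bb b0 cov3_0[OF c3] cov3_add[OF c3] b cov3_central[OF c3])
  qed
qed

section \<open>Averaging over left translations\<close>

text \<open>The maps 1 + \<open>NL a\<close> and 1 + \<open>NR a\<close> are the differentials of
  left and right translation by \<open>a\<close>. Their difference \<open>lie a\<close> is the
  bracket with \<open>a\<close> in the Heisenberg Lie algebra.\<close>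

definition NL :: "cvec \<Rightarrow> cvec \<Rightarrow> cvec" where
  "NL a u = zc (a $ 1 * u $ 2)"

definition NR :: "cvec \<Rightarrow> cvec \<Rightarrow> cvec" where
  "NR a u = zc (a $ 2 * u $ 1)"

definition lie :: "cvec \<Rightarrow> cvec \<Rightarrow> cvec" where
  "lie a u = zc (a $ 1 * u $ 2 - a $ 2 * u $ 1)"

lemma central_NL [simp]: "central (NL a)" and central_NR [simp]: "central (NR a)" and central_lie [simp]: "central (lie a)"
proof -
  have "central (\<lambda>u. zc (p * u $ 2 - q * u $ 1))" for p q :: complex
    unfolding central_def
  proof (intro conjI allI)
    show "linear (\<lambda>u. zc (p * u $ 2 - q * u $ 1))"
      by (rule linearI) (simp_all add: vec_eq_iff algebra_simps)
  qed auto
  from this[of "a $ 1" 0] this[of 0 "- a $ 2"] this[of "a $ 1" "a $ 2"]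
  show "central (NL a)" "central (NR a)" "central (lie a)"
    by (simp_all add: NL_def[abs_def] NR_def[abs_def] lie_def[abs_def])
qed

lemma ins_lie:
  assumes "is_covector k (\<omega> x)"
  shows "ins k (lie a) \<omega> x v = ins k (NL a) \<omega> x v - ins k (NR a) \<omega> x v"
proof -
  have "lie a u = NL a u - NR a u" for u by (simp add: lie_def NL_def NR_def vec_eq_iff)
  then show ?thesis
    by (simp add: ins_def linear_diff[OF is_covectorD(2)[OF assms]] sum_subtractf)
qed

text \<open>The average over left translations by \<open>s *\<^sub>R a\<close> with weight
  \<open>w s\<close>. The three terms are the series of \<open>shear_expand\<close> for
  \<open>s\<close> times \<open>NL a\<close>; the central part of the translated base point is left
  out, since the forms concerned are invariant under the center.\<close>

definition LA :: "nat \<Rightarrow> (real \<Rightarrow> complex) \<Rightarrow> cvec \<Rightarrow> form \<Rightarrow> form" where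
  "LA k w a \<omega> = (\<lambda>x v. avg w a \<omega> x v + avg (\<lambda>s. w s * complex_of_real s) a (ins k (NL a) \<omega>) x v +
      avg (\<lambda>s. w s * complex_of_real s ^ 2 / 2) a (ins k (NL a) (ins k (NL a) \<omega>)) x v)"

text \<open>The derivative along left translation by \<open>a\<close>, on forms invariant under the center.\<close>

definition Lder :: "nat \<Rightarrow> cvec \<Rightarrow> form \<Rightarrow> form" where
  "Lder k a \<omega> = (\<lambda>x v. dd a (\<lambda>y. \<omega> y v) x + ins k (NL a) \<omega> x v)"

abbreviation "contw w \<equiv> continuous_on (cbox 0 (1::real)) (w :: real \<Rightarrow> complex)"

lemma contw_mult: "contw w \<Longrightarrow> contw (\<lambda>s. w s * complex_of_real s)" "contw w \<Longrightarrow> contw (\<lambda>s. w s * complex_of_real s ^ 2 / 2)"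
  by (auto intro!: continuous_intros simp del: box_real)

lemma smoothf_add: "smoothf \<omega> \<Longrightarrow> smoothf \<eta> \<Longrightarrow> smoothf (\<lambda>x v. \<omega> x v + \<eta> x v)"
  by (simp add: smoothf_def)

lemma Zinv_add: "Zinv \<omega> \<Longrightarrow> Zinv \<eta> \<Longrightarrow> Zinv (\<lambda>x v. \<omega> x v + \<eta> x v)"
  by (simp add: Zinv_def)

lemma Zinv_LA: "Zinv \<omega> \<Longrightarrow> Zinv (LA k w a \<omega>)"
  unfolding LA_def by (intro Zinv_add Zinv_avg Zinv_ins)

lemma is_form_LA: "is_form k \<omega> \<Longrightarrow> Zinv \<omega> \<Longrightarrow> contw w \<Longrightarrow> is_form k (LA k w a \<omega>)"
  unfolding LA_def by (intro is_form_add is_form_avg is_form_ins contw_mult disjI2 Zinv_ins) auto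

lemma ext_gen_LA:
  assumes "smoothf \<omega>" "Zinv \<omega>" "contw w"
  shows "ext_gen p q k (LA k w a \<omega>) = LA (Suc k) w a (ext_gen p q k \<omega>)"
  unfolding LA_def
  by (simp add: ext_gen_add smoothf_add smoothf_avg smoothf_ins contw_mult assms ext_gen_avg ext_gen_ins Zinv_ins
      del: box_real)

lemma LA_add:
  assumes "smoothf \<omega>" "smoothf \<eta>" "contw w"
  shows "LA k w a (\<lambda>x v. \<omega> x v + \<eta> x v) x v = LA k w a \<omega> x v + LA k w a \<eta> x v"
proof -
  have i: "ins k B (\<lambda>x v. \<omega> x v + \<eta> x v) = (\<lambda>x v. ins k B \<omega> x v + ins k B \<eta> x v)" for \<omega> \<eta> B
    by (simp add: ins_def fun_eq_iff sum.distrib)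
  show ?thesis
    unfolding LA_def i by (simp add: avg_add smoothf_ins assms contw_mult del: box_real)
qed

lemma ins_zero: "ins k B (\<lambda>x v. 0) = (\<lambda>x v. 0)"
  by (simp add: ins_def)

lemma avg_zero: "avg w a (\<lambda>x v. 0) = (\<lambda>x v. 0)"
  by (simp add: avg_def fun_eq_iff del: box_real)

lemma LA_zero: "LA k w a (\<lambda>x v. 0) = (\<lambda>x v. 0)"
  by (simp add: LA_def ins_zero avg_zero)

lemma LA_integral:
  assumes "smoothf \<omega>" "contw w"
  shows "((\<lambda>s. w s * (\<omega> (x + s *\<^sub>R a) v + s * ins k (NL a) \<omega> (x + s *\<^sub>R a) v +
      complex_of_real s ^ 2 / 2 * ins k (NL a) (ins k (NL a) \<omega>) (x + s *\<^sub>R a) v)) has_integral LA k w a \<omega> x v) {0..1}"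
proof -
  have I: "((\<lambda>s. u s * \<eta> (x + s *\<^sub>R a) v) has_integral avg u a \<eta> x v) (cbox 0 1)" if "smoothf \<eta>" "contw u" for u \<eta>
    unfolding avg_def pint_def
    by (rule integrable_integral, rule pint_integrable[OF smoothfD[OF that(1)] that(2) continuous_scaleR_line])
  show ?thesis
    using has_integral_add[OF has_integral_add[OF I[OF assms] I[OF smoothf_ins[OF assms(1)] contw_mult(1)[OF assms(2)]]]
        I[OF smoothf_ins[OF smoothf_ins[OF assms(1)]] contw_mult(2)[OF assms(2)]]]
    by (simp add: LA_def algebra_simps)
qed

lemma smoothf_dd: "smoothf \<omega> \<Longrightarrow> smoothf (\<lambda>x v. dd a (\<lambda>y. \<omega> y v) x)"
  by (simp add: smoothf_def smooth_dd)

lemma smoothf_Lder: "smoothf \<omega> \<Longrightarrow> smoothf (Lder k a \<omega>)"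
  unfolding Lder_def by (intro smoothf_add smoothf_dd smoothf_ins)

lemma ins_Lder:
  assumes "smoothf \<omega>" "\<And>x. is_covector k (\<omega> x)" "central B"
  shows "ins k B (Lder k a \<omega>) = Lder k a (ins k B \<omega>)"
proof -
  have "ins k B (Lder k a \<omega>) x v = dd a (\<lambda>y. ins k B \<omega> y v) x + ins k B (ins k (NL a) \<omega>) x v" for x v
    by (simp add: ins_def Lder_def dd_sum smoothfD[OF assms(1)] sum.distrib)
  then show ?thesis
    using ins_commute[OF assms(2,3) central_NL] by (simp add: Lder_def fun_eq_iff)
qed

context
  fixes k :: nat and a :: cvec and \<omega> :: form
  assumes k: "k = 2 \<or> k = 3" and form: "is_form k \<omega>" and Z: "Zinv \<omega>"
begin

text \<open>\<open>g x v\<close> is the left translate of the form by \<open>s *\<^sub>R a\<close>,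
  as a function of the time \<open>s\<close>, and \<open>h x v\<close> is that of its Lie
  derivative; \<open>h\<close> will turn out to be the derivative of \<open>g\<close>.\<close>

private definition "g x v s = \<omega> (x + s *\<^sub>R a) v + s * ins k (NL a) \<omega> (x + s *\<^sub>R a) v +
      complex_of_real s ^ 2 / 2 * ins k (NL a) (ins k (NL a) \<omega>) (x + s *\<^sub>R a) v" for s :: real

private definition "h x v s = Lder k a \<omega> (x + s *\<^sub>R a) v + s * ins k (NL a) (Lder k a \<omega>) (x + s *\<^sub>R a) v +
      complex_of_real s ^ 2 / 2 * ins k (NL a) (ins k (NL a) (Lder k a \<omega>)) (x + s *\<^sub>R a) v" for s :: real

private lemma deriv: "(g x v has_vector_derivative h x v s) (at s within S)"
proof -
  note c = is_formD(1)[OF form] and sm = is_formD(2)[OF form]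
  note ci = is_covector_ins[where \<omega> = \<omega>, OF c central_linear[OF central_NL]]
  have D: "((\<lambda>s. \<eta> (x + s *\<^sub>R a) v) has_vector_derivative dd a (\<lambda>y. \<eta> y v) (x + s *\<^sub>R a)) (at s within S)" if "smoothf \<eta>" for \<eta>
    by (rule smooth_line_derivative[OF smoothfD[OF that]])
  \<comment> \<open>\<open>h\<close> contains a third insertion with the factor s^2 / 2, which no
    term of \<open>g\<close> produces under differentiation.\<close>
  have 3: "ins k (NL a) (ins k (NL a) (ins k (NL a) \<omega>)) x v = 0" for x v
    by (rule ins_pow3[OF k c central_NL])
  have e1: "h x v s = Lder k a \<omega> (x + s *\<^sub>R a) v + s * Lder k a (ins k (NL a) \<omega>) (x + s *\<^sub>R a) v +
      complex_of_real s ^ 2 / 2 * Lder k a (ins k (NL a) (ins k (NL a) \<omega>)) (x + s *\<^sub>R a) v" for x v s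
    unfolding h_def
    by (simp add: ins_Lder[OF sm c] ins_Lder[OF smoothf_ins[OF sm] ci])
  have s: "((\<lambda>s. complex_of_real s) has_vector_derivative 1) (at s within S)"
    by (auto intro!: derivative_eq_intros)
  have s2: "((\<lambda>s. (complex_of_real s)\<^sup>2 / 2) has_vector_derivative s) (at s within S)"
    using has_vector_derivative_mult_right[OF has_vector_derivative_mult[OF s s], of "1/2"]
    by (simp add: power2_eq_square)
  show ?thesis
    unfolding g_def e1
    by (rule has_vector_derivative_eq_rhs[OF has_vector_derivative_add[OF has_vector_derivative_add[OF
          D[of \<omega>] has_vector_derivative_mult[OF s D[of "ins k (NL a) \<omega>"]]]
          has_vector_derivative_mult[OF s2 D[of "ins k (NL a) (ins k (NL a) \<omega>)"]]]])
       (simp_all add: Lder_def 3 algebra_simps sm smoothf_ins)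
qed

text \<open>The integral of the derivative of \<open>g\<close> over one period: for a lattice vector
  the translate at time 1 is the form itself.\<close>

lemma LA_Lder:
  assumes "gvec a" "a $ 3 = 0"
  shows "LA k (\<lambda>s. 1) a (Lder k a \<omega>) x v = 0"
proof -
  note c = is_formD(1)[OF form] and sm = is_formD(2)[OF form]
  have "((\<lambda>s. h x v s) has_integral g x v 1 - g x v 0) {0..1}"
    by (rule fundamental_theorem_of_calculus) (auto intro: deriv)
  moreover have "((\<lambda>s. h x v s) has_integral LA k (\<lambda>s. 1) a (Lder k a \<omega>) x v) {0..1}"
    using LA_integral[OF smoothf_Lder[OF sm], of "\<lambda>s. 1"] by (simp add: h_def)
  moreover have "g x v 1 = g x v 0"
  proof -
    have "(\<lambda>i. sh (a $ 1) (v i)) = (\<lambda>i. v i + NL a (v i))" by (simp add: sh_def NL_def)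
    moreover have "\<omega> (x + a + zc (a $ 1 * x $ 2)) = \<omega> (x + a)" using Z by (simp add: Zinv_def)
    ultimately have "\<omega> (x + a) (\<lambda>i. v i + NL a (v i)) = \<omega> x v"
      using is_formD(3)[OF form] assms(1) unfolding ginv_def by metis
    then show ?thesis using shear_expand[where x = "x + a" and v = v and \<omega> = \<omega>, OF k c central_NL] by (simp add: g_def)
  qed
  ultimately show ?thesis by (simp add: has_integral_unique)
qed

text \<open>Integration by parts: the weight is 1 at the start and 0 at the end, so only the
  boundary value at \<open>s = 0\<close> remains. The formula writes the change under averaging as
  an average of the Lie derivative, to which Cartan's formula can then be applied.\<close>

lemma LA_Lder_linear_weight: "LA k (\<lambda>s. 1 - complex_of_real s) a (Lder k a \<omega>) x v = LA k (\<lambda>s. 1) a \<omega> x v - \<omega> x v"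
proof -
  note c = is_formD(1)[OF form] and sm = is_formD(2)[OF form]
  have d: "((\<lambda>s. (1 - complex_of_real s) * g x v s) has_vector_derivative (1 - complex_of_real s) * h x v s + (- 1) * g x v s) (at s within S)" for s S
    by (rule has_vector_derivative_mult[OF _ deriv]) (auto intro!: derivative_eq_intros)
  have "((\<lambda>s. (1 - complex_of_real s) * h x v s + (- 1) * g x v s) has_integral (1 - complex_of_real 1) * g x v 1 - (1 - complex_of_real 0) * g x v 0) {0..1}"
    by (rule fundamental_theorem_of_calculus) (simp, rule d)
  moreover have "((\<lambda>s. (1 - complex_of_real s) * h x v s + (- 1) * g x v s) has_integral
      LA k (\<lambda>s. 1 - complex_of_real s) a (Lder k a \<omega>) x v + (-1) * LA k (\<lambda>s. 1) a \<omega> x v) {0..1}"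
    using has_integral_add[OF LA_integral[OF smoothf_Lder[OF sm], of "\<lambda>s. 1 - complex_of_real s" k a x a v k]
        has_integral_mult_right[OF LA_integral[OF sm, of "\<lambda>s. 1" x a v k], of "-1"]]
    by (simp add: h_def g_def continuous_intros)
  ultimately have "LA k (\<lambda>s. 1 - complex_of_real s) a (Lder k a \<omega>) x v + (-1) * LA k (\<lambda>s. 1) a \<omega> x v = - g x v 0"
    by (simp add: has_integral_unique)
  then show ?thesis by (simp add: g_def algebra_simps)
qed

end

text \<open>Left translations commute up to the center; infinitesimally, products of
  \<open>NL a\<close> and \<open>NL b\<close> vanish. So averages taken later keep the invariance
  obtained earlier.\<close>

lemma Lder_LA:
  assumes "is_form k \<omega>" "contw w"
  shows "Lder k b (LA k w a \<omega>) = LA k w a (Lder k b \<omega>)"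
proof -
  note c = is_formD(1)[OF assms(1)] and sm = is_formD(2)[OF assms(1)]
  have A: "Lder k b (avg u a \<eta>) = avg u a (Lder k b \<eta>)" if "smoothf \<eta>" "contw u" for u \<eta>
  proof -
    have "dd b (\<lambda>y. avg u a \<eta> y v) x = avg u a (\<lambda>x v. dd b (\<lambda>y. \<eta> y v) x) x v" for x v
      unfolding avg_def by (subst dd_pint) (auto simp: that smoothfD simp del: box_real)
    then show ?thesis
      unfolding Lder_def fun_eq_iff
      by (simp add: avg_add smoothf_dd smoothf_ins that ins_avg del: box_real)
  qed
  have B: "Lder k b (\<lambda>x v. \<omega> x v + \<eta> x v) = (\<lambda>x v. Lder k b \<omega> x v + Lder k b \<eta> x v)"
    if "smoothf \<omega>" "smoothf \<eta>" for \<omega> \<eta>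
    using that by (simp add: Lder_def dd_add smoothfD fun_eq_iff ins_def sum.distrib)
  note ci = is_covector_ins[where \<omega> = \<omega>, OF c central_linear[OF central_NL]]
  show ?thesis
    unfolding LA_def
    by (simp add: B A smoothf_add smoothf_avg smoothf_ins contw_mult assms sm ins_Lder[OF sm c]
       ins_Lder[OF smoothf_ins[OF sm] ci] del: box_real)
qed

section \<open>Averages over the center\<close>

lemma Zinv_iff_dd:
  assumes "smoothf \<omega>" "\<And>x v. dd (zc 1) (\<lambda>y. \<omega> y v) x = 0" "\<And>x v. dd (zc \<i>) (\<lambda>y. \<omega> y v) x = 0"
  shows "Zinv \<omega>"
proof -
  have "dd (zc c) (\<lambda>y. \<omega> y v) x = 0" for c x v
    unfolding zc_expand[of c] using assms by (simp add: dd_add_dir dd_scaleR_dir smoothfD)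
  then show ?thesis
    unfolding Zinv_def using zero_dd_imp_constant smoothfD[OF assms(1)] by blast
qed

text \<open>The unsheared counterparts of \<open>LA_Lder\<close> and
  \<open>LA_Lder_linear_weight\<close>, for use in central directions.\<close>

lemma avg_dd:
  assumes "smoothf \<omega>"
  shows "avg (\<lambda>s. 1) a (\<lambda>x v. dd a (\<lambda>y. \<omega> y v) x) x v = \<omega> (x + a) v - \<omega> x v"
    and "avg (\<lambda>s. 1 - complex_of_real s) a (\<lambda>x v. dd a (\<lambda>y. \<omega> y v) x) x v = avg (\<lambda>s. 1) a \<omega> x v - \<omega> x v"
proof -
  have I: "((\<lambda>s. u s * \<eta> (x + s *\<^sub>R a) v) has_integral avg u a \<eta> x v) {0..1}" if "smoothf \<eta>" "contw u" for u \<eta>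
    using integrable_integral[OF pint_integrable[OF smoothfD[OF that(1)] that(2) continuous_scaleR_line]]
    unfolding avg_def pint_def by simp
  note D = smooth_line_derivative[OF smoothfD[OF assms], of x a v]
  note d = smoothf_dd[OF assms, of a]
  have "((\<lambda>s. dd a (\<lambda>y. \<omega> y v) (x + s *\<^sub>R a)) has_integral \<omega> (x + 1 *\<^sub>R a) v - \<omega> (x + 0 *\<^sub>R a) v) {0..1}"
    by (rule fundamental_theorem_of_calculus) (auto intro: D)
  with I[OF d, of "\<lambda>s. 1"] show "avg (\<lambda>s. 1) a (\<lambda>x v. dd a (\<lambda>y. \<omega> y v) x) x v = \<omega> (x + a) v - \<omega> x v"
    by (simp add: has_integral_unique)
  have E: "((\<lambda>s. (1 - complex_of_real s) * \<omega> (x + s *\<^sub>R a) v) has_vector_derivative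
      (1 - complex_of_real s) * dd a (\<lambda>y. \<omega> y v) (x + s *\<^sub>R a) + (- 1) * \<omega> (x + s *\<^sub>R a) v) (at s within S)" for s S
    by (rule has_vector_derivative_mult[OF _ D]) (auto intro!: derivative_eq_intros)
  have "((\<lambda>s. (1 - complex_of_real s) * dd a (\<lambda>y. \<omega> y v) (x + s *\<^sub>R a) + (- 1) * \<omega> (x + s *\<^sub>R a) v) has_integral
      (1 - complex_of_real 1) * \<omega> (x + 1 *\<^sub>R a) v - (1 - complex_of_real 0) * \<omega> (x + 0 *\<^sub>R a) v) {0..1}"
    by (rule fundamental_theorem_of_calculus) (simp, rule E)
  moreover have "((\<lambda>s. (1 - complex_of_real s) * dd a (\<lambda>y. \<omega> y v) (x + s *\<^sub>R a) + (- 1) * \<omega> (x + s *\<^sub>R a) v) has_integral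
      avg (\<lambda>s. 1 - complex_of_real s) a (\<lambda>x v. dd a (\<lambda>y. \<omega> y v) x) x v + (-1) * avg (\<lambda>s. 1) a \<omega> x v) {0..1}"
    using has_integral_add[OF I[OF d, of "\<lambda>s. 1 - complex_of_real s"] has_integral_mult_right[OF I[OF assms, of "\<lambda>s. 1"], of "-1"]]
    by (simp add: continuous_intros)
  ultimately have "avg (\<lambda>s. 1 - complex_of_real s) a (\<lambda>x v. dd a (\<lambda>y. \<omega> y v) x) x v + (-1) * avg (\<lambda>s. 1) a \<omega> x v = - \<omega> x v"
    by (simp add: has_integral_unique)
  then show "avg (\<lambda>s. 1 - complex_of_real s) a (\<lambda>x v. dd a (\<lambda>y. \<omega> y v) x) x v = avg (\<lambda>s. 1) a \<omega> x v - \<omega> x v"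
    by (simp add: algebra_simps)
qed

text \<open>\<open>zc 1\<close> and \<open>zc \<i>\<close> generate the lattice points of the
  center, so on invariant forms this is the mean over the central torus.\<close>

definition cavg :: "form \<Rightarrow> form" where
  "cavg \<omega> = avg (\<lambda>s. 1) (zc \<i>) (avg (\<lambda>s. 1) (zc 1) \<omega>)"

lemma is_form_cavg: "is_form k \<omega> \<Longrightarrow> is_form k (cavg \<omega>)"
  unfolding cavg_def by (intro is_form_avg) auto

lemma gvec_zc: "gvec (zc c) \<longleftrightarrow> c \<in> gaussian_ints"
  by (auto simp: gvec_def gaussian_ints_def)

lemma ginv_shift:
  assumes "ginv \<omega>" "c \<in> gaussian_ints"
  shows "\<omega> (x + zc c) v = \<omega> x v"
proof -
  have "sh 0 = (\<lambda>u. u)" by (simp add: sh_def fun_eq_iff)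
  moreover have "\<omega> (x + zc c + zc (zc c $ 1 * x $ 2)) (\<lambda>i. sh (zc c $ 1) (v i)) = \<omega> x v"
    using assms unfolding ginv_def gvec_zc[symmetric] by blast
  ultimately show ?thesis by simp
qed

lemma Zinv_cavg:
  assumes "is_form k \<omega>"
  shows "Zinv (cavg \<omega>)"
proof -
  have g: "1 \<in> gaussian_ints" "\<i> \<in> gaussian_ints" by (auto simp: gaussian_ints_def)
  have A: "dd b (\<lambda>y. avg (\<lambda>s. 1) a \<eta> y v) x = avg (\<lambda>s. 1) a (\<lambda>x v. dd b (\<lambda>y. \<eta> y v) x) x v" if "smoothf \<eta>" for a b \<eta> x v
    unfolding avg_def by (subst dd_pint) (auto simp: that smoothfD simp del: box_real)
  have f: "is_form k (avg (\<lambda>s. 1) (zc 1) \<omega>)" using assms by (intro is_form_avg) auto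
  have z: "dd (zc 1) (\<lambda>y. avg (\<lambda>s. 1) (zc 1) \<omega> y v) x = 0" for x v
    by (simp add: A is_formD(2)[OF assms] avg_dd ginv_shift[OF is_formD(3)[OF assms] g(1)])
  show ?thesis
  proof (rule Zinv_iff_dd)
    show "smoothf (cavg \<omega>)" using is_formD(2) is_form_cavg assms by blast
    show "dd (zc 1) (\<lambda>y. cavg \<omega> y v) x = 0" for x v
      unfolding cavg_def by (simp add: A is_formD(2)[OF f] z avg_zero)
    show "dd (zc \<i>) (\<lambda>y. cavg \<omega> y v) x = 0" for x v
      unfolding cavg_def by (simp add: A is_formD(2)[OF f] avg_dd ginv_shift[OF is_formD(3)[OF f] g(2)])
  qed
qed

lemma cavg_Zinv: "Zinv \<omega> \<Longrightarrow> cavg \<omega> = \<omega>"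
proof -
  assume Z: "Zinv \<omega>"
  have "\<omega> (x + s *\<^sub>R zc c) = \<omega> x" for x s c
    using Z unfolding Zinv_def by (metis zc_scaleR)
  then show ?thesis by (simp add: cavg_def avg_def pint_def fun_eq_iff)
qed

lemma ext_gen_cavg: "smoothf \<omega> \<Longrightarrow> ext_gen p q k (cavg \<omega>) = cavg (ext_gen p q k \<omega>)"
  unfolding cavg_def by (simp add: ext_gen_avg smoothf_avg del: box_real)

section \<open>Forms invariant under all left translations\<close>

text \<open>Left invariance in infinitesimal form: the last clause says that \<open>Lder k a\<close>
  vanishes for all \<open>a\<close>. It turns derivatives of the form into algebra in its values at
  the same point.\<close>

definition Linv :: "nat \<Rightarrow> form \<Rightarrow> bool" where
  "Linv k \<omega> \<longleftrightarrow> Zinv \<omega> \<and> smoothf \<omega> \<and> (\<forall>x. is_covector k (\<omega> x)) \<and>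
     (\<forall>a x v. dd a (\<lambda>y. \<omega> y v) x = - ins k (NL a) \<omega> x v)"

text \<open>A real basis of a complement of the center, made of lattice vectors so that averaging up
  to time 1 is averaging over a full period.\<close>

definition horiz :: "cvec list" where
  "horiz = [axis 1 1, axis 1 \<i>, axis 2 1, axis 2 \<i>]"

text \<open>\<open>Lder k a\<close> is real-linear in \<open>a\<close> and vanishes for central
  \<open>a\<close>, so four directions suffice.\<close>

lemma LinvI:
  assumes "is_form k \<omega>" "Zinv \<omega>" "\<And>a. a \<in> set horiz \<Longrightarrow> Lder k a \<omega> = (\<lambda>x v. 0)"
  shows "Linv k \<omega>"
proof -
  note c = is_formD(1)[OF assms(1)] and sm = is_formD(2)[OF assms(1)]
  have e: "a = Re (a$1) *\<^sub>R axis 1 1 + Im (a$1) *\<^sub>R axis 1 \<i> + Re (a$2) *\<^sub>R axis 2 1 + Im (a$2) *\<^sub>R axis 2 \<i> + zc (a$3)" for a :: cvec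
    by (simp add: vec_eq_iff forall_3 axis_def complex_eq_iff)
  have "Lder k a \<omega> x v = 0" for a x v
  proof -
    have lin: "linear (\<lambda>a. Lder k a \<omega> x v)"
    proof -
      have "linear (\<lambda>a. \<omega> x (v(j := NL a (v j))))" if "j < k" for j
      proof -
        have "linear (\<lambda>a. NL a (v j))"
          by (rule linearI) (simp_all add: NL_def vec_eq_iff algebra_simps)
        from linear_compose[OF this is_covectorD(2)[OF c that]] show ?thesis by (simp add: o_def)
      qed
      then show ?thesis
        unfolding Lder_def ins_def
        by (intro linear_compose_add linear_dd smoothfD[OF sm] linear_compose_sum) auto
    qed
    have "Lder k (zc d) \<omega> x v = 0" for d
    proof -
      have "dd (zc d) (\<lambda>y. \<omega> y v) x = 0"
        using dg_central_dir[OF assms(2) sm, of 1 0 d v x] by (simp add: dg_def)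
      moreover have "ins k (NL (zc d)) \<omega> x v = 0"
        using linear_0[OF is_covectorD(2)[OF c]] by (simp add: ins_def NL_def)
      ultimately show ?thesis by (simp add: Lder_def)
    qed
    then show ?thesis
      using assms(3) unfolding horiz_def
      by (subst e[of a]) (simp add: linear_add[OF lin] linear_scale[OF lin])
  qed
  then show ?thesis
    unfolding Linv_def using assms(2) sm c by (simp add: Lder_def eq_neg_iff_add_eq_0)
qed

lemma Linv_Lder: "Linv k \<omega> \<Longrightarrow> Lder k a \<omega> = (\<lambda>x v. 0)"
  by (simp add: Linv_def Lder_def fun_eq_iff)

lemma horiz_simps: "a \<in> set horiz \<Longrightarrow> gvec a \<and> a $ 3 = 0"
  by (auto simp: horiz_def gvec_def gaussian_ints_def axis_def)

definition Lavg :: "nat \<Rightarrow> form \<Rightarrow> form" where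
  "Lavg k \<omega> = foldr (LA k (\<lambda>s. 1)) horiz (cavg \<omega>)"

text \<open>Each average kills its own Lie derivative by \<open>LA_Lder\<close> and preserves the
  vanishing of the earlier ones by \<open>Lder_LA\<close>.\<close>

lemma foldr_LA:
  assumes "k = 2 \<or> k = 3" "is_form k \<omega>" "Zinv \<omega>" "set as \<subseteq> set horiz"
  shows "is_form k (foldr (LA k (\<lambda>s. 1)) as \<omega>) \<and> Zinv (foldr (LA k (\<lambda>s. 1)) as \<omega>) \<and>
    (\<forall>a\<in>set as. Lder k a (foldr (LA k (\<lambda>s. 1)) as \<omega>) = (\<lambda>x v. 0))"
  using assms(4)
proof (induction as)
  case (Cons a as)
  define \<rho> where "\<rho> = foldr (LA k (\<lambda>s. 1)) as \<omega>"
  have \<rho>: "is_form k \<rho>" "Zinv \<rho>" "\<And>b. b \<in> set as \<Longrightarrow> Lder k b \<rho> = (\<lambda>x v. 0)"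
    using Cons unfolding \<rho>_def by auto
  have "Lder k b (LA k (\<lambda>s. 1) a \<rho>) = LA k (\<lambda>s. 1) a (Lder k b \<rho>)" for b
    using Lder_LA[OF \<rho>(1), of "\<lambda>s. 1"] by simp
  moreover have "LA k (\<lambda>s. 1) a (Lder k a \<rho>) = (\<lambda>x v. 0)"
    using LA_Lder[OF assms(1) \<rho>(1,2)] horiz_simps[of a] Cons.prems by (simp add: fun_eq_iff)
  ultimately show ?case
    using \<rho> by (simp flip: \<rho>_def add: is_form_LA Zinv_LA LA_zero)
qed (use assms in auto)

lemma Linv_Lavg: "k = 2 \<or> k = 3 \<Longrightarrow> is_form k \<omega> \<Longrightarrow> is_form k (Lavg k \<omega>) \<and> Linv k (Lavg k \<omega>)"
  using foldr_LA[of k "cavg \<omega>" horiz] LinvI[of k "Lavg k \<omega>"]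
  by (auto simp: is_form_cavg Zinv_cavg Lavg_def)

text \<open>For a form with zero Lie derivatives, \<open>LA_Lder_linear_weight\<close> says that the
  average minus the form is zero.\<close>

lemma Lavg_Linv:
  assumes "k = 2 \<or> k = 3" "is_form k \<omega>" "Linv k \<omega>"
  shows "Lavg k \<omega> = \<omega>"
proof -
  have Z: "Zinv \<omega>" using assms(3) by (simp add: Linv_def)
  have "LA k (\<lambda>s. 1) a \<omega> = \<omega>" for a
    using LA_Lder_linear_weight[OF assms(1,2) Z, where a = a]
    by (simp add: Linv_Lder[OF assms(3)] LA_zero fun_eq_iff)
  then have "foldr (LA k (\<lambda>s. 1)) as \<omega> = \<omega>" for as by (induction as) auto
  then show ?thesis by (simp add: Lavg_def cavg_Zinv Z)
qed

lemma ext_gen_Lavg: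
  assumes "is_form k \<omega>" "k = 2 \<or> k = 3"
  shows "ext_gen p q k (Lavg k \<omega>) = Lavg (Suc k) (ext_gen p q k \<omega>)"
proof -
  note sm = is_formD(2)[OF assms(1)]
  have "set as \<subseteq> set horiz \<Longrightarrow> ext_gen p q k (foldr (LA k (\<lambda>s. 1)) as (cavg \<omega>)) = foldr (LA (Suc k) (\<lambda>s. 1)) as (cavg (ext_gen p q k \<omega>))" for as
  proof (induction as)
    case Nil
    then show ?case by (simp add: ext_gen_cavg sm)
  next
    case (Cons a as)
    have "is_form k (foldr (LA k (\<lambda>s. 1)) as (cavg \<omega>))" "Zinv (foldr (LA k (\<lambda>s. 1)) as (cavg \<omega>))"
      using foldr_LA[OF assms(2) is_form_cavg[OF assms(1)] Zinv_cavg[OF assms(1)], of as] Cons.prems by auto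
    then show ?case
      using Cons ext_gen_LA[OF is_formD(2), of k "foldr (LA k (\<lambda>s. 1)) as (cavg \<omega>)" "\<lambda>s. 1" p q k a] by simp
  qed
  then show ?thesis by (simp add: Lavg_def)
qed

section \<open>Closed forms of degree three are cohomologous to their averages\<close>

text \<open>Contraction with the left-invariant vector field extending \<open>a\<close>, which generates right translations.\<close>

definition iV :: "cvec \<Rightarrow> form \<Rightarrow> form" where
  "iV a \<omega> = (\<lambda>x v. \<omega> x (case_nat (a + zc (x $ 1 * a $ 2)) v))"

lemma case_nat_upd: "case_nat u (v(i := t)) = (case_nat u v)(Suc i := t)" "(case_nat u v)(0 := t) = case_nat t v"
  by (auto simp: fun_eq_iff split: nat.splits)

lemma omit_case_nat: "omit 0 (case_nat u v) = v" "omit (Suc j) (case_nat u v) = case_nat u (omit j v)"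
  by (auto simp: omit_def fun_eq_iff split: nat.splits)

lemma cov_head_linear:
  assumes "is_covector (Suc k) \<phi>"
  shows "linear (\<lambda>u. \<phi> (case_nat u v))"
  using is_covectorD(2)[OF assms, of 0 "case_nat 0 v"] by (simp add: case_nat_upd)

text \<open>The field contracted in \<open>iV\<close> has the central coefficient
  \<open>x $ 1 * a $ 2\<close>. Covectors are only real-linear, so its real and imaginary parts
  enter as separate coefficients.\<close>

lemma smooth_Re_Im:
  "smooth (\<lambda>y::cvec. complex_of_real (Re (y $ 1 * c)))" "dd v (\<lambda>y. complex_of_real (Re (y $ 1 * c))) = (\<lambda>x. Re (v $ 1 * c))"
  "smooth (\<lambda>y::cvec. complex_of_real (Im (y $ 1 * c)))" "dd v (\<lambda>y. complex_of_real (Im (y $ 1 * c))) = (\<lambda>x. Im (v $ 1 * c))"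
proof -
  have "linear (\<lambda>y::cvec. complex_of_real (Re (y $ 1 * c)))" "linear (\<lambda>y::cvec. complex_of_real (Im (y $ 1 * c)))"
    by (rule linearI; simp add: algebra_simps scaleR_conv_of_real[where 'a = complex])+
  then show "smooth (\<lambda>y::cvec. complex_of_real (Re (y $ 1 * c)))" "dd v (\<lambda>y. complex_of_real (Re (y $ 1 * c))) = (\<lambda>x. Re (v $ 1 * c))"
  "smooth (\<lambda>y::cvec. complex_of_real (Im (y $ 1 * c)))" "dd v (\<lambda>y. complex_of_real (Im (y $ 1 * c))) = (\<lambda>x. Im (v $ 1 * c))"
    by (simp_all add: smooth_linear dd_linear linear_conv_bounded_linear)
qed

lemma iV_expand:
  fixes \<omega> :: form
  assumes "is_covector (Suc k) (\<omega> x)"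
  shows "iV a \<omega> x v = \<omega> x (case_nat a v) + complex_of_real (Re (x $ 1 * a $ 2)) * \<omega> x (case_nat (zc 1) v) +
    complex_of_real (Im (x $ 1 * a $ 2)) * \<omega> x (case_nat (zc \<i>) v)"
  unfolding iV_def zc_expand[of "x $ 1 * a $ 2"]
  using linear_add[OF cov_head_linear[OF assms]] linear_scale[OF cov_head_linear[OF assms]]
  by (simp add: scaleR_conv_of_real[where 'a = complex])

lemma smoothf_iV:
  fixes \<omega> :: form
  assumes "\<And>x. is_covector (Suc k) (\<omega> x)" "smoothf \<omega>"
  shows "smoothf (iV a \<omega>)"
  unfolding smoothf_def iV_expand[of k, OF assms(1)]
  by (intro allI smooth_add smooth_mult smooth_Re_Im smoothfD assms)

text \<open>The product rule for a contraction: first the form is differentiated with the field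
  frozen at \<open>x\<close>, then the field, whose derivative in direction \<open>b\<close> is
  \<open>NR a b\<close>.\<close>

lemma dd_iV:
  fixes \<omega> :: form
  assumes "\<And>x. is_covector (Suc k) (\<omega> x)" "smoothf \<omega>"
  shows "dd b (\<lambda>y. iV a \<omega> y v) x =
    dd b (\<lambda>y. \<omega> y (case_nat (a + zc (x $ 1 * a $ 2)) v)) x + \<omega> x (case_nat (NR a b) v)"
proof -
  have s: "smooth (\<lambda>y. \<omega> y w)" for w using assms(2) by (rule smoothfD)
  note l = linear_add[OF cov_head_linear[OF assms(1)]] linear_scale[OF cov_head_linear[OF assms(1)]]
  have 1: "\<omega> y (case_nat (a + zc c) v) = \<omega> y (case_nat a v) + complex_of_real (Re c) * \<omega> y (case_nat (zc 1) v) + complex_of_real (Im c) * \<omega> y (case_nat (zc \<i>) v)" for y c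
    unfolding zc_expand[of c] by (simp add: l scaleR_conv_of_real[where 'a = complex])
  have 2: "\<omega> x (case_nat (NR a b) v) = complex_of_real (Re (b $ 1 * a $ 2)) * \<omega> x (case_nat (zc 1) v) + complex_of_real (Im (b $ 1 * a $ 2)) * \<omega> x (case_nat (zc \<i>) v)"
    unfolding NR_def zc_expand[of "a $ 2 * b $ 1"] by (simp add: l scaleR_conv_of_real[where 'a = complex] mult.commute)
  define R where "R = (\<lambda>y::cvec. complex_of_real (Re (y $ 1 * a $ 2)))"
  define I where "I = (\<lambda>y::cvec. complex_of_real (Im (y $ 1 * a $ 2)))"
  have RI: "smooth R" "dd b R = (\<lambda>x. R b)" "smooth I" "dd b I = (\<lambda>x. I b)"
    unfolding R_def I_def by (simp_all only: smooth_Re_Im)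
  have 3: "iV a \<omega> y v = \<omega> y (case_nat a v) + R y * \<omega> y (case_nat (zc 1) v) + I y * \<omega> y (case_nat (zc \<i>) v)" for y
    unfolding R_def I_def by (rule iV_expand[of k, OF assms(1)])
  show ?thesis
    unfolding 1 2 3 unfolding R_def[symmetric, THEN fun_cong] R_def[THEN fun_cong, symmetric] I_def[THEN fun_cong, symmetric]
    by (simp add: dd_add dd_mult s RI algebra_simps)
qed

lemma is_form_iV:
  assumes "is_form (Suc k) \<omega>"
  shows "is_form k (iV a \<omega>)"
  unfolding is_form_iff
proof (intro conjI allI)
  note c = is_formD(1)[OF assms] and sm = is_formD(2)[OF assms]
  show "smoothf (iV a \<omega>)" by (rule smoothf_iV[OF c sm])
  show "is_covector k (iV a \<omega> x)" for x
  proof (rule is_covectorI)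
    show "iV a \<omega> x v = iV a \<omega> x w" if "\<And>i. i < k \<Longrightarrow> v i = w i" for v w
      unfolding iV_def by (rule is_covectorD(1)[OF c]) (use that in \<open>auto split: nat.splits\<close>)
    show "linear (\<lambda>u. iV a \<omega> x (v(i := u)))" if "i < k" for v i
      unfolding iV_def case_nat_upd by (rule is_covectorD(2)[OF c]) (use that in simp)
    show "iV a \<omega> x v = 0" if "i < k" "j < k" "i \<noteq> j" "v i = v j" for v i j
      unfolding iV_def by (rule is_covectorD(3)[OF c, of "Suc i" "Suc j"]) (use that in auto)
  qed
  show "ginv (iV a \<omega>)"
    unfolding ginv_def
  proof (intro allI impI)
    fix w x v assume w: "gvec w"
    let ?x = "x + w + zc (w $ 1 * x $ 2)"
    \<comment> \<open>The field is left-invariant: the differential of left translation carries its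
      value at \<open>x\<close> to its value at the image point.\<close>
    have "case_nat (a + zc (?x $ 1 * a $ 2)) (\<lambda>i. sh (w $ 1) (v i)) = (\<lambda>i. sh (w $ 1) (case_nat (a + zc (x $ 1 * a $ 2)) v i))"
      by (auto simp: fun_eq_iff sh_def vec_eq_iff algebra_simps split: nat.splits)
    then show "iV a \<omega> ?x (\<lambda>i. sh (w $ 1) (v i)) = iV a \<omega> x v"
      using is_formD(3)[OF assms] w unfolding iV_def ginv_def by metis
  qed
qed

lemma Zinv_iV: "Zinv \<omega> \<Longrightarrow> Zinv (iV a \<omega>)"
  by (simp add: Zinv_def iV_def)

text \<open>Closedness, evaluated with the field in the first slot, equates the derivative along the
  field with the exterior derivative of the contraction with frozen coefficients. The actual
  contraction also differentiates the field, and this gives the insertion of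
  \<open>NR a\<close>.\<close>

lemma Cartan:
  fixes a :: cvec
  assumes "is_form 3 \<omega>" and cl: "ext_gen 1 0 3 \<omega> = (\<lambda>x v. 0)" and Z: "Zinv \<omega> \<or> a $ 2 = 0"
  shows "ext_gen 1 0 2 (iV a \<omega>) x v = dd a (\<lambda>y. \<omega> y v) x + ins 3 (NR a) \<omega> x v"
proof -
  have c: "is_covector (Suc 2) (\<omega> x)" for x using is_formD(1)[OF assms(1)] by simp
  have c3: "is_covector 3 (\<omega> x)" for x using is_formD(1)[OF assms(1)] by simp
  note sm = is_formD(2)[OF assms(1)]
  define V where "V = a + zc (x $ 1 * a $ 2)"
  \<comment> \<open>The field differs from \<open>a\<close> by a central vector, along which the
    form is constant, unless \<open>a $ 2 = 0\<close>, where the field is \<open>a\<close>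
    itself.\<close>
  have V: "dd V (\<lambda>y. \<omega> y v) x = dd a (\<lambda>y. \<omega> y v) x"
  proof (cases "a $ 2 = 0")
    case False
    with Z have "dd (zc d) (\<lambda>y. \<omega> y v) x = 0" for d
      using dg_central_dir[of \<omega> 1 0 d v x] sm by (simp add: dg_def)
    then show ?thesis by (simp add: V_def dd_add_dir smoothfD[OF sm])
  qed (simp add: V_def)
  define T where "T j = dd (v j) (\<lambda>y. \<omega> y (case_nat V (omit j v))) x" for j
  \<comment> \<open>Moving the inserted vector from the first slot back to slot \<open>j\<close>
    costs the sign of a cycle of length \<open>j + 1\<close>.\<close>
  have S: "\<omega> x (case_nat (NR a (v j)) (omit j v)) = (- 1) ^ j * \<omega> x (v(j := NR a (v j)))" if "j \<le> 2" for j
  proof -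
    have "j = 0 \<or> j = 1 \<or> j = 2" using that by auto
    then show ?thesis
      unfolding cov3[OF c3[of x], of "case_nat _ _"] cov3[OF c3[of x], of "v(_ := _)"]
      using cov3_swap(1)[OF c3[of x], of "v 0" "NR a (v 1)" "v 2"] cov3_swap(1)[OF c3[of x], of "v 0" "NR a (v 2)" "v 1"]
        cov3_swap(2)[OF c3[of x], of "v 0" "v 1" "NR a (v 2)"]
      by (elim disjE) (simp_all add: omit_def numeral_2_eq_2)
  qed
  have S': "(- 1) ^ j * \<omega> x (case_nat (NR a (v j)) (omit j v)) = \<omega> x (v(j := NR a (v j)))" if "j \<le> 2" for j
  proof -
    have "(- 1) ^ j * (- 1) ^ j = (1::complex)" by (simp flip: power_mult_distrib)
    then show ?thesis unfolding S[OF that] by (metis mult.assoc mult_1)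
  qed
  have "0 = ext_gen 1 0 3 \<omega> x (case_nat V v)" by (simp add: cl)
  also have "\<dots> = dd V (\<lambda>y. \<omega> y v) x - (T 0 - T 1 + T 2)"
    by (simp add: ext_gen_def dg_def T_def numeral_3_eq_3 numeral_2_eq_2 omit_case_nat)
  finally have "dd a (\<lambda>y. \<omega> y v) x = T 0 - T 1 + T 2" by (simp add: V)
  moreover have "ext_gen 1 0 2 (iV a \<omega>) x v = (\<Sum>i\<le>2. (- 1) ^ i * T i) + ins 3 (NR a) \<omega> x v"
  proof -
    have "ext_gen 1 0 2 (iV a \<omega>) x v = (\<Sum>i\<le>2. (- 1) ^ i * T i + (- 1) ^ i * \<omega> x (case_nat (NR a (v i)) (omit i v)))"
      unfolding ext_gen_def dg_def T_def V_def dd_iV[OF c sm] by (simp add: algebra_simps)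
    also have "\<dots> = (\<Sum>i\<le>2. (- 1) ^ i * T i) + (\<Sum>i\<le>2. \<omega> x (v(i := NR a (v i))))"
      unfolding sum.distrib by (intro arg_cong2[where f = "(+)"] refl sum.cong S') auto
    finally show ?thesis by (simp only: ins_def lessThan_Suc_atMost numeral_3_eq_3 numeral_2_eq_2)
  qed
  ultimately show ?thesis by (simp add: numeral_2_eq_2)
qed

text \<open>Exactness with a primitive that is itself invariant under the center: such a primitive
  can be averaged again by \<open>LA\<close>, as the iteration requires.\<close>

definition exz :: "form \<Rightarrow> bool" where
  "exz \<sigma> \<longleftrightarrow> (\<exists>\<eta>. is_form 2 \<eta> \<and> Zinv \<eta> \<and> \<sigma> = ext_gen 1 0 2 \<eta>)"

lemma exzI: "is_form 2 \<eta> \<Longrightarrow> Zinv \<eta> \<Longrightarrow> \<sigma> = ext_gen 1 0 2 \<eta> \<Longrightarrow> exz \<sigma>"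
  by (auto simp: exz_def)

lemma exzE:
  assumes "exz \<sigma>"
  obtains \<eta> where "is_form 2 \<eta>" "Zinv \<eta>" "smoothf \<eta>" "\<sigma> = ext_gen 1 0 2 \<eta>"
  using assms is_formD(2) unfolding exz_def by blast

lemma exz_add: "exz \<sigma> \<Longrightarrow> exz \<tau> \<Longrightarrow> exz (\<lambda>x v. \<sigma> x v + \<tau> x v)"
  by (elim exzE) (auto intro: exzI[OF is_form_add Zinv_add] simp: ext_gen_add)

lemma exz_cmult: "exz \<sigma> \<Longrightarrow> exz (\<lambda>x v. c * \<sigma> x v)"
proof -
  have "Zinv \<eta> \<Longrightarrow> Zinv (\<lambda>x v. c * \<eta> x v)" for \<eta> by (simp add: Zinv_def)
  then show "exz \<sigma> \<Longrightarrow> exz (\<lambda>x v. c * \<sigma> x v)"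
    by (auto elim!: exzE intro!: exzI[OF is_form_cmult] simp: ext_gen_cmult)
qed

lemma exz_diff: "exz \<sigma> \<Longrightarrow> exz \<tau> \<Longrightarrow> exz (\<lambda>x v. \<sigma> x v - \<tau> x v)"
  using exz_add[of \<sigma> "\<lambda>x v. - 1 * \<tau> x v"] exz_cmult[of \<tau> "- 1"] by simp

lemma exz_LA: "exz \<sigma> \<Longrightarrow> contw w \<Longrightarrow> exz (LA 3 w a \<sigma>)"
proof (elim exzE)
  fix \<eta> assume "contw w" "is_form 2 \<eta>" "Zinv \<eta>" "smoothf \<eta>" "\<sigma> = ext_gen 1 0 2 \<eta>"
  then show "exz (LA 3 w a \<sigma>)"
    by (intro exzI[of "LA 2 w a \<eta>"] is_form_LA Zinv_LA) (simp_all add: ext_gen_LA del: box_real)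
qed

definition closed3 :: "form \<Rightarrow> bool" where
  "closed3 \<omega> \<longleftrightarrow> is_form 3 \<omega> \<and> Zinv \<omega> \<and> ext_gen 1 0 3 \<omega> = (\<lambda>x v. 0)"

lemma closed3_ins: "closed3 \<omega> \<Longrightarrow> central B \<Longrightarrow> closed3 (ins 3 B \<omega>)"
  unfolding closed3_def
  by (auto simp: is_form_ins Zinv_ins ext_gen_ins[OF _ is_formD(2)[of 3 \<omega>]] ins_zero)

lemma closed3_LA: "closed3 \<omega> \<Longrightarrow> contw w \<Longrightarrow> closed3 (LA 3 w a \<omega>)"
  unfolding closed3_def
  by (auto simp: is_form_LA Zinv_LA ext_gen_LA[OF is_formD(2)[of 3 \<omega>]] LA_zero simp del: box_real)

text \<open>
  By Cartan's formula, \<open>Lder 3 a\<close> differs from \<open>ins 3 (lie a)\<close> by an exact form.  Since the latter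
  is nilpotent, it maps closed forms to exact ones after averaging, and finally without averaging.
\<close>

lemma LA_cohomologous:
  fixes a :: cvec
  assumes \<omega>: "closed3 \<omega>" and a: "gvec a" "a $ 3 = 0"
  shows "exz (\<lambda>x v. LA 3 (\<lambda>s. 1) a \<omega> x v - \<omega> x v)"
proof -
  let ?N = "ins 3 (lie a)"
  let ?A = "LA 3 (\<lambda>s. 1 - complex_of_real s) a"
  let ?P = "LA 3 (\<lambda>s. 1) a"
  have w: "contw (\<lambda>s. 1 - complex_of_real s)" "contw (\<lambda>s. 1)" by (auto intro!: continuous_intros simp del: box_real)
  have L: "Lder 3 a \<rho> = (\<lambda>x v. ext_gen 1 0 2 (iV a \<rho>) x v + ?N \<rho> x v)" if "closed3 \<rho>" for \<rho>
    using that Cartan[of \<rho> a] ins_lie[where \<omega> = \<rho> and k = 3 and a = a]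
    unfolding closed3_def Lder_def by (auto simp: fun_eq_iff is_formD(1))
  have iv: "is_form 2 (iV a \<rho>)" "Zinv (iV a \<rho>)" if "closed3 \<rho>" for \<rho>
    using that is_form_iV[of 2 \<rho>] Zinv_iV unfolding closed3_def by auto
  have sm: "smoothf (ext_gen 1 0 2 (iV a \<rho>))" if "closed3 \<rho>" for \<rho>
    using iv[OF that] by (auto simp: ext_gen_def smoothf_def is_form_iff)
  have ex: "exz (LA 3 w a (ext_gen 1 0 2 (iV a \<rho>)))" if "closed3 \<rho>" "contw w" for \<rho> w
    by (rule exz_LA[OF _ that(2)]) (use iv[OF that(1)] in \<open>auto simp: exz_def\<close>)
  have smN: "smoothf (?N \<rho>)" if "closed3 \<rho>" for \<rho>
    using that by (auto simp: closed3_def is_form_iff smoothf_ins)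
  \<comment> \<open>The average of \<open>Lder 3 a \<rho>\<close> is zero by periodicity, so the
    averaged bracket term is minus an averaged exact form.\<close>
  have 1: "exz (?P (?N \<rho>))" if "closed3 \<rho>" for \<rho>
  proof -
    have "?P (?N \<rho>) = (\<lambda>x v. - 1 * ?P (ext_gen 1 0 2 (iV a \<rho>)) x v)"
    proof (intro ext)
      fix x v
      have "0 = ?P (Lder 3 a \<rho>) x v"
        using LA_Lder[of 3 \<rho> a x v] that a by (simp add: closed3_def)
      also have "\<dots> = ?P (ext_gen 1 0 2 (iV a \<rho>)) x v + ?P (?N \<rho>) x v"
        unfolding L[OF that] by (rule LA_add[OF sm[OF that] smN[OF that] w(2)])
      finally show "?P (?N \<rho>) x v = - 1 * ?P (ext_gen 1 0 2 (iV a \<rho>)) x v" by (simp add: eq_neg_iff_add_eq_0 add.commute)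
    qed
    then show ?thesis using exz_cmult[OF ex[OF that w(2)], of "- 1"] by simp
  qed
  have 2: "?P \<rho> x v - \<rho> x v = ?A (ext_gen 1 0 2 (iV a \<rho>)) x v + ?A (?N \<rho>) x v" if "closed3 \<rho>" for \<rho> x v
  proof -
    have "?A (Lder 3 a \<rho>) x v = ?P \<rho> x v - \<rho> x v"
      using LA_Lder_linear_weight[of 3 \<rho> a x v] that by (simp add: closed3_def)
    then show ?thesis unfolding L[OF that] LA_add[OF sm[OF that] smN[OF that] w(1)] by simp
  qed
  have 3: "exz (\<lambda>x v. ?P \<rho> x v - \<rho> x v)" if "closed3 \<rho>" "exz (?N \<rho>)" for \<rho>
    unfolding 2[OF that(1)] by (intro exz_add ex that w exz_LA)
  \<comment> \<open>If the bracket term is exact, so is the difference of average and form; an exact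
    average then makes the form itself exact.\<close>
  have 4: "exz \<rho>" if "closed3 \<rho>" "exz (?N \<rho>)" "exz (?P \<rho>)" for \<rho>
    using exz_diff[OF that(3) 3[OF that(1,2)]] by simp
  have n3: "?N (?N (?N \<omega>)) = (\<lambda>x v. 0)"
    using ins_pow3[where \<omega> = \<omega> and k = 3] \<omega> by (auto simp: closed3_def fun_eq_iff is_formD(1))
  have z: "exz (\<lambda>x v. 0)"
    using exz_diff[OF 1[OF \<omega>] 1[OF \<omega>]] by simp
  note N = closed3_ins[OF _ central_lie]
  \<comment> \<open>Descent along the powers of \<open>?N\<close>: the bracket term of
    \<open>?N (?N \<omega>)\<close> is zero, and averages of forms in the image of \<open>?N\<close>
    on closed forms are exact by 1. The same step then treats \<open>?N \<omega>\<close>.\<close>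
  have "exz (?N (?N \<omega>))"
  proof (rule 4[OF N[OF N[OF \<omega>]]])
    show "exz (?N (?N (?N \<omega>)))" unfolding n3 by (rule z)
  qed (rule 1[OF N[OF \<omega>]])
  from 4[OF N[OF \<omega>] this 1[OF \<omega>]] have "exz (?N \<omega>)" .
  from 3[OF \<omega> this] show ?thesis .
qed

text \<open>For a central direction the insertion in Cartan's formula is zero, so there is no
  bracket to iterate away, and the alternative \<open>a $ 2 = 0\<close> takes the place of
  invariance under the center.\<close>

lemma central_avg_cohomologous:
  assumes \<omega>: "is_form 3 \<omega>" and cl: "ext_gen 1 0 3 \<omega> = (\<lambda>x v. 0)"
  shows "\<exists>\<eta>. is_form 2 \<eta> \<and> (\<forall>x v. avg (\<lambda>s. 1) (zc c) \<omega> x v = \<omega> x v + ext_gen 1 0 2 \<eta> x v)"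
proof -
  have w: "contw (\<lambda>s. 1 - complex_of_real s)" by (auto intro!: continuous_intros simp del: box_real)
  have iv: "is_form 2 (iV (zc c) \<omega>)" using is_form_iV[of 2 \<omega>] \<omega> by simp
  have "ins 3 (NR (zc c)) \<omega> x v = 0" for x v
    using linear_0[OF is_covectorD(2)[OF is_formD(1)[OF \<omega>]]] by (simp add: ins_def NR_def)
  then have e: "ext_gen 1 0 2 (iV (zc c) \<omega>) = (\<lambda>x v. dd (zc c) (\<lambda>y. \<omega> y v) x)"
    using Cartan[OF \<omega> cl, of "zc c"] by (simp add: fun_eq_iff)
  have "ext_gen 1 0 2 (avg (\<lambda>s. 1 - complex_of_real s) (zc c) (iV (zc c) \<omega>)) x v = avg (\<lambda>s. 1) (zc c) \<omega> x v - \<omega> x v" for x v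
    by (simp add: ext_gen_avg[OF is_formD(2)[OF iv] w] e avg_dd(2)[OF is_formD(2)[OF \<omega>]])
  moreover have "is_form 2 (avg (\<lambda>s. 1 - complex_of_real s) (zc c) (iV (zc c) \<omega>))"
    by (rule is_form_avg[OF iv]) (use w in \<open>auto simp del: box_real\<close>)
  ultimately show ?thesis by (metis add.commute diff_add_cancel)
qed

lemma cohomologous_Lavg:
  assumes \<omega>: "is_form 3 \<omega>" and cl: "ext_gen 1 0 3 \<omega> = (\<lambda>x v. 0)"
  shows "\<exists>\<eta>. is_form 2 \<eta> \<and> (\<forall>x v. \<omega> x v = Lavg 3 \<omega> x v + ext_gen 1 0 2 \<eta> x v)"
    and "ext_gen 1 0 3 (Lavg 3 \<omega>) = (\<lambda>x v. 0)"
proof -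
  let ?\<omega>1 = "avg (\<lambda>s. 1) (zc 1) \<omega>"
  have f1: "is_form 3 ?\<omega>1" using \<omega> by (intro is_form_avg) auto
  have c1: "ext_gen 1 0 3 ?\<omega>1 = (\<lambda>x v. 0)"
    using ext_gen_avg[OF is_formD(2)[OF \<omega>], of "\<lambda>s. 1"] by (simp add: cl avg_zero)
  obtain \<eta>1 where \<eta>1: "is_form 2 \<eta>1" "\<And>x v. ?\<omega>1 x v = \<omega> x v + ext_gen 1 0 2 \<eta>1 x v"
    using central_avg_cohomologous[OF \<omega> cl, of 1] by blast
  obtain \<eta>2 where \<eta>2: "is_form 2 \<eta>2" "\<And>x v. cavg \<omega> x v = ?\<omega>1 x v + ext_gen 1 0 2 \<eta>2 x v"
    using central_avg_cohomologous[OF f1 c1, of \<i>] unfolding cavg_def by blast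
  have cc: "closed3 (cavg \<omega>)"
    using is_form_cavg[OF \<omega>] Zinv_cavg[OF \<omega>] ext_gen_avg[OF is_formD(2)[OF f1], of "\<lambda>s. 1"]
    by (simp add: closed3_def cavg_def c1 avg_zero)
  have "set as \<subseteq> set horiz \<Longrightarrow> closed3 (foldr (LA 3 (\<lambda>s. 1)) as (cavg \<omega>)) \<and>
      exz (\<lambda>x v. foldr (LA 3 (\<lambda>s. 1)) as (cavg \<omega>) x v - cavg \<omega> x v)" for as
  proof (induction as)
    case Nil
    have "Zinv (\<lambda>x v. 0)" by (simp add: Zinv_def)
    then show ?case using cc is_form_zero ext_gen_zero unfolding exz_def by (auto intro!: exI[of _ "\<lambda>x v. 0"])
  next
    case (Cons a as)
    define \<rho> where "\<rho> = foldr (LA 3 (\<lambda>s. 1)) as (cavg \<omega>)"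
    have \<rho>: "closed3 \<rho>" "exz (\<lambda>x v. \<rho> x v - cavg \<omega> x v)" using Cons by (auto simp: \<rho>_def)
    have "exz (\<lambda>x v. LA 3 (\<lambda>s. 1) a \<rho> x v - \<rho> x v)"
      using LA_cohomologous[OF \<rho>(1), of a] horiz_simps[of a] Cons.prems by auto
    from exz_add[OF this \<rho>(2)] show ?case
      using closed3_LA[OF \<rho>(1), of "\<lambda>s. 1" a] by (simp flip: \<rho>_def)
  qed
  from this[of horiz] obtain \<eta>3 where \<eta>3: "is_form 2 \<eta>3" "(\<lambda>x v. Lavg 3 \<omega> x v - cavg \<omega> x v) = ext_gen 1 0 2 \<eta>3"
     and c: "closed3 (Lavg 3 \<omega>)"
    unfolding Lavg_def exz_def by blast
  show "ext_gen 1 0 3 (Lavg 3 \<omega>) = (\<lambda>x v. 0)" using c by (simp add: closed3_def)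
  let ?\<eta> = "\<lambda>x v. - 1 * (\<eta>1 x v + \<eta>2 x v + \<eta>3 x v)"
  have "is_form 2 ?\<eta>" by (intro is_form_cmult is_form_add \<eta>1 \<eta>2 \<eta>3)
  moreover have "\<omega> x v = Lavg 3 \<omega> x v + ext_gen 1 0 2 ?\<eta> x v" for x v
  proof -
    have "smoothf \<eta>1" "smoothf \<eta>2" "smoothf \<eta>3" using \<eta>1 \<eta>2 \<eta>3 is_formD(2) by blast+
    then have "ext_gen 1 0 2 ?\<eta> x v = - 1 * (ext_gen 1 0 2 \<eta>1 x v + ext_gen 1 0 2 \<eta>2 x v + ext_gen 1 0 2 \<eta>3 x v)"
      by (simp only: ext_gen_cmult ext_gen_add smoothf_add)
    then show ?thesis using \<eta>1(2)[of x v] \<eta>2(2)[of x v] fun_cong[OF fun_cong[OF \<eta>3(2)], of x v] by (simp add: algebra_simps)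
  qed
  ultimately show "\<exists>\<eta>. is_form 2 \<eta> \<and> (\<forall>x v. \<omega> x v = Lavg 3 \<omega> x v + ext_gen 1 0 2 \<eta> x v)" by blast
qed

section \<open>Left-invariant forms\<close>

lemma wedge_covectors2:
  "wedge_covectors [f, g] v = f (v 0) * g (v 1) - f (v 1) * g (v 0)"
proof -
  have f: "finite {0::nat}" "1 \<notin> {0::nat}" by auto
  have l: "{..<length [f, g]} = insert 1 {0}" by auto
  show ?thesis
    unfolding wedge_covectors_def l sum_over_permutations_insert[OF f]
    by (simp add: sign_swap_id sign_compose permutation_swap_id sign_id swap_id_eq lessThan_Suc del: One_nat_def)
qed

lemma wedge_covectors3:
  "wedge_covectors [f, g, h] v =
     f (v 0) * g (v 1) * h (v 2) - f (v 0) * g (v 2) * h (v 1) - f (v 1) * g (v 0) * h (v 2) +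
     f (v 1) * g (v 2) * h (v 0) + f (v 2) * g (v 0) * h (v 1) - f (v 2) * g (v 1) * h (v 0)"
proof -
  have f1: "finite {0::nat}" "1 \<notin> {0::nat}" and f2: "finite {1, 0::nat}" "2 \<notin> {1, 0::nat}" by auto
  have l: "{..<length [f, g, h]} = insert 2 (insert 1 {0})" by auto
  show ?thesis
    unfolding wedge_covectors_def l sum_over_permutations_insert[OF f2] sum_over_permutations_insert[OF f1]
    by (simp add: sign_swap_id sign_compose permutation_swap_id sign_id swap_id_eq lessThan_Suc permutation_compose
       numeral_2_eq_2)
qed

text \<open>Left-invariant one-forms. Invariance is recorded infinitesimally, for
  \<open>Linv\<close>, and for all finite translations, for \<open>ginv\<close>.\<close>

definition lframe :: "(cvec \<Rightarrow> cvec \<Rightarrow> complex) \<Rightarrow> bool" where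
  "lframe f \<longleftrightarrow> (\<forall>x. linear (f x)) \<and> (\<forall>v. smooth (\<lambda>x. f x v)) \<and>
     (\<forall>a x v. dd a (\<lambda>y. f y v) x = - f x (NL a v)) \<and>
     (\<forall>w x v. f (x + w + zc (w $ 1 * x $ 2)) (sh (w $ 1) v) = f x v) \<and>
     (\<forall>x c. f (x + zc c) = f x)"

lemma lframeD:
  assumes "lframe f"
  shows "linear (f x)" "smooth (\<lambda>x. f x v)" "dd a (\<lambda>y. f y v) x = - f x (NL a v)"
    "f (x + w + zc (w $ 1 * x $ 2)) (sh (w $ 1) v) = f x v" "f (x + zc c) = f x"
  using assms by (auto simp: lframe_def)

lemma lframe_shift: "lframe f \<Longrightarrow> f (x + w) (sh (w $ 1) v) = f x v"
  using lframeD(4,5) by metis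

lemma lframe_bar: "lframe f \<Longrightarrow> lframe (bar f)"
  unfolding lframe_def bar_def
  by (auto simp: linear_iff smooth_cnj dd_cnj)

lemma lframe_generators: "lframe \<alpha>" "lframe \<beta>" "lframe \<gamma>"
  unfolding lframe_def form_\<alpha>_def form_\<beta>_def form_\<gamma>_def dz_def
  by (auto simp: linear_iff NL_def sh_def algebra_simps dd_diff dd_mult scaleR_conv_of_real[where 'a = complex]
      intro!: smooth_diff smooth_mult)

lemma wedge2: "wedge [f, g] x v = f x (v 0) * g x (v 1) - f x (v 1) * g x (v 0)"
  by (simp add: wedge_def wedge_covectors2)

lemma wedge3:
  "wedge [f, g, h] x v =
     f x (v 0) * g x (v 1) * h x (v 2) - f x (v 0) * g x (v 2) * h x (v 1) - f x (v 1) * g x (v 0) * h x (v 2) +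
     f x (v 1) * g x (v 2) * h x (v 0) + f x (v 2) * g x (v 0) * h x (v 1) - f x (v 2) * g x (v 1) * h x (v 0)"
  by (simp add: wedge_def wedge_covectors3)

lemma is_covector_wedge2:
  assumes "linear (f x)" "linear (g x)"
  shows "is_covector 2 (wedge [f, g] x)"
proof (rule is_covectorI)
  note l = assms[THEN linear_add] assms[THEN linear_scale]
  show "linear (\<lambda>u. wedge [f, g] x (v(i := u)))" if "i < 2" for v i
  proof -
    have "i = 0 \<or> i = 1" using that by auto
    then show ?thesis
      unfolding wedge2
      by (elim disjE; intro linearI) (simp_all add: l scaleR_conv_of_real[where 'a = complex] algebra_simps)
  qed
  show "wedge [f, g] x v = 0" if "i < 2" "j < 2" "i \<noteq> j" "v i = v j" for v i j
  proof -
    have "v 0 = v 1" using that by (auto simp: numeral_2_eq_2 less_Suc_eq)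
    then show ?thesis unfolding wedge2 by simp
  qed
qed (simp add: wedge2)

lemma is_covector_wedge3:
  assumes "linear (f x)" "linear (g x)" "linear (h x)"
  shows "is_covector 3 (wedge [f, g, h] x)"
proof (rule is_covectorI)
  note l = assms[THEN linear_add] assms[THEN linear_scale]
  show "linear (\<lambda>u. wedge [f, g, h] x (v(i := u)))" if "i < 3" for v i
  proof -
    have "i = 0 \<or> i = 1 \<or> i = 2" using that by auto
    then show ?thesis
      unfolding wedge3
      by (elim disjE; intro linearI) (simp_all add: l scaleR_conv_of_real[where 'a = complex] algebra_simps)
  qed
  show "wedge [f, g, h] x v = 0" if "i < 3" "j < 3" "i \<noteq> j" "v i = v j" for v i j
  proof -
    have "v 0 = v 1 \<or> v 0 = v 2 \<or> v 1 = v 2"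
      using that by (auto simp: numeral_3_eq_3 numeral_2_eq_2 less_Suc_eq)
    then show ?thesis unfolding wedge3 by (elim disjE) simp_all
  qed
qed (simp add: wedge3)

lemma lframe_wedge2:
  assumes "lframe f" "lframe g"
  shows "is_form 2 (wedge [f, g])" "Linv 2 (wedge [f, g])"
proof -
  note D = lframeD[OF assms(1)] lframeD[OF assms(2)] assms[THEN lframe_shift]
  have sm: "smoothf (wedge [f, g])"
    unfolding smoothf_def wedge2 by (intro allI smooth_diff smooth_mult D)
  show "is_form 2 (wedge [f, g])"
    unfolding is_form_iff ginv_def using sm by (auto intro: is_covector_wedge2 D simp: wedge2 D)
  show "Linv 2 (wedge [f, g])"
    unfolding Linv_def Zinv_def
    by (intro conjI sm allI is_covector_wedge2 D; simp add: wedge2 D fun_eq_iff dd_diff dd_mult ins_def numeral_2_eq_2 algebra_simps)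
qed

lemma lframe_wedge3:
  assumes "lframe f" "lframe g" "lframe h"
  shows "is_form 3 (wedge [f, g, h])" "Linv 3 (wedge [f, g, h])"
proof -
  note D = lframeD[OF assms(1)] lframeD[OF assms(2)] lframeD[OF assms(3)] assms[THEN lframe_shift]
  have sm: "smoothf (wedge [f, g, h])"
    unfolding smoothf_def wedge3 by (intro allI smooth_diff smooth_add smooth_mult D)
  show "is_form 3 (wedge [f, g, h])"
    unfolding is_form_iff ginv_def using sm by (auto intro: is_covector_wedge3 D simp: wedge3 D)
  show "Linv 3 (wedge [f, g, h])"
    unfolding Linv_def Zinv_def
    by (intro conjI sm allI is_covector_wedge3 D;
        simp add: wedge3 D fun_eq_iff dd_diff dd_add dd_mult ins_def numeral_3_eq_3 numeral_2_eq_2 algebra_simps)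
qed

lemma Linv_add: "Linv k \<omega> \<Longrightarrow> Linv k \<eta> \<Longrightarrow> Linv k (\<lambda>x v. \<omega> x v + \<eta> x v)"
  unfolding Linv_def
  by (auto simp: Zinv_add smoothf_add is_covector_add dd_add smoothfD ins_def sum.distrib)

lemma Linv_cmult: "Linv k \<omega> \<Longrightarrow> Linv k (\<lambda>x v. c * \<omega> x v)"
  unfolding Linv_def
  by (auto simp: Zinv_def smoothf_def is_covector_cmult ins_def sum_distrib_left)

text \<open>The polarized form of \<open>ins_pow3\<close> in degree three: a nonzero term would need
  three central arguments.\<close>

lemma ins3_central_product:
  assumes c: "is_covector 3 (\<omega> x)" and B: "central B" "central C" "central D"
  shows "ins 3 B (ins 3 C (ins 3 D \<omega>)) x v = 0"
proof -
  have c': "is_covector n (ins n B \<eta> x)" if "is_covector n (\<eta> x)" "central B" for n \<eta> B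
    by (rule is_covector_ins[where \<omega> = \<eta>, OF that(1) central_linear[OF that(2)]])
  note i1 = c'[of 3 \<omega>, OF c B(3)] note i2 = c'[of 3 "ins 3 D \<omega>", OF i1 B(2)]
  note i3 = c'[of 3 "ins 3 C (ins 3 D \<omega>)", OF i2 B(1)]
  obtain b where b: "B u = zc (b u)" for u using B unfolding central_def by metis
  obtain c0 where c0: "C u = zc (c0 u)" for u using B unfolding central_def by metis
  obtain d where d: "D u = zc (d u)" for u using B unfolding central_def by metis
  have z: "B (zc p) = 0" "C (zc p) = 0" "D (zc p) = 0" for p using B unfolding central_def by blast+
  have "B 0 = 0" "C 0 = 0" "D 0 = 0" using B[THEN central_linear] linear_0 by blast+
  with z have z': "zc (b (zc p)) = 0" "zc (c0 (zc p)) = 0" "zc (d (zc p)) = 0"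
     "zc (b 0) = 0" "zc (c0 0) = 0" "zc (d 0) = 0" for p
    using b c0 d by metis+
  show ?thesis
    by (subst cov3[OF i3]) (simp add: ins3 i1 i2 c b c0 d z' cov3_0[OF c] cov3_central[OF c])
qed

text \<open>The derivatives of an invariant form are its insertions up to sign, those of the
  insertions are double insertions, and triple insertions vanish. So the double insertions are
  constant, hence zero because they vanish at the origin, and the argument repeats downwards to the
  form itself.\<close>

lemma Linv3_ext:
  assumes L: "Linv 3 \<omega>" and 0: "\<omega> 0 = (\<lambda>v. 0)"
  shows "\<omega> x v = 0"
proof -
  have sm: "smoothf \<omega>" and c: "is_covector 3 (\<omega> x)" for x using L by (auto simp: Linv_def)
  have d0: "dd a (\<lambda>y. \<omega> y v) x = - ins 3 (NL a) \<omega> x v" for a x v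
    using L by (simp add: Linv_def)
  have d1: "dd a (\<lambda>y. ins 3 (NL b) \<omega> y v) x = - ins 3 (NL b) (ins 3 (NL a) \<omega>) x v" for a b x v
    unfolding ins_def[of 3 "NL b"] by (simp add: dd_sum smoothfD sm d0 sum_negf)
  have d2: "dd a (\<lambda>y. ins 3 (NL b) (ins 3 (NL c) \<omega>) y v) x = - ins 3 (NL b) (ins 3 (NL c) (ins 3 (NL a) \<omega>)) x v" for a b c x v
    unfolding ins_def[of 3 "NL b"] by (simp add: dd_sum smoothfD smoothf_ins sm d1 sum_negf)
  have K: "\<eta> x v = 0" if "smoothf \<eta>" "\<eta> 0 = (\<lambda>v. 0)" "\<And>a x v. dd a (\<lambda>y. \<eta> y v) x = 0" for \<eta> :: form and x v
    using zero_dd_imp_constant[OF smoothfD[OF that(1)] that(3), of 0 x v] that(2) by simp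
  have z1: "ins 3 (NL b) \<eta> 0 = (\<lambda>v. 0)" if "\<eta> 0 = (\<lambda>v. 0)" for b \<eta>
    using that by (simp add: ins_def fun_eq_iff)
  have 2: "ins 3 (NL b) (ins 3 (NL c) \<omega>) x v = 0" for b c x v
    by (rule K) (auto intro!: smoothf_ins sm z1 0 simp: d2 ins3_central_product c)
  have 1: "ins 3 (NL b) \<omega> x v = 0" for b x v
    by (rule K) (auto intro!: smoothf_ins sm z1 0 simp: d1 2)
  show ?thesis by (rule K) (auto intro!: sm 0 simp: d0 1)
qed

section \<open>Complex components of covectors\<close>

text \<open>
  The indices \<open>0, \<dots>, 5\<close> stand for \<open>\<alpha>, \<beta>, \<gamma>\<close> and their conjugates.  The component of a covector at
  indices \<open>a, b, c\<close> is the value of its complex-multilinear extension at the dual frame at the origin.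
\<close>

definition fr :: "nat \<Rightarrow> cvec \<Rightarrow> cvec \<Rightarrow> complex" where
  "fr a = [\<alpha>, \<beta>, \<gamma>, bar \<alpha>, bar \<beta>, bar \<gamma>] ! a"

definition ix :: "nat \<Rightarrow> 3" where
  "ix a = [1, 2, 3, 1, 2, 3] ! a"

text \<open>The constants are those of the Wirtinger derivatives: the vector dual to a holomorphic
  coordinate is half of the real direction minus \<i> times the imaginary one, with the opposite
  sign for its conjugate.\<close>

definition hat1 :: "nat \<Rightarrow> (cvec \<Rightarrow> complex) \<Rightarrow> complex" where
  "hat1 a l = (l (axis (ix a) 1) + (if a < 3 then - \<i> else \<i>) * l (axis (ix a) \<i>)) / 2"

definition hat :: "covector \<Rightarrow> nat \<Rightarrow> nat \<Rightarrow> nat \<Rightarrow> complex" where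
  "hat \<phi> a b c = hat1 a (\<lambda>u. hat1 b (\<lambda>v. hat1 c (\<lambda>w. \<phi> (tri u v w))))"

lemma less_6: "a < 6 \<longleftrightarrow> a = 0 \<or> a = 1 \<or> a = 2 \<or> a = 3 \<or> a = 4 \<or> a = (5::nat)"
  by auto

lemma lframe_fr: "a < 6 \<Longrightarrow> lframe (fr a)"
  unfolding less_6 by (elim disjE) (simp_all add: fr_def lframe_generators lframe_bar)

lemma hat1_fr: "a < 6 \<Longrightarrow> b < 6 \<Longrightarrow> hat1 a (fr b 0) = (if a = b then 1 else 0)"
  unfolding less_6
  by (elim disjE) (simp_all add: hat1_def fr_def ix_def form_\<alpha>_def form_\<beta>_def form_\<gamma>_def bar_def dz_def axis_def)

lemma hat1_add: "hat1 a (\<lambda>u. f u + g u) = hat1 a f + hat1 a g"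
  by (simp add: hat1_def algebra_simps add_divide_distrib)

lemma hat1_diff: "hat1 a (\<lambda>u. f u - g u) = hat1 a f - hat1 a g"
  by (simp add: hat1_def algebra_simps diff_divide_distrib)

lemma hat1_cmult: "hat1 a (\<lambda>u. c * f u) = c * hat1 a f" "hat1 a (\<lambda>u. f u * c) = hat1 a f * c"
  by (simp_all add: hat1_def algebra_simps)

lemma hat_add: "hat (\<lambda>v. \<phi> v + \<psi> v) a b c = hat \<phi> a b c + hat \<psi> a b c"
  by (simp add: hat_def hat1_add)

lemma hat_diff: "hat (\<lambda>v. \<phi> v - \<psi> v) a b c = hat \<phi> a b c - hat \<psi> a b c"
  by (simp add: hat_def hat1_diff)

lemma hat_cmult: "hat (\<lambda>v. k * \<phi> v) a b c = k * hat \<phi> a b c"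
  by (simp add: hat_def hat1_cmult)

lemma hat_zero: "hat (\<lambda>v. 0) a b c = 0"
  by (simp add: hat_def hat1_def)

lemma hat_sum: "hat (\<lambda>v. \<Sum>i\<in>I. \<phi> i v) a b c = (\<Sum>i\<in>I. hat (\<phi> i) a b c)"
  by (induction I rule: infinite_finite_induct) (auto simp: hat_zero hat_add)

lemma hat1_expand:
  assumes "linear l"
  shows "l v = (\<Sum>a<6. hat1 a l * fr a 0 v)"
proof -
  have "v = Re (v$1) *\<^sub>R axis 1 1 + Im (v$1) *\<^sub>R axis 1 \<i> + Re (v$2) *\<^sub>R axis 2 1 + Im (v$2) *\<^sub>R axis 2 \<i>
      + Re (v$3) *\<^sub>R axis 3 1 + Im (v$3) *\<^sub>R axis 3 \<i>"
    by (simp add: vec_eq_iff forall_3 axis_def complex_eq_iff)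
  from arg_cong[where f = l, OF this] have "l v = Re (v$1) *\<^sub>R l (axis 1 1) + Im (v$1) *\<^sub>R l (axis 1 \<i>) + Re (v$2) *\<^sub>R l (axis 2 1) + Im (v$2) *\<^sub>R l (axis 2 \<i>)
      + Re (v$3) *\<^sub>R l (axis 3 1) + Im (v$3) *\<^sub>R l (axis 3 \<i>)"
    by (simp only: linear_add[OF assms] linear_scale[OF assms])
  moreover have "(\<Sum>a<6. hat1 a l * fr a 0 v) = \<dots>"
    by (simp add: eval_nat_numeral fr_def hat1_def ix_def form_\<alpha>_def form_\<beta>_def form_\<gamma>_def bar_def dz_def)
       (simp add: complex_eq_iff field_simps)
  ultimately show ?thesis by simp
qed

lemma hat_swap:
  assumes "is_covector 3 \<phi>"
  shows "hat \<phi> b a c = - hat \<phi> a b c" "hat \<phi> a c b = - hat \<phi> a b c"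
proof -
  have "hat \<phi> b a c = hat1 b (\<lambda>u. hat1 a (\<lambda>v. - hat1 c (\<lambda>w. \<phi> (tri v u w))))"
    unfolding hat_def
  proof (intro arg_cong[where f = "hat1 _"] ext)
    fix u v
    show "hat1 c (\<lambda>w. \<phi> (tri u v w)) = - hat1 c (\<lambda>w. \<phi> (tri v u w))"
      unfolding cov3_swap(1)[OF assms, of u v] using hat1_cmult(1)[of c "- 1"] by simp
  qed
  also have "\<dots> = - hat \<phi> a b c"
    by (simp add: hat_def hat1_def algebra_simps add_divide_distrib diff_divide_distrib)
  finally show "hat \<phi> b a c = - hat \<phi> a b c" .
  have "hat \<phi> a c b = hat1 a (\<lambda>u. hat1 c (\<lambda>v. hat1 b (\<lambda>w. - \<phi> (tri u w v))))"
    unfolding hat_def by (intro arg_cong[where f = "hat1 _"] ext) (rule cov3_swap(2)[OF assms])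
  also have "\<dots> = - hat \<phi> a b c"
    by (simp add: hat_def hat1_def algebra_simps add_divide_distrib diff_divide_distrib)
  finally show "hat \<phi> a c b = - hat \<phi> a b c" .
qed

lemma covector3_eq_0:
  assumes c: "is_covector 3 \<phi>" and z: "\<And>a b c. a < b \<Longrightarrow> b < c \<Longrightarrow> c < 6 \<Longrightarrow> hat \<phi> a b c = 0"
  shows "\<phi> v = 0"
proof -
  note s = hat_swap[OF c]
  have eq: "hat \<phi> a a b = 0" "hat \<phi> a b b = 0" for a b
    using s(1)[of a a b] s(2)[of a b b] by auto
  have eq': "hat \<phi> a b a = 0" for a b using s(1)[of a b a] eq by simp
  have h: "hat \<phi> a b c = 0" if "a < 6" "b < 6" "c < 6" for a b c
  proof -
    consider "a = b \<or> b = c \<or> a = c" | "a < b" "b < c" | "a < c" "c < b" | "b < a" "a < c" | "b < c" "c < a" | "c < a" "a < b" | "c < b" "b < a"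
      by linarith
    then show ?thesis
    proof cases
      case 3 then show ?thesis using z[of a c b] s(2)[of a c b] that by simp
    next
      case 4 then show ?thesis using z[of b a c] s(1)[of b a c] that by simp
    next
      case 5 then show ?thesis using z[of b c a] s(1)[of a b c] s(2)[of b a c] that by simp
    next
      case 6 then show ?thesis using z[of c a b] s(1)[of a c b] s(2)[of a b c] that by simp
    next
      case 7 then show ?thesis using z[of c b a] s(1)[of c b a] s(2)[of b a c] s(1)[of b a c] that by simp
    qed (use eq eq' z that in auto)
  qed
  have hl: "linear (\<lambda>v. hat1 c (\<lambda>w. \<phi> (tri u v w)))" "linear (\<lambda>u. hat1 b (\<lambda>v. hat1 c (\<lambda>w. \<phi> (tri u v w))))" for b c u
    by (intro linearI; simp add: hat1_def cov3_add[OF c] cov3_scaleR[OF c] scaleR_conv_of_real[where 'a = complex] field_simps)+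
  have "\<phi> v = \<phi> (tri (v 0) (v 1) (v 2))" by (rule cov3[OF c])
  also have "\<dots> = (\<Sum>a<6. hat1 a (\<lambda>w. \<phi> (tri (v 0) (v 1) w)) * fr a 0 (v 2))"
    by (rule hat1_expand[OF cov3_linear(3)[OF c]])
  also have "\<dots> = 0"
  proof (intro sum.neutral ballI)
    fix a assume a: "a \<in> {..<6::nat}"
    have "hat1 a (\<lambda>w. \<phi> (tri (v 0) (v 1) w)) = (\<Sum>b<6. hat1 b (\<lambda>v'. hat1 a (\<lambda>w. \<phi> (tri (v 0) v' w))) * fr b 0 (v 1))"
      by (rule hat1_expand[OF hl(1)])
    also have "\<dots> = (\<Sum>b<6. (\<Sum>c<6. hat \<phi> c b a * fr c 0 (v 0)) * fr b 0 (v 1))"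
      unfolding hat_def by (subst hat1_expand[OF hl(2)]) (rule refl)
    also have "\<dots> = 0" using a h by simp
    finally show "hat1 a (\<lambda>w. \<phi> (tri (v 0) (v 1) w)) * fr a 0 (v 2) = 0" by simp
  qed
  finally show ?thesis .
qed

abbreviation W :: "nat \<Rightarrow> nat \<Rightarrow> nat \<Rightarrow> form" where
  "W a b c \<equiv> wedge [fr a, fr b, fr c]"

lemma hat_W:
  assumes "a < 6" "b < 6" "c < 6" "a' < 6" "b' < 6" "c' < 6" "a < b" "b < c" "a' < b'" "b' < c'"
  shows "hat (W a b c 0) a' b' c' = (if a' = a \<and> b' = b \<and> c' = c then 1 else 0)"
  unfolding hat_def wedge3 using assms
  by (auto simp: tri_def hat1_add hat1_diff hat1_cmult hat1_fr)

lemma sum_single: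
  fixes h :: "nat \<Rightarrow> complex"
  assumes "\<And>x. x \<noteq> y \<Longrightarrow> h x = 0"
  shows "(\<Sum>x<n. h x) = (if y < n then h y else 0)"
  using assms sum.mono_neutral_right[of "{..<n}" "{y}" h] by (auto intro!: sum.neutral)

text \<open>Both sides are left-invariant, so by \<open>Linv3_ext\<close> it is enough to compare
  them at the origin, where \<open>hat\<close> reads off the coefficients.\<close>

lemma Linv_expand:
  assumes "Linv 3 \<rho>"
  shows "\<rho> = (\<lambda>x v. \<Sum>c<6. \<Sum>b<c. \<Sum>a<b. hat (\<rho> 0) a b c * W a b c x v)"
proof -
  have sumL: "Linv 3 (\<lambda>x v. \<Sum>i\<in>I. f i x v)" if "finite I" "\<And>i. i \<in> I \<Longrightarrow> Linv 3 (f i)" for I and f :: "nat \<Rightarrow> form"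
    using that
  proof (induction I rule: finite_induct)
    case empty
    have "Linv 3 (\<lambda>x v. 0 * \<rho> x v)" by (rule Linv_cmult[OF assms])
    then show ?case by simp
  qed (simp add: Linv_add)
  let ?\<sigma> = "\<lambda>x v. \<Sum>c<6. \<Sum>b<c. \<Sum>a<b. hat (\<rho> 0) a b c * W a b c x v"
  have "Linv 3 ?\<sigma>"
    by (intro sumL Linv_cmult lframe_wedge3 lframe_fr) auto
  then have L: "Linv 3 (\<lambda>x v. \<rho> x v + - 1 * ?\<sigma> x v)" by (intro Linv_add Linv_cmult assms)
  have "\<rho> 0 v + - 1 * ?\<sigma> 0 v = 0" for v
  proof (rule covector3_eq_0)
    show "is_covector 3 (\<lambda>v. \<rho> 0 v + - 1 * ?\<sigma> 0 v)" using L by (simp add: Linv_def)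
    fix a b c :: nat assume abc: "a < b" "b < c" "c < 6"
    have "hat (?\<sigma> 0) a b c = (\<Sum>c'<6. \<Sum>b'<c'. \<Sum>a'<b'. hat (\<rho> 0) a' b' c' * (if a = a' \<and> b = b' \<and> c = c' then 1 else 0))"
      unfolding hat_sum hat_cmult by (intro sum.cong refl arg_cong2[where f = "(*)"] hat_W) (use abc in auto)
    also have "\<dots> = (\<Sum>c'<6. \<Sum>b'<c'. if a < b' \<and> b = b' \<and> c = c' then hat (\<rho> 0) a b' c' else 0)"
      by (intro sum.cong refl, subst sum_single[where y = a]) (auto simp: if_distrib)
    also have "\<dots> = (\<Sum>c'<6. if b < c' \<and> a < b \<and> c = c' then hat (\<rho> 0) a b c' else 0)"
      by (intro sum.cong refl, subst sum_single[where y = b]) auto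
    also have "\<dots> = hat (\<rho> 0) a b c" by (subst sum_single[where y = c]) (use abc in auto)
    finally show "hat (\<lambda>v. \<rho> 0 v + - 1 * ?\<sigma> 0 v) a b c = 0" by (simp add: hat_add hat_cmult[of "- 1", simplified] hat_diff)
  qed
  then have "\<rho> x v + - 1 * ?\<sigma> x v = 0" for x v
    using Linv3_ext[OF L] by (simp add: fun_eq_iff)
  then show ?thesis by (simp add: fun_eq_iff)
qed

text \<open>On left-invariant forms the operators are algebraic: for d this is the
  Chevalley-Eilenberg differential, the alternating sum turning \<open>NL\<close> into the
  bracket.\<close>

lemma Linv_ext_gen:
  assumes "Linv k \<omega>"
  shows "ext_gen p q k \<omega> x v = - (\<Sum>i\<le>k. (- 1) ^ i *
    (p * ins k (NL (v i)) \<omega> x (omit i v) + q * ins k (NL (\<i> *s v i)) \<omega> x (omit i v)))"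
proof -
  have "dg p q a (\<lambda>y. \<omega> y u) x = - (p * ins k (NL a) \<omega> x u + q * ins k (NL (\<i> *s a)) \<omega> x u)" for a u
    using assms by (simp add: dg_def Linv_def algebra_simps)
  note d = this
  show ?thesis unfolding ext_gen_def sum_negf[symmetric] by (intro sum.cong refl) (simp only: d mult_minus_right)
qed

lemma ins2': "is_covector 2 (\<omega> x) \<Longrightarrow> ins 2 B \<omega> x w = \<omega> x (pr (B (w 0)) (w 1)) + \<omega> x (pr (w 0) (B (w 1)))"
  by (simp add: ins_def numeral_2_eq_2 cov2[of "\<omega> x" "w(_ := _)"])

lemma ins3': "is_covector 3 (\<omega> x) \<Longrightarrow> ins 3 B \<omega> x w =
    \<omega> x (tri (B (w 0)) (w 1) (w 2)) + \<omega> x (tri (w 0) (B (w 1)) (w 2)) + \<omega> x (tri (w 0) (w 1) (B (w 2)))"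
  by (simp add: ins_def numeral_3_eq_3 numeral_2_eq_2 cov3[of "\<omega> x" "w(_ := _)", unfolded numeral_2_eq_2])

lemma NL_axis: "NL (axis i c) (axis j d) = (if i = 1 \<and> j = 2 then zc (c * d) else 0)"
  "\<i> *s axis i c = axis i (\<i> * c)" "axis 3 c = zc c"
  "NL (zc c) u = 0" "NL (- zc c) u = 0" "NL u (zc c) = 0" "\<i> *s zc c = zc (\<i> * c)"
  by (auto simp: NL_def axis_def zc_def vec_eq_iff)

lemma zc_uminus: "zc (- c) = - zc c"
  by (simp add: vec_eq_iff)

text \<open>Index 0 is the generator of type (3,0), indices 1 to 4 are those of type (2,1), 5 to 8
  those of type (1,2), and 9 is that of type (0,3), so that each summand occupies a block of
  consecutive coordinates.\<close>

definition lab :: "nat \<Rightarrow> nat \<times> nat \<times> nat" where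
  "lab j = [(0, 1, 2), (0, 2, 3), (0, 2, 4), (1, 2, 3), (1, 2, 4), (0, 3, 5), (0, 4, 5), (1, 3, 5), (1, 4, 5), (3, 4, 5)] ! j"

definition G :: "nat \<Rightarrow> form" where
  "G j = (case lab j of (a, b, c) \<Rightarrow> W a b c)"

lemma less_10: "j < 10 \<longleftrightarrow> j = 0 \<or> j = 1 \<or> j = 2 \<or> j = 3 \<or> j = 4 \<or> j = 5 \<or> j = 6 \<or> j = 7 \<or> j = 8 \<or> j = (9::nat)"
  by auto

lemma G_lab: "G j = W (fst (lab j)) (fst (snd (lab j))) (snd (snd (lab j)))"
  by (simp add: G_def case_prod_beta)

lemma lab_less: "j < 10 \<Longrightarrow> fst (lab j) < fst (snd (lab j)) \<and> fst (snd (lab j)) < snd (snd (lab j)) \<and> snd (snd (lab j)) < 6"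
  unfolding less_10 by (elim disjE) (simp_all add: lab_def)

lemma lab_inj: "i < 10 \<Longrightarrow> j < 10 \<Longrightarrow> lab i = lab j \<Longrightarrow> i = j"
  unfolding less_10 by (elim disjE) (simp_all add: lab_def)

lemma G_form: "j < 10 \<Longrightarrow> is_form 3 (G j)" "j < 10 \<Longrightarrow> Linv 3 (G j)"
  unfolding G_lab using lab_less[of j] by (auto intro!: lframe_wedge3 lframe_fr)

definition hatl :: "covector \<Rightarrow> nat \<Rightarrow> complex" where
  "hatl \<phi> j = hat \<phi> (fst (lab j)) (fst (snd (lab j))) (snd (snd (lab j)))"

lemma hatl_G:
  assumes "i < 10" "j < 10"
  shows "hatl (G i 0) j = (if i = j then 1 else 0)"
proof -
  have "lab i = lab j \<longleftrightarrow> fst (lab i) = fst (lab j) \<and> fst (snd (lab i)) = fst (snd (lab j)) \<and> snd (snd (lab i)) = snd (snd (lab j))"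
    by (auto simp: prod_eq_iff)
  then show ?thesis
    unfolding hatl_def G_lab using lab_less[OF assms(1)] lab_less[OF assms(2)] lab_inj[OF assms]
    by (subst hat_W) auto
qed

text \<open>The structure equation is d\<gamma> = -\<alpha>\<and>\<beta> together with its
  conjugate, so every monomial in the derivative of an invariant two-form contains both 0 and 1 or
  both 3 and 4. Among the labels only (0, 1, 2) and (3, 4, 5) do, and these would have to come from
  \<gamma>\<and>\<gamma> or its conjugate.\<close>

lemma hatl_ext_gen:
  assumes L: "Linv 2 \<eta>" and j: "j < 10"
  shows "hatl (ext_gen p q 2 \<eta> 0) j = 0"
proof -
  have c: "is_covector 2 (\<eta> 0)" using L by (simp add: Linv_def)
  note l = cov2_0[OF c] cov2_alt[OF c] cov2_linear(1)[OF c, THEN linear_neg] cov2_linear(2)[OF c, THEN linear_neg]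
  have sw: "\<eta> 0 (pr (zc \<i>) (zc 1)) = - \<eta> 0 (pr (zc 1) (zc \<i>))" by (rule cov2_swap[OF c])
  have e: "ext_gen p q 2 \<eta> 0 (tri u0 u1 u2) = - (
      p * (\<eta> 0 (pr (NL u0 u1) u2) + \<eta> 0 (pr u1 (NL u0 u2)) - \<eta> 0 (pr (NL u1 u0) u2) - \<eta> 0 (pr u0 (NL u1 u2))
         + \<eta> 0 (pr (NL u2 u0) u1) + \<eta> 0 (pr u0 (NL u2 u1))) +
      q * (\<eta> 0 (pr (NL (\<i> *s u0) u1) u2) + \<eta> 0 (pr u1 (NL (\<i> *s u0) u2)) - \<eta> 0 (pr (NL (\<i> *s u1) u0) u2) - \<eta> 0 (pr u0 (NL (\<i> *s u1) u2))
         + \<eta> 0 (pr (NL (\<i> *s u2) u0) u1) + \<eta> 0 (pr u0 (NL (\<i> *s u2) u1))))" for u0 u1 u2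
    unfolding Linv_ext_gen[OF L]
    by (simp add: numeral_2_eq_2 ins2'[where \<omega> = \<eta>, OF c, unfolded numeral_2_eq_2] omit_def tri_def) (simp add: algebra_simps)
  show ?thesis
    using j unfolding less_10
    by (elim disjE)
      (simp_all add: hatl_def lab_def hat_def hat1_def ix_def e NL_axis l zc_uminus sw field_simps)
qed

text \<open>A primitive of an invariant form may be replaced by its average, which is
  left-invariant; then \<open>hatl_ext_gen\<close> applies. Arbitrary \<open>p\<close> and
  \<open>q\<close> cover the exterior derivative and the Dolbeault operator at once.\<close>

lemma independent:
  assumes \<eta>: "is_form 2 \<eta>" and eq: "\<And>x v. (\<Sum>i<10. c i * G i x v) = ext_gen p q 2 \<eta> x v" and j: "j < 10"
  shows "c j = 0"
proof -
  define \<sigma> where "\<sigma> = (\<lambda>x v. \<Sum>i<10. c i * G i x v)"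
  have F: "is_form 3 \<sigma>" unfolding \<sigma>_def by (intro is_form_sum is_form_cmult G_form) auto
  have "Linv 3 (\<lambda>x v. \<Sum>i<n. c i * G i x v)" if "n \<le> 10" for n
    using that
  proof (induction n)
    case 0
    then show ?case using Linv_cmult[OF G_form(2)[of 0], of 0] by simp
  next
    case (Suc n)
    then show ?case by (auto intro!: Linv_add Linv_cmult G_form)
  qed
  then have L: "Linv 3 \<sigma>" by (simp add: \<sigma>_def)
  have "\<sigma> = ext_gen p q 2 \<eta>" using eq by (simp add: \<sigma>_def fun_eq_iff)
  then have "\<sigma> = ext_gen p q 2 (Lavg 2 \<eta>)"
    using ext_gen_Lavg[OF \<eta>, of p q] Lavg_Linv[OF _ F L] by simp
  then have "hatl (\<sigma> 0) j = 0" using hatl_ext_gen[OF _ j] Linv_Lavg[of 2 \<eta>] \<eta> by simp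
  moreover have "hatl (\<sigma> 0) j = (\<Sum>i<10. c i * hatl (G i 0) j)"
    unfolding \<sigma>_def hatl_def by (simp only: hat_sum hat_cmult)
  also have "\<dots> = (\<Sum>i<10. if i = j then c i else 0)"
    by (intro sum.cong) (use hatl_G j in auto)
  ultimately show ?thesis using j by simp
qed

lemma fr_NL: "\<alpha> x (NL a u) = 0" "\<beta> x (NL a u) = 0" "\<gamma> x (NL a u) = a $ 1 * u $ 2"
  "NL a u $ 1 = 0" "NL a u $ 2 = 0"
  by (simp_all add: form_\<alpha>_def form_\<beta>_def form_\<gamma>_def dz_def NL_def)

text \<open>Differentiating \<gamma> brings in \<alpha>\<and>\<beta>, and every generator that
  contains \<gamma> also contains \<alpha> or \<beta>, so a factor repeats; the same holds for the
  conjugates.\<close>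

lemma ext_gen_G:
  assumes "j < 10"
  shows "ext_gen p q 3 (G j) = (\<lambda>x v. 0)"
proof (intro ext)
  fix x v
  have c: "is_covector 3 (G j x)" using G_form(1)[OF assms] by (rule is_formD)
  have ab: "\<alpha> x u = u $ 1" "\<beta> x u = u $ 2" for u
    by (simp_all add: form_\<alpha>_def form_\<beta>_def dz_def)
  show "ext_gen p q 3 (G j) x v = 0"
    unfolding Linv_ext_gen[OF G_form(2)[OF assms]] ins3'[where \<omega> = "G j", OF c]
    using assms unfolding less_10 G_def
    by (elim disjE)
      (simp_all add: lab_def wedge3 tri_def fr_def bar_def fr_NL ab omit_def numeral_3_eq_3 numeral_2_eq_2 algebra_simps)
qed

text \<open>A basis of the left-invariant coboundaries of degree three. Closedness imposes five
  conditions on the twenty coefficients, and dividing by these five forms leaves ten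
  dimensions.\<close>

lemma exact_W:
  "ext_gen 1 0 2 (wedge [\<gamma>, bar \<alpha>]) x v = - W 0 1 3 x v"
  "ext_gen 1 0 2 (wedge [\<gamma>, bar \<beta>]) x v = - W 0 1 4 x v"
  "ext_gen 1 0 2 (wedge [\<alpha>, bar \<gamma>]) x v = W 0 3 4 x v"
  "ext_gen 1 0 2 (wedge [\<beta>, bar \<gamma>]) x v = W 1 3 4 x v"
  "ext_gen 1 0 2 (wedge [\<gamma>, bar \<gamma>]) x v = W 2 3 4 x v - W 0 1 5 x v"
proof -
  have ab: "\<alpha> x u = u $ 1" "\<beta> x u = u $ 2" for u
    by (simp_all add: form_\<alpha>_def form_\<beta>_def dz_def)
  note lf = lframe_generators lframe_generators[THEN lframe_bar]
  have e: "ext_gen 1 0 2 (wedge [f, g]) x v = - (\<Sum>i\<le>2. (- 1) ^ i * ins 2 (NL (v i)) (wedge [f, g]) x (omit i v))"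
    if "lframe f" "lframe g" for f g
    using Linv_ext_gen[OF lframe_wedge2(2)[OF that], of 1 0] by simp
  have i: "ins 2 B (wedge [f, g]) x w = wedge [f, g] x (pr (B (w 0)) (w 1)) + wedge [f, g] x (pr (w 0) (B (w 1)))"
    if "lframe f" "lframe g" for f g B w
    by (rule ins2'[OF is_formD(1)[OF lframe_wedge2(1)[OF that]]])
  note s = i wedge2 wedge3 pr_def fr_def bar_def fr_NL ab omit_def numeral_2_eq_2 algebra_simps
  show "ext_gen 1 0 2 (wedge [\<gamma>, bar \<alpha>]) x v = - W 0 1 3 x v"
    unfolding e[OF lf(3) lf(4)] i[OF lf(3) lf(4)] by (simp add: s numeral_3_eq_3)
  show "ext_gen 1 0 2 (wedge [\<gamma>, bar \<beta>]) x v = - W 0 1 4 x v"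
    unfolding e[OF lf(3) lf(5)] i[OF lf(3) lf(5)] by (simp add: s eval_nat_numeral)
  show "ext_gen 1 0 2 (wedge [\<alpha>, bar \<gamma>]) x v = W 0 3 4 x v"
    unfolding e[OF lf(1) lf(6)] i[OF lf(1) lf(6)] by (simp add: s eval_nat_numeral)
  show "ext_gen 1 0 2 (wedge [\<beta>, bar \<gamma>]) x v = W 1 3 4 x v"
    unfolding e[OF lf(2) lf(6)] i[OF lf(2) lf(6)] by (simp add: s eval_nat_numeral)
  show "ext_gen 1 0 2 (wedge [\<gamma>, bar \<gamma>]) x v = W 2 3 4 x v - W 0 1 5 x v"
    unfolding e[OF lf(3) lf(6)] i[OF lf(3) lf(6)] by (simp add: s eval_nat_numeral)
qed

definition qd :: "cvec \<Rightarrow> cvec \<Rightarrow> cvec \<Rightarrow> cvec \<Rightarrow> nat \<Rightarrow> cvec" where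
  "qd a b c d = (\<lambda>i. if i = 0 then a else if i = 1 then b else if i = 2 then c else d)"

text \<open>Closedness is a system of linear equations in the values at the origin. Testing it on
  three horizontal vectors and one central vector gives the first four claims, and on four
  horizontal vectors the last.\<close>

lemma closed_Linv_components:
  assumes L: "Linv 3 \<rho>" and cl: "ext_gen 1 0 3 \<rho> = (\<lambda>x v. 0)"
  shows "hat (\<rho> 0) 0 2 5 = 0" "hat (\<rho> 0) 1 2 5 = 0" "hat (\<rho> 0) 2 3 5 = 0" "hat (\<rho> 0) 2 4 5 = 0"
    "hat (\<rho> 0) 0 1 5 = - hat (\<rho> 0) 2 3 4"
proof -
  have c: "is_covector 3 (\<rho> 0)" using L by (simp add: Linv_def)
  note l = cov3_0[OF c] cov3_alt[OF c] cov3_linear(1)[OF c, THEN linear_neg] cov3_linear(2)[OF c, THEN linear_neg]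
    cov3_linear(3)[OF c, THEN linear_neg]
  define T where "T a b c = \<rho> 0 (tri a b c)" for a b c
  have e: "0 = (\<Sum>i\<le>3. (- 1) ^ i * ins 3 (NL (qd u0 u1 u2 u3 i)) \<rho> 0 (omit i (qd u0 u1 u2 u3)))" for u0 u1 u2 u3
    using Linv_ext_gen[OF L, of 1 0 0 "qd u0 u1 u2 u3"] cl by simp
  have e': "T (NL u0 u1) u2 u3 + T u1 (NL u0 u2) u3 + T u1 u2 (NL u0 u3)
      - (T (NL u1 u0) u2 u3 + T u0 (NL u1 u2) u3 + T u0 u2 (NL u1 u3))
      + (T (NL u2 u0) u1 u3 + T u0 (NL u2 u1) u3 + T u0 u1 (NL u2 u3))
      - (T (NL u3 u0) u1 u2 + T u0 (NL u3 u1) u2 + T u0 u1 (NL u3 u2)) = 0" for u0 u1 u2 u3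
    using e[of u0 u1 u2 u3] unfolding ins3'[where \<omega> = \<rho>, OF c] T_def
    by (simp add: qd_def omit_def numeral_3_eq_3 numeral_2_eq_2 algebra_simps)
  have mv: "T (zc r) (axis i b) w = - T (axis i b) (zc r) w" "T u (zc r) (axis i b) = - T u (axis i b) (zc r)"
    "T u (zc \<i>) (zc 1) = - T u (zc 1) (zc \<i>)" for r i b u w
    unfolding T_def by (rule cov3_swap[OF c])+
  note s = l[folded T_def] NL_axis zc_uminus mv
  let ?e1 = "axis 1 1 :: cvec" and ?f1 = "axis 1 \<i> :: cvec" and ?e2 = "axis 2 1 :: cvec" and ?f2 = "axis 2 \<i> :: cvec"
  have 1: "T ?e1 (zc 1) (zc \<i>) = 0" "T ?f1 (zc 1) (zc \<i>) = 0" "T ?e2 (zc 1) (zc \<i>) = 0" "T ?f2 (zc 1) (zc \<i>) = 0"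
    using e'[of ?e1 ?f1 ?e2 "zc 1"] e'[of ?e1 ?f1 ?e2 "zc \<i>"] e'[of ?e1 ?e2 ?f2 "zc 1"] e'[of ?e1 ?e2 ?f2 "zc \<i>"]
    by (simp_all add: s)
  have 2: "T ?e1 ?e2 (zc 1) + T ?e1 ?f2 (zc \<i>) + T ?f1 ?e2 (zc \<i>) - T ?f1 ?f2 (zc 1) = 0"
    using e'[of ?e1 ?f1 ?e2 ?f2] by (simp add: s algebra_simps)
  show "hat (\<rho> 0) 0 2 5 = 0" "hat (\<rho> 0) 1 2 5 = 0" "hat (\<rho> 0) 2 3 5 = 0" "hat (\<rho> 0) 2 4 5 = 0"
    unfolding hat_def T_def[symmetric] by (simp_all add: hat1_def ix_def s 1)
  \<comment> \<open>Each \<open>hat1\<close> divides by 2, so the factor 8 clears the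
    denominators.\<close>
  have "8 * hat (\<rho> 0) 0 1 5 + 8 * hat (\<rho> 0) 2 3 4 =
      2 * (T ?e1 ?e2 (zc 1) + T ?e1 ?f2 (zc \<i>) + T ?f1 ?e2 (zc \<i>) - T ?f1 ?f2 (zc 1))"
    unfolding hat_def T_def[symmetric] by (simp add: hat1_def ix_def s field_simps)
  then have "8 * (hat (\<rho> 0) 0 1 5 + hat (\<rho> 0) 2 3 4) = 0" unfolding 2 by (simp add: algebra_simps)
  then have "hat (\<rho> 0) 0 1 5 + hat (\<rho> 0) 2 3 4 = 0" unfolding mult_eq_0_iff by (elim disjE) simp_all
  then show "hat (\<rho> 0) 0 1 5 = - hat (\<rho> 0) 2 3 4" by (simp only: eq_neg_iff_add_eq_0)
qed

lemma sum_triples: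
  fixes f :: "nat \<Rightarrow> nat \<Rightarrow> nat \<Rightarrow> complex"
  shows "(\<Sum>c<6. \<Sum>b<c. \<Sum>a<b. f a b c) = f 0 1 2 + f 0 1 3 + f 0 2 3 + f 1 2 3 + f 0 1 4 + f 0 2 4 + f 1 2 4 + f 0 3 4 + f 1 3 4 + f 2 3 4 + f 0 1 5 + f 0 2 5 + f 1 2 5 + f 0 3 5 + f 1 3 5 + f 2 3 5 + f 0 4 5 + f 1 4 5 + f 2 4 5 + f 3 4 5"
  by (simp add: eval_nat_numeral)

lemma sum_less_10:
  fixes g :: "nat \<Rightarrow> complex"
  shows "(\<Sum>i<10. g i) = g 0 + g 1 + g 2 + g 3 + g 4 + g 5 + g 6 + g 7 + g 8 + g 9"
  by (simp add: eval_nat_numeral)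

theorem DR_spanning:
  assumes \<omega>: "is_form 3 \<omega>" and cl: "ext_gen 1 0 3 \<omega> = (\<lambda>x v. 0)"
  shows "\<exists>c \<eta>. is_form 2 \<eta> \<and> (\<forall>x v. \<omega> x v = (\<Sum>i<10. c i * G i x v) + ext_gen 1 0 2 \<eta> x v)"
proof -
  define \<rho> where "\<rho> = Lavg 3 \<omega>"
  obtain \<eta> where \<eta>: "is_form 2 \<eta>" "\<And>x v. \<omega> x v = \<rho> x v + ext_gen 1 0 2 \<eta> x v"
    using cohomologous_Lavg(1)[OF \<omega> cl] unfolding \<rho>_def by blast
  have L: "Linv 3 \<rho>" using Linv_Lavg[of 3 \<omega>] \<omega> by (simp add: \<rho>_def)
  note k = closed_Linv_components[OF L cohomologous_Lavg(2)[OF \<omega> cl, folded \<rho>_def]]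
  define h where "h = hat (\<rho> 0)"
  note lf = lframe_generators lframe_generators[THEN lframe_bar]
  \<comment> \<open>A primitive for the components outside the list \<open>lab\<close>, with signs
    dictated by \<open>exact_W\<close>; its last term removes the components 2 3 4 and 0 1 5
    together, which closedness makes opposite.\<close>
  let ?\<xi> = "\<lambda>x v. - h 0 1 3 * wedge [\<gamma>, bar \<alpha>] x v + - h 0 1 4 * wedge [\<gamma>, bar \<beta>] x v +
     h 0 3 4 * wedge [\<alpha>, bar \<gamma>] x v + h 1 3 4 * wedge [\<beta>, bar \<gamma>] x v + h 2 3 4 * wedge [\<gamma>, bar \<gamma>] x v"
  have f: "is_form 2 ?\<xi>" by (intro is_form_add is_form_cmult lframe_wedge2 lf)
  have sm: "smoothf (wedge [f, g])" if "lframe f" "lframe g" for f g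
    using lframe_wedge2(1)[OF that] by (rule is_formD)
  have smc: "smoothf (\<lambda>x v. c * \<omega> x v)" if "smoothf \<omega>" for c \<omega>
    using that by (simp add: smoothf_def)
  have e: "ext_gen 1 0 2 ?\<xi> x v = h 0 1 3 * W 0 1 3 x v + h 0 1 4 * W 0 1 4 x v + h 0 3 4 * W 0 3 4 x v +
      h 1 3 4 * W 1 3 4 x v + h 2 3 4 * (W 2 3 4 x v - W 0 1 5 x v)" for x v
    by (simp only: ext_gen_add ext_gen_cmult smoothf_add smc sm lf exact_W) simp
  define c where "c i = hatl (\<rho> 0) i" for i
  have R: "\<rho> x v = (\<Sum>i<10. c i * G i x v) + ext_gen 1 0 2 ?\<xi> x v" for x v
  proof -
    have "\<rho> x v = (\<Sum>c<6. \<Sum>b<c. \<Sum>a<b. h a b c * W a b c x v)"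
      unfolding h_def using fun_cong[OF fun_cong[OF Linv_expand[OF L], of x], of v] .
    also have "\<dots> = (\<Sum>i<10. c i * G i x v) + ext_gen 1 0 2 ?\<xi> x v"
      unfolding e
      by (simp only: sum_triples sum_less_10 k[folded h_def])
         (simp add: c_def hatl_def lab_def G_def algebra_simps flip: h_def)
    finally show ?thesis .
  qed
  have "\<omega> x v = (\<Sum>i<10. c i * G i x v) + ext_gen 1 0 2 (\<lambda>x v. ?\<xi> x v + \<eta> x v) x v" for x v
    unfolding ext_gen_add[OF is_formD(2)[OF f] is_formD(2)[OF \<eta>(1)]] \<eta>(2) R by (rule add.assoc)
  moreover have "is_form 2 (\<lambda>x v. ?\<xi> x v + \<eta> x v)" by (intro is_form_add f \<eta>(1))
  ultimately show ?thesis by blast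
qed

section \<open>Fourier series\<close>

text \<open>The character e^(-2 pi i m s), with the sign under which integration against it extracts
  mode \<open>m\<close>.\<close>

definition ek :: "int \<Rightarrow> real \<Rightarrow> complex" where
  "ek m s = cis (- (2 * pi * m * s))"

lemma ek_mult: "ek m s * ek n s = ek (m + n) s"
  by (simp add: ek_def cis_mult algebra_simps)

lemma ek_0 [simp]: "ek 0 s = 1" "ek m 0 = 1"
  by (simp_all add: ek_def)

lemma ek_1 [simp]: "ek m 1 = 1"
  using cis_multiple_2pi[of "- real_of_int m"] by (simp add: ek_def mult.assoc)

lemma cnj_ek: "cnj (ek m s) = ek (- m) s"
  by (simp add: ek_def cis_cnj)

lemma norm_ek [simp]: "cmod (ek m s) = 1"
  by (simp add: ek_def)

lemma continuous_on_ek [continuous_intros]: "continuous_on S f \<Longrightarrow> continuous_on S (\<lambda>x. ek m (f x))"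
  unfolding ek_def by (intro continuous_intros)

lemma ek_derivative: "(ek m has_vector_derivative (- (2 * pi * \<i> * m) * ek m s)) (at s within S)"
  unfolding has_vector_derivative_def ek_def[abs_def]
  by (rule derivative_eq_intros refl)+ (auto simp: scaleR_conv_of_real algebra_simps)

lemma ek_integral: "(ek m has_integral (if m = 0 then 1 else 0)) {0..1}"
proof (cases "m = 0")
  case True
  moreover have "ek 0 = (\<lambda>s. 1)" by (simp add: fun_eq_iff)
  ultimately show ?thesis using has_integral_const_real[of "1::complex" 0 1] by simp
next
  case False
  have "((\<lambda>s. - (2 * pi * \<i> * m) * ek m s) has_integral ek m 1 - ek m 0) {0..1}"
    by (rule fundamental_theorem_of_calculus[OF zero_le_one ek_derivative])
  from has_integral_mult_right[OF this, of "inverse (- (2 * pi * \<i> * m))"] show ?thesis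
    using False by (simp add: field_simps)
qed

section \<open>Bessel's inequality and the decay of Fourier coefficients\<close>

definition fc :: "int \<Rightarrow> (real \<Rightarrow> complex) \<Rightarrow> complex" where
  "fc m h = integral {0..1} (\<lambda>s. ek m s * h s)"

lemma fc_has_integral:
  "continuous_on {0..1} h \<Longrightarrow> ((\<lambda>s. ek m s * h s) has_integral fc m h) {0..1}"
  unfolding fc_def by (intro integrable_integral integrable_continuous_real continuous_intros)

lemma has_integral_conj: "(f has_integral I) S \<Longrightarrow> ((\<lambda>x. cnj (f x)) has_integral cnj I) S"
  using has_integral_linear[OF _ bounded_linear_cnj] by (simp add: o_def)

text \<open>The integral of the squared distance from \<open>g\<close> to its partial sum
  \<open>S\<close> is nonnegative; by orthonormality the mixed terms and the square of
  \<open>S\<close> all integrate to \<open>B\<close>.\<close>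

lemma Bessel:
  assumes g: "continuous_on {0..1} g" and M: "finite M"
  shows "(\<Sum>m\<in>M. (cmod (fc m g))\<^sup>2) \<le> Re (integral {0..1} (\<lambda>s. g s * cnj (g s)))"
proof -
  define S where "S s = (\<Sum>m\<in>M. fc m g * ek (- m) s)" for s
  define B where "B = (\<Sum>m\<in>M. fc m g * cnj (fc m g))"
  define J where "J = integral {0..1} (\<lambda>s. g s * cnj (g s))"
  have cS: "cnj (S s) = (\<Sum>m\<in>M. cnj (fc m g) * ek m s)" for s
    by (simp add: S_def cnj_ek)
  have 1: "((\<lambda>s. g s * cnj (g s)) has_integral J) {0..1}"
    unfolding J_def by (intro integrable_integral integrable_continuous_real continuous_intros g)
  have 2: "((\<lambda>s. g s * cnj (S s)) has_integral B) {0..1}"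
  proof -
    have "((\<lambda>s. \<Sum>m\<in>M. cnj (fc m g) * (ek m s * g s)) has_integral (\<Sum>m\<in>M. cnj (fc m g) * fc m g)) {0..1}"
      by (intro has_integral_sum M has_integral_mult_right fc_has_integral g)
    then show ?thesis by (simp add: cS B_def sum_distrib_left mult_ac)
  qed
  have 3: "((\<lambda>s. S s * cnj (g s)) has_integral B) {0..1}"
    using has_integral_conj[OF 2] by (simp add: B_def mult.commute)
  have 4: "((\<lambda>s. S s * cnj (S s)) has_integral B) {0..1}"
  proof -
    have "((\<lambda>s. \<Sum>m\<in>M. \<Sum>n\<in>M. fc m g * cnj (fc n g) * ek (n - m) s) has_integral
      (\<Sum>m\<in>M. \<Sum>n\<in>M. fc m g * cnj (fc n g) * (if n - m = 0 then 1 else 0))) {0..1}"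
      by (intro has_integral_sum M has_integral_mult_right ek_integral)
    moreover have "(\<Sum>m\<in>M. \<Sum>n\<in>M. fc m g * cnj (fc n g) * (if n - m = 0 then 1 else 0)) = B"
      unfolding B_def using M by (intro sum.cong refl) (simp add: if_distrib cong: if_cong)
    moreover have "(\<Sum>m\<in>M. \<Sum>n\<in>M. fc m g * cnj (fc n g) * ek (n - m) s) = S s * cnj (S s)" for s
    proof -
      have "ek (n - m) s = ek (- m) s * ek n s" for n m by (simp add: ek_mult)
      then show ?thesis unfolding cS unfolding S_def sum_product by (simp add: mult_ac)
    qed
    ultimately show ?thesis by simp
  qed
  have "((\<lambda>s. (g s - S s) * cnj (g s - S s)) has_integral J - B - B + B) {0..1}"
    using has_integral_add[OF has_integral_diff[OF has_integral_diff[OF 1 2] 3] 4]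
    by (simp add: algebra_simps)
  from has_integral_linear[OF this[folded complex_norm_square] bounded_linear_Re]
  have "((\<lambda>s. (cmod (g s - S s))\<^sup>2) has_integral Re (J - B)) {0..1}"
    by (simp add: o_def flip: of_real_power)
  from has_integral_nonneg[OF this] have "Re B \<le> Re J" by simp
  moreover have "Re B = (\<Sum>m\<in>M. (cmod (fc m g))\<^sup>2)"
    by (simp add: B_def complex_mult_cnj cmod_power2)
  ultimately show ?thesis by (simp add: J_def)
qed

text \<open>By Bessel's inequality the squares of the coefficients are summable along any
  enumeration without repetition.\<close>

lemma fc_tendsto_0:
  assumes g: "continuous_on {0..1} g" and inj: "inj (\<sigma> :: nat \<Rightarrow> int)"
  shows "(\<lambda>n. fc (\<sigma> n) g) \<longlonglongrightarrow> 0"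
proof -
  have "summable (\<lambda>n. (cmod (fc (\<sigma> n) g))\<^sup>2)"
  proof (rule summableI_nonneg_bounded)
    show "(\<Sum>i<n. (cmod (fc (\<sigma> i) g))\<^sup>2) \<le> Re (integral {0..1} (\<lambda>s. g s * cnj (g s)))" for n
      using Bessel[OF g, of "\<sigma> ` {..<n}"] inj
      sum.reindex[of \<sigma> "{..<n}" "\<lambda>m. (cmod (fc m g))\<^sup>2"] inj_on_subset[OF inj] by (simp add: o_def)
  qed auto
  from summable_LIMSEQ_zero[OF this] have "(\<lambda>n. sqrt ((cmod (fc (\<sigma> n) g))\<^sup>2)) \<longlonglongrightarrow> sqrt 0"
    by (intro tendsto_real_sqrt)
  then show ?thesis by (simp add: tendsto_norm_zero_iff)
qed

lemma vector_derivative_quotient: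
  fixes h :: "real \<Rightarrow> complex"
  assumes "(h has_vector_derivative D) (at x within S)"
  shows "((\<lambda>y. (h y - h x) / of_real (y - x)) \<longlongrightarrow> D) (at x within S)"
proof -
  have "((\<lambda>y. Re (h y)) has_field_derivative Re D) (at x within S)" "((\<lambda>y. Im (h y)) has_field_derivative Im D) (at x within S)"
    using assms by (simp_all add: has_vector_derivative_complex_iff)
  then show ?thesis
    by (simp add: has_field_derivative_iff tendsto_complex_iff)
qed

lemma ek_eq_1_iff: "0 < s \<Longrightarrow> s < 1 \<Longrightarrow> ek (- 1) s \<noteq> 1"
proof
  assume s: "0 < s" "s < 1" and "ek (- 1) s = 1"
  then have "sin (2 * pi * s) = 0" "cos (2 * pi * s) = 1" by (auto simp: ek_def complex_eq_iff)
  then obtain n :: int where "2 * pi * s = n * 2 * pi" using cos_one_2pi_int by auto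
  then have "s = n" by simp
  then show False using s by simp
qed

text \<open>
  Chernoff's argument: the partial sums telescope after division by \<open>ek (- 1) - 1\<close>.
\<close>

lemma Fourier_partial_sums:
  fixes h :: "real \<Rightarrow> complex"
  assumes h: "\<And>s. (h has_vector_derivative h' s) (at s within {0..1})" and per: "h 1 = h 0"
  shows "(\<lambda>N. \<Sum>m\<in>{- int N..int N}. fc m h) \<longlonglongrightarrow> h 0"
proof -
  \<comment> \<open>At the endpoints the quotient is 0 / 0. Its limits there are quotients of
    derivatives, and \<open>ek (- 1)\<close> has derivative 2 pi i at both.\<close>
  define g where "g s = (if s = 0 then h' 0 / (2 * pi * \<i>) else if s = 1 then h' 1 / (2 * pi * \<i>)
     else (h s - h 0) / (ek (- 1) s - 1))" for s :: real
  have hc: "continuous_on {0..1} h"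
    using h by (auto intro: has_vector_derivative_continuous simp: continuous_on_eq_continuous_within)
  have E: "(ek (- 1) has_vector_derivative (2 * pi * \<i>) * ek (- 1) s) (at s within {0..1})" for s
    using ek_derivative[of "- 1" s] by simp
  have endpt: "(g \<longlongrightarrow> g x) (at x within {0..1})" if "x = 0 \<or> x = 1" for x
  proof -
    have v: "h x = h 0" "ek (- 1) x = 1" using that per by auto
    have "((\<lambda>y. ((h y - h x) / of_real (y - x)) / ((ek (- 1) y - ek (- 1) x) / of_real (y - x))) \<longlongrightarrow>
        h' x / (2 * pi * \<i> * ek (- 1) x)) (at x within {0..1})"
      by (intro tendsto_divide vector_derivative_quotient h E) (simp add: v)
    then have "((\<lambda>y. ((h y - h 0) / of_real (y - x)) / ((ek (- 1) y - 1) / of_real (y - x))) \<longlongrightarrow> g x) (at x within {0..1})"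
      using that by (auto simp: v g_def)
    moreover have "eventually (\<lambda>y. g y = ((h y - h 0) / of_real (y - x)) / ((ek (- 1) y - 1) / of_real (y - x))) (at x within {0..1})"
    proof -
      \<comment> \<open>Close to one endpoint, \<open>y\<close> also stays away from the other one,
        where \<open>g\<close> is given by a separate clause.\<close>
      have "eventually (\<lambda>y. y \<in> {0..1} \<and> y \<noteq> x \<and> y \<noteq> 1 - x) (at x within {0..1})"
      proof -
        have "eventually (\<lambda>y. y \<in> - {1 - x}) (nhds x)"
          by (rule eventually_nhds_in_open) (use that in auto)
        then show ?thesis by (auto simp: eventually_at_filter elim: eventually_mono)
      qed
      then show ?thesis
        by (rule eventually_mono) (use that in \<open>auto simp: g_def\<close>)
    qed
    ultimately show ?thesis by (subst tendsto_cong)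
  qed
  have gc: "continuous_on {0..1} g"
    unfolding continuous_on_def
  proof
    fix x :: real assume x: "x \<in> {0..1}"
    show "(g \<longlongrightarrow> g x) (at x within {0..1})"
    proof (cases "x = 0 \<or> x = 1")
      case False
      then have x: "x \<in> {0<..<1}" using x by auto
      have "continuous_on {0<..<1} (\<lambda>s. (h s - h 0) / (ek (- 1) s - 1))"
        by (intro continuous_intros continuous_on_subset[OF hc]) (auto dest: ek_eq_1_iff)
      then have "continuous_on {0<..<1} g"
        by (rule continuous_on_eq) (auto simp: g_def)
      then have "isCont g x" using x by (simp add: continuous_on_eq_continuous_at)
      then show ?thesis using isCont_def tendsto_within_subset by blast
    qed (use endpt in blast)
  qed
  have hg: "h s - h 0 = (ek (- 1) s - 1) * g s" if "s \<in> {0..1}" for s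
    using that per ek_eq_1_iff[of s] by (cases "s = 0 \<or> s = 1") (auto simp: g_def)
  \<comment> \<open>Multiplication by \<open>ek (- 1)\<close> lowers the index of a Fourier
    coefficient by one, and the constant \<open>h 0\<close> contributes to mode 0 only.\<close>
  have step: "fc m h = (if m = 0 then h 0 else 0) + (fc (m - 1) g - fc m g)" for m
  proof -
    have "((\<lambda>s. h 0 * ek m s + (ek (m - 1) s * g s - ek m s * g s)) has_integral
        h 0 * (if m = 0 then 1 else 0) + (fc (m - 1) g - fc m g)) {0..1}"
      by (intro has_integral_add has_integral_diff has_integral_mult_right ek_integral fc_has_integral gc)
    moreover have "h 0 * ek m s + (ek (m - 1) s * g s - ek m s * g s) = ek m s * h s" if "s \<in> {0..1}" for s
    proof -
      have e: "h s = h 0 + (ek (- 1) s - 1) * g s" using hg[OF that] by (simp add: algebra_simps)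
      have "ek (m - 1) s = ek m s * ek (- 1) s" by (simp add: ek_mult)
      then show ?thesis unfolding e by (simp add: algebra_simps)
    qed
    ultimately have "((\<lambda>s. ek m s * h s) has_integral h 0 * (if m = 0 then 1 else 0) + (fc (m - 1) g - fc m g)) {0..1}"
      by (rule has_integral_eq[rotated])
    then show ?thesis unfolding fc_def[of m h] by (simp add: integral_unique)
  qed
  have sum: "(\<Sum>m\<in>{- int N..int N}. fc m h) = h 0 + fc (- int N - 1) g - fc (int N) g" for N
  proof (induction N)
    case 0
    then show ?case using step[of 0] by simp
  next
    case (Suc N)
    have "{- int (Suc N)..int (Suc N)} = insert (- int N - 1) (insert (int N + 1) {- int N..int N})" by auto
    then have "(\<Sum>m\<in>{- int (Suc N)..int (Suc N)}. fc m h) =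
        fc (- int N - 1) h + (fc (int N + 1) h + (\<Sum>m\<in>{- int N..int N}. fc m h))" by simp
    also have "\<dots> = h 0 + fc (- int N - 1 - 1) g - fc (int N + 1) g"
      unfolding Suc.IH step[of "- int N - 1"] step[of "int N + 1"] by simp
    also have "- int N - 1 - 1 = - int (Suc N) - 1" by simp
    also have "int N + 1 = int (Suc N)" by simp
    finally show ?case .
  qed
  have "(\<lambda>N. h 0 + fc (- int N - 1) g - fc (int N) g) \<longlonglongrightarrow> h 0 + 0 - 0"
    by (intro tendsto_add tendsto_diff tendsto_const fc_tendsto_0 gc) (auto simp: inj_def)
  then show ?thesis by (simp add: sum)
qed

text \<open>The factor by which 1 - D^2 acts on mode \<open>m\<close> of a function of period 1. It
  is at least 1 and its inverse is summable, so two derivatives pay for absolute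
  convergence.\<close>

definition qw :: "int \<Rightarrow> real" where
  "qw m = 1 + 4 * pi ^ 2 * (real_of_int m) ^ 2"

lemma qw_ge_1: "qw m \<ge> 1"
  by (simp add: qw_def)

lemma summable_on_qw: "(\<lambda>m. 1 / qw m) summable_on UNIV"
proof -
  have s: "summable (\<lambda>n. 1 / qw (int n))"
  proof (rule summable_comparison_test')
    show "summable (\<lambda>n. inverse (real n ^ 2))" by (rule inverse_power_summable) simp
    fix n :: nat assume n: "n \<ge> 1"
    have "1 * real n ^ 2 \<le> (4 * pi ^ 2) * real n ^ 2"
      by (rule mult_right_mono) (use pi_gt3 power_mono[of 3 pi 2] in auto)
    then have "real n ^ 2 \<le> qw (int n)" by (simp add: qw_def)
    then show "norm (1 / qw (int n)) \<le> inverse (real n ^ 2)"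
      using n qw_ge_1[of "int n"] by (simp add: field_simps)
  qed
  have nn: "1 / qw m \<ge> 0" for m using qw_ge_1[of m] by simp
  have a: "(\<lambda>m. 1 / qw m) summable_on range int"
    by (subst summable_on_reindex) (auto intro!: summable_nonneg_imp_summable_on s nn simp: o_def)
  have "(\<lambda>m. 1 / qw m) summable_on ((\<lambda>n. - int n) ` UNIV)"
    using s nn by (subst summable_on_reindex) (auto intro!: summable_nonneg_imp_summable_on simp: o_def inj_on_def qw_def)
  then have b: "(\<lambda>m. 1 / qw m) summable_on ((\<lambda>n. - int n) ` UNIV - range int)"
    by (rule summable_on_subset_banach) auto
  have "range int \<union> ((\<lambda>n. - int n) ` UNIV - range int) = UNIV"
  proof -
    have "m \<in> range int \<or> m \<in> range (\<lambda>n. - int n)" for m by (cases m rule: int_cases2) auto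
    then show ?thesis by auto
  qed
  with summable_on_Un_disjoint[OF a b] show ?thesis by auto
qed

text \<open>A finite set of pairs lies in the product of its projections, over which the sum
  factors.\<close>

lemma summable_on_qw2: "(\<lambda>(m, n). 1 / (qw m * qw n)) summable_on UNIV"
proof (rule nonneg_bdd_above_summable_on)
  have p: "qw m > 0" for m using qw_ge_1[of m] by simp
  show "0 \<le> (case x of (m, n) \<Rightarrow> 1 / (qw m * qw n))" for x
    using p by (auto simp: case_prod_beta intro: less_imp_le)
  show "bdd_above (sum (\<lambda>(m, n). 1 / (qw m * qw n)) ` {F. F \<subseteq> UNIV \<and> finite F})"
  proof (rule bdd_aboveI2)
    fix F :: "(int \<times> int) set" assume "F \<in> {F. F \<subseteq> UNIV \<and> finite F}"
    then have F: "finite F" by simp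
    let ?S = "infsum (\<lambda>m. 1 / qw m) UNIV"
    have le: "(\<Sum>m\<in>A. 1 / qw m) \<le> ?S" if "finite A" for A
      using that p by (intro finite_sum_le_infsum summable_on_qw) (auto intro: less_imp_le)
    have "sum (\<lambda>(m, n). 1 / (qw m * qw n)) F \<le> sum (\<lambda>(m, n). 1 / (qw m * qw n)) (fst ` F \<times> snd ` F)"
      using F p by (intro sum_mono2) (auto simp: subset_fst_snd intro!: less_imp_le)
    also have "\<dots> = (\<Sum>m\<in>fst ` F. 1 / qw m) * (\<Sum>n\<in>snd ` F. 1 / qw n)"
      by (simp add: sum_product sum.cartesian_product)
    also have "\<dots> \<le> ?S * ?S"
      using F by (intro mult_mono le sum_nonneg infsum_nonneg) (auto intro: less_imp_le[OF p])
    finally show "sum (\<lambda>(m, n). 1 / (qw m * qw n)) F \<le> ?S * ?S" .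
  qed
qed

text \<open>The component of mode \<open>m\<close> along \<open>e\<close>, kept as a function of the
  point \<open>x\<close>: the character is absorbed into it, so the components add up to the
  function itself and stay smooth in all directions.\<close>

definition FE :: "int \<Rightarrow> cvec \<Rightarrow> (cvec \<Rightarrow> complex) \<Rightarrow> cvec \<Rightarrow> complex" where
  "FE m e = pint (cbox 0 1) (ek m) (\<lambda>s. s *\<^sub>R e)"

lemma contek [simp]: "continuous_on S (ek m)"
  using continuous_on_ek[OF continuous_on_id] by simp

lemma smooth_FE [simp]: "smooth f \<Longrightarrow> smooth (FE m e f)"
  unfolding FE_def by (rule smooth_pint) auto

lemma dd_FE: "smooth f \<Longrightarrow> dd v (FE m e f) = FE m e (dd v f)"
  unfolding FE_def by (rule dd_pint) auto

lemma FE_diff: "smooth f \<Longrightarrow> smooth g \<Longrightarrow> FE m e (\<lambda>x. f x - g x) x = FE m e f x - FE m e g x"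
  using pint_add[of f "\<lambda>x. - 1 * g x" 0 1 "ek m" "\<lambda>s. s *\<^sub>R e" x] pint_cmult[of "cbox 0 1" "ek m" "\<lambda>s. s *\<^sub>R e" "- 1" g x]
  by (simp add: FE_def del: box_real)

lemma FE_periodic: "(\<And>x. f (x + a) = f x) \<Longrightarrow> FE m e f (x + a) = FE m e f x"
  unfolding FE_def pint_def by (simp add: add.assoc add.commute[of a]) (simp add: add.assoc[symmetric])

lemma FE_eq_fc: "FE m e f x = fc m (\<lambda>s. f (x + s *\<^sub>R e))"
  by (simp add: FE_def pint_def fc_def)

lemma FE_dd:
  assumes f: "smooth f" and per: "\<And>x. f (x + e) = f x"
  shows "FE m e (dd e f) x = 2 * pi * \<i> * m * FE m e f x"
proof -
  have "((\<lambda>s. ek m s * f (x + s *\<^sub>R e)) has_vector_derivative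
      ek m s * dd e f (x + s *\<^sub>R e) + - (2 * pi * \<i> * m) * ek m s * f (x + s *\<^sub>R e)) (at s within {0..1})" for s
    by (rule has_vector_derivative_mult[OF ek_derivative smooth_line_derivative[OF f]])
  from fundamental_theorem_of_calculus[OF zero_le_one this]
  have "((\<lambda>s. ek m s * dd e f (x + s *\<^sub>R e) + - (2 * pi * \<i> * m) * (ek m s * f (x + s *\<^sub>R e))) has_integral 0) {0..1}"
    by (simp add: per mult.assoc)
  moreover have "((\<lambda>s. ek m s * dd e f (x + s *\<^sub>R e) + - (2 * pi * \<i> * m) * (ek m s * f (x + s *\<^sub>R e))) has_integral
      FE m e (dd e f) x + - (2 * pi * \<i> * m) * FE m e f x) {0..1}"
    unfolding FE_eq_fc
    by (intro has_integral_add has_integral_mult_right fc_has_integral continuous_intros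
        continuous_on_compose2[OF smooth_continuous_on[of _ UNIV]] f smooth_dd) auto
  ultimately have "FE m e (dd e f) x + - (2 * pi * \<i> * m) * FE m e f x = 0" by (rule has_integral_unique[symmetric])
  then show ?thesis by simp
qed

text \<open>Lattice elements act by maps \<open>\<phi>\<close> that are translations only up to a
  shear; the point is that they commute with translation along \<open>e\<close>.\<close>

lemma dd_equivariant:
  assumes f: "smooth f" and "\<And>x. f (\<phi> x) = f x" and "\<And>x s. \<phi> (x + s *\<^sub>R e) = \<phi> x + s *\<^sub>R e"
  shows "dd e f (\<phi> x) = dd e f x"
proof -
  have "((\<lambda>s. f (\<phi> x + s *\<^sub>R e)) has_vector_derivative dd e f (\<phi> x + 0 *\<^sub>R e)) (at 0)"
    "((\<lambda>s. f (x + s *\<^sub>R e)) has_vector_derivative dd e f (x + 0 *\<^sub>R e)) (at 0)"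
    by (rule smooth_line_derivative[OF f])+
  moreover have "f (\<phi> x + s *\<^sub>R e) = f (x + s *\<^sub>R e)" for s using assms(2,3) by metis
  ultimately show ?thesis by (simp add: vector_derivative_unique_at)
qed

lemma dd_periodic:
  assumes "smooth f" "\<And>x. f (x + a) = f x"
  shows "dd e f (x + a) = dd e f x"
  by (rule dd_equivariant[OF assms]) (simp add: add_ac)

definition FD :: "cvec \<Rightarrow> (cvec \<Rightarrow> complex) \<Rightarrow> cvec \<Rightarrow> complex" where
  "FD e f = (\<lambda>x. f x - dd e (dd e f) x)"

lemma smooth_FD [simp]: "smooth f \<Longrightarrow> smooth (FD e f)"
  by (simp add: FD_def smooth_dd)

lemma FD_periodic: "smooth f \<Longrightarrow> (\<And>x. f (x + a) = f x) \<Longrightarrow> FD e f (x + a) = FD e f x"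
  by (simp add: FD_def dd_periodic smooth_dd)

lemma FE_FD:
  assumes f: "smooth f" and per: "\<And>x. f (x + e) = f x"
  shows "FE m e (FD e f) x = qw m * FE m e f x"
proof -
  have "FE m e (FD e f) x = FE m e f x - FE m e (dd e (dd e f)) x"
    unfolding FD_def by (rule FE_diff) (auto simp: f smooth_dd)
  also have "FE m e (dd e (dd e f)) x = 2 * pi * \<i> * m * (2 * pi * \<i> * m * FE m e f x)"
    by (simp only: FE_dd[OF smooth_dd[OF f] dd_periodic[OF f per]] FE_dd[OF f per])
  finally show ?thesis by (simp add: qw_def algebra_simps power2_eq_square)
qed

lemma FE_bound:
  assumes "smooth f"
  obtains C where "\<And>m. cmod (FE m e f x) \<le> C"
proof -
  have c: "continuous_on {0..1} (\<lambda>s. f (x + s *\<^sub>R e))"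
    by (intro continuous_on_compose2[OF smooth_continuous_on[OF assms, of UNIV]] continuous_intros) auto
  then have "bounded ((\<lambda>s. f (x + s *\<^sub>R e)) ` {0..1})"
    by (intro compact_imp_bounded compact_continuous_image) auto
  then obtain C where C: "C > 0" "\<And>s. s \<in> {0..1} \<Longrightarrow> cmod (f (x + s *\<^sub>R e)) \<le> C"
    unfolding bounded_pos by auto
  have "cmod (FE m e f x) \<le> C * (1 - 0)" for m
    unfolding FE_eq_fc fc_def
    by (rule integral_bound) (use C in \<open>auto intro!: continuous_intros c simp: norm_mult\<close>)
  then show ?thesis using that by auto
qed

text \<open>The components of \<open>FD e f\<close> are bounded, and they are those of
  \<open>f\<close> multiplied by \<open>qw m\<close>, so the series converges absolutely. Its sum is
  then the limit of the symmetric partial sums, known from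
  \<open>Fourier_partial_sums\<close>.\<close>

lemma FE_sum:
  assumes f: "smooth f" and per: "\<And>x. f (x + e) = f x"
  shows "((\<lambda>m. FE m e f x) has_sum f x) UNIV"
proof -
  obtain C where C: "\<And>m. cmod (FE m e (FD e f) x) \<le> C" using FE_bound[OF smooth_FD[OF f]] by blast
  have bnd: "cmod (FE m e f x) \<le> norm (C * (1 / qw m))" for m
  proof -
    have "qw m * cmod (FE m e f x) \<le> C"
      using C[of m] qw_ge_1[of m] unfolding FE_FD[OF f per] by (simp add: norm_mult)
    then show ?thesis using qw_ge_1[of m] by (simp add: field_simps)
  qed
  have smb: "(\<lambda>m. norm (C * (1 / qw m))) summable_on UNIV"
  proof -
    have "\<bar>qw m\<bar> = qw m" for m using qw_ge_1[of m] by simp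
    then show ?thesis using summable_on_cmult_right[OF summable_on_qw, of "\<bar>C\<bar>"] by (simp add: abs_mult)
  qed
  have "(\<lambda>m. norm (FE m e f x)) summable_on UNIV"
    by (rule summable_on_comparison_test[OF smb bnd norm_ge_zero])
  then have "(\<lambda>m. FE m e f x) summable_on UNIV" by (rule Infinite_Sum.abs_summable_summable)
  then have hs: "((\<lambda>m. FE m e f x) has_sum infsum (\<lambda>m. FE m e f x) UNIV) UNIV" by simp
  have "filterlim (\<lambda>N. {- int N..int N}) (finite_subsets_at_top UNIV) sequentially"
    unfolding filterlim_finite_subsets_at_top
  proof (intro allI impI)
    fix X :: "int set" assume "finite X \<and> X \<subseteq> UNIV"
    then have B: "\<bar>m\<bar> \<le> Max (abs ` X)" if "m \<in> X" for m using that by simp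
    show "eventually (\<lambda>N. finite {- int N..int N} \<and> X \<subseteq> {- int N..int N} \<and> {- int N..int N} \<subseteq> UNIV) sequentially"
      using eventually_ge_at_top[of "nat (Max (abs ` X))"]
      by eventually_elim (use B in force)
  qed
  then have "(\<lambda>N. \<Sum>m\<in>{- int N..int N}. FE m e f x) \<longlonglongrightarrow> infsum (\<lambda>m. FE m e f x) UNIV"
    using hs unfolding has_sum_def by (rule filterlim_compose[rotated])
  moreover have "(\<lambda>N. \<Sum>m\<in>{- int N..int N}. FE m e f x) \<longlonglongrightarrow> f x"
    using Fourier_partial_sums[of "\<lambda>s. f (x + s *\<^sub>R e)" "\<lambda>s. dd e f (x + s *\<^sub>R e)"] smooth_line_derivative[OF f, of x e] per
    by (simp add: FE_eq_fc)
  ultimately have "infsum (\<lambda>m. FE m e f x) UNIV = f x" by (rule LIMSEQ_unique)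
  then show ?thesis using hs by simp
qed

section \<open>The Dolbeault equation on a torus with parameters\<close>

text \<open>Real coordinates on the complex line spanned by \<open>e\<close>, with the unit square
  as a fundamental domain for the periods \<open>e\<close> and \<open>\<i> *s e\<close>.\<close>

definition tline :: "cvec \<Rightarrow> real \<times> real \<Rightarrow> cvec" where
  "tline e t = fst t *\<^sub>R e + snd t *\<^sub>R (\<i> *s e)"

abbreviation unit_square :: "(real \<times> real) set" where
  "unit_square \<equiv> cbox (0, 0) (1, 1)"

definition ek2 :: "int \<times> int \<Rightarrow> real \<times> real \<Rightarrow> complex" where
  "ek2 p t = ek (fst p) (fst t) * ek (snd p) (snd t)"

definition FE2 :: "int \<times> int \<Rightarrow> cvec \<Rightarrow> (cvec \<Rightarrow> complex) \<Rightarrow> cvec \<Rightarrow> complex" where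
  "FE2 p e f = FE (fst p) e (FE (snd p) (\<i> *s e) f)"

lemma continuous_tline [simp]: "continuous_on S (tline e)"
  unfolding tline_def by (intro continuous_intros)

lemma continuous_ek2 [simp]: "continuous_on S (ek2 p)"
  unfolding ek2_def by (intro continuous_intros)

lemma continuous_on_smooth_tl: "smooth f \<Longrightarrow> continuous_on S (\<lambda>t. f (x + tline e t))"
  by (intro continuous_on_compose2[OF smooth_continuous_on[of f UNIV]] continuous_intros continuous_tline) auto

lemma FE2_eq: "smooth f \<Longrightarrow> FE2 p e f x = pint unit_square (ek2 p) (tline e) f x"
proof -
  assume f: "smooth f"
  have "integral unit_square (\<lambda>t. ek2 p t * f (x + tline e t)) =
      integral (cbox 0 1) (\<lambda>s. integral (cbox 0 1) (\<lambda>t. ek2 p (s, t) * f (x + tline e (s, t))))"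
    by (rule integral_prod_continuous) (intro continuous_intros continuous_on_smooth_tl f continuous_ek2)
  also have "\<dots> = integral (cbox 0 1) (\<lambda>s. ek (fst p) s *
      integral (cbox 0 1) (\<lambda>t. ek (snd p) t * f (x + s *\<^sub>R e + t *\<^sub>R (\<i> *s e))))"
    by (simp add: ek2_def tline_def mult.assoc add.assoc del: box_real)
  finally show ?thesis by (simp add: FE2_def FE_def pint_def del: box_real)
qed

lemma smooth_tl_bound:
  assumes "smooth f"
  obtains C where "C > 0" "\<And>t. t \<in> unit_square \<Longrightarrow> cmod (f (x + tline e t)) \<le> C"
proof -
  have "bounded ((\<lambda>t. f (x + tline e t)) ` unit_square)"
    by (intro compact_imp_bounded compact_continuous_image continuous_on_smooth_tl assms compact_cbox)
  then show ?thesis using that unfolding bounded_pos by auto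
qed

lemma FE2_bound:
  assumes "smooth f"
  obtains C where "\<And>p. cmod (FE2 p e f x) \<le> C"
proof -
  obtain C where C: "C > 0" "\<And>t. t \<in> unit_square \<Longrightarrow> cmod (f (x + tline e t)) \<le> C"
    using smooth_tl_bound[OF assms] by blast
  have "cmod (FE2 p e f x) \<le> C * measure lborel unit_square" for p
    unfolding FE2_eq[OF assms]
  proof (rule has_integral_bound[where f = "\<lambda>t. ek2 p t * f (x + tline e t)"])
    show "((\<lambda>t. ek2 p t * f (x + tline e t)) has_integral pint unit_square (ek2 p) (tline e) f x) unit_square"
      unfolding pint_def by (intro integrable_integral pint_integrable assms continuous_ek2 continuous_tline)
  qed (use C in \<open>auto simp: norm_mult ek2_def\<close>)
  then show ?thesis using that by blast
qed

context
  fixes e :: cvec and f :: "cvec \<Rightarrow> complex"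
  assumes f: "smooth f" and per1: "\<And>x. f (x + e) = f x" and per2: "\<And>x. f (x + \<i> *s e) = f x"
begin

private definition "F = FD e (FD (\<i> *s e) f)"

private lemma F: "smooth F" "F (x + e) = F x" "F (x + \<i> *s e) = F x"
  unfolding F_def by (simp_all add: f FD_periodic per1 per2)

private lemma FE2_F: "FE2 (m, n) e F x = qw m * qw n * FE2 (m, n) e f x"
proof -
  have "FE n (\<i> *s e) F = FD e (FE n (\<i> *s e) (FD (\<i> *s e) f))"
    unfolding F_def FD_def[of e] by (rule ext) (simp add: FE_diff dd_FE smooth_dd f)
  also have "FE n (\<i> *s e) (FD (\<i> *s e) f) = (\<lambda>x. qw n * FE n (\<i> *s e) f x)"
    by (rule ext) (rule FE_FD[OF f per2])
  finally have "FE2 (m, n) e F x = qw m * FE m e (\<lambda>x. qw n * FE n (\<i> *s e) f x) x"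
    by (simp add: FE2_def FE_FD f FE_periodic per1)
  also have "FE m e (\<lambda>x. qw n * FE n (\<i> *s e) f x) x = qw n * FE m e (FE n (\<i> *s e) f) x"
    unfolding FE_def by (rule pint_cmult)
  finally show ?thesis by (simp add: FE2_def mult.assoc)
qed

text \<open>The operator is (D + \<i> D') / 2 with D along \<open>e\<close> and D' along
  \<open>\<i> *s e\<close>; on the mode these are multiplication by 2 pi i m and 2 pi i n.\<close>

private lemma FE2_dbar:
  assumes g: "smooth g" and "\<And>x. g (x + e) = g x" and "\<And>x. g (x + \<i> *s e) = g x"
  shows "FE2 (m, n) e (dg (1/2) (\<i>/2) e g) x = pi * (\<i> * m - n) * FE2 (m, n) e g x"
proof -
  have 1: "FE2 (m, n) e (dd e g) x = 2 * pi * \<i> * m * FE2 (m, n) e g x"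
    unfolding FE2_def fst_conv snd_conv dd_FE[OF g, symmetric]
    by (rule FE_dd) (simp_all add: g FE_periodic assms)
  have "FE n (\<i> *s e) (dd (\<i> *s e) g) = (\<lambda>x. 2 * pi * \<i> * n * FE n (\<i> *s e) g x)"
    by (rule ext) (rule FE_dd[OF g assms(3)])
  then have 2: "FE2 (m, n) e (dd (\<i> *s e) g) x = 2 * pi * \<i> * n * FE2 (m, n) e g x"
    unfolding FE2_def fst_conv snd_conv by (simp only: FE_def pint_cmult)
  have "FE2 (m, n) e (dg (1/2) (\<i>/2) e g) x = 1/2 * FE2 (m, n) e (dd e g) x + \<i>/2 * FE2 (m, n) e (dd (\<i> *s e) g) x"
    unfolding dg_def[abs_def]
    by (simp only: FE2_eq smooth_add smooth_mult smooth_const smooth_dd g pint_add pint_cmult continuous_ek2 continuous_tline)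
  then show ?thesis unfolding 1 2 by (simp add: algebra_simps)
qed

text \<open>The weights make the double series absolutely convergent. Summing over \<open>m\<close>
  first leaves the components along \<open>\<i> *s e\<close>, and these add up to \<open>f\<close>;
  the expansion in one variable is used twice.\<close>

private lemma FE2_sum: "((\<lambda>p. FE2 p e f x) has_sum f x) UNIV"
proof -
  obtain C where C: "\<And>p. cmod (FE2 p e F x) \<le> C" using FE2_bound[OF F(1)] by blast
  have q: "qw m > 0" for m using qw_ge_1[of m] by simp
  have bnd: "cmod (FE2 p e f x) \<le> norm (C * (case p of (m, n) \<Rightarrow> 1 / (qw m * qw n)))" for p
  proof (cases p)
    case (Pair m n)
    have "qw m * qw n * cmod (FE2 p e f x) \<le> C"
      using C[of p] q[of m] q[of n] unfolding Pair FE2_F by (simp add: norm_mult)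
    then have "cmod (FE2 p e f x) \<le> C / (qw m * qw n)" using q[of m] q[of n] by (simp add: field_simps)
    also have "\<dots> \<le> \<bar>C\<bar> / \<bar>qw m * qw n\<bar>" using q[of m] q[of n] by (simp add: divide_right_mono)
    finally show ?thesis using Pair by simp
  qed
  have smb: "(\<lambda>p. norm (C * (case p of (m, n) \<Rightarrow> 1 / (qw m * qw n)))) summable_on UNIV"
  proof -
    have "norm (C * (case p of (m, n) \<Rightarrow> 1 / (qw m * qw n))) = \<bar>C\<bar> * (case p of (m, n) \<Rightarrow> 1 / (qw m * qw n))" for p
      using q by (cases p) (simp add: abs_mult abs_of_pos)
    then show ?thesis using summable_on_cmult_right[OF summable_on_qw2, of "\<bar>C\<bar>"] by simp
  qed
  have "(\<lambda>p. norm (FE2 p e f x)) summable_on UNIV"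
    by (rule summable_on_comparison_test[OF smb bnd norm_ge_zero])
  then have s: "(\<lambda>p. FE2 p e f x) summable_on UNIV" by (rule Infinite_Sum.abs_summable_summable)
  have "infsum (\<lambda>p. FE2 p e f x) UNIV = infsum (\<lambda>m. infsum (\<lambda>n. FE2 (m, n) e f x) UNIV) UNIV"
    using infsum_Sigma_banach[of "\<lambda>p. FE2 p e f x" UNIV "\<lambda>_. UNIV"] s by simp
  also have "\<dots> = infsum (\<lambda>n. infsum (\<lambda>m. FE2 (m, n) e f x) UNIV) UNIV"
    by (rule infsum_swap_banach) (use s in \<open>simp add: case_prod_unfold\<close>)
  also have "\<dots> = infsum (\<lambda>n. FE n (\<i> *s e) f x) UNIV"
  proof (rule infsum_cong)
    show "infsum (\<lambda>m. FE2 (m, n) e f x) UNIV = FE n (\<i> *s e) f x" for n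
      unfolding FE2_def fst_conv snd_conv by (intro infsumI FE_sum) (simp_all add: f FE_periodic per1)
  qed
  also have "\<dots> = f x"
    by (intro infsumI FE_sum f per2)
  finally show ?thesis using s by (metis has_sum_infsum)
qed

text \<open>
  On the Fourier mode \<open>(m, n)\<close>, passing from \<open>f\<close> to \<open>F\<close> is multiplication by \<open>qw m * qw n\<close> and
  \<open>dbar\<close> is multiplication by \<open>pi * (\<i> * m - n)\<close>.  So convolution of \<open>F\<close> with \<open>K\<close> inverts \<open>dbar\<close> off
  the mean value, and the extra weights make the series for \<open>K\<close> converge uniformly.
\<close>

private definition "\<kappa> p = (if p = (0, 0) then 0 else
    1 / (complex_of_real pi * (\<i> * fst p - snd p) * qw (fst p) * qw (snd p)))" for p :: "int \<times> int"

private definition "K t = infsum (\<lambda>p. \<kappa> p * ek2 p t) UNIV"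

text \<open>There are no small divisors: off the origin \<open>\<i> * m - n\<close> is a nonzero
  Gaussian integer and has modulus at least 1.\<close>

private lemma \<kappa>_bound: "cmod (\<kappa> p) \<le> (case p of (m, n) \<Rightarrow> 1 / (qw m * qw n))"
proof (cases p)
  case (Pair m n)
  have q: "qw m > 0" for m using qw_ge_1[of m] by simp
  show ?thesis
  proof (cases "p = (0, 0)")
    case True
    then show ?thesis using Pair q by (simp add: \<kappa>_def less_imp_le)
  next
    case False
    have "1 \<le> cmod (\<i> * m - n)"
    proof -
      have "(1::real) \<le> (real_of_int m)\<^sup>2 + (real_of_int n)\<^sup>2"
      proof -
        have "m\<^sup>2 + n\<^sup>2 > 0" using False Pair by (simp add: sum_power2_gt_zero_iff)
        then have "1 \<le> m\<^sup>2 + n\<^sup>2" by linarith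
        then have "real_of_int 1 \<le> real_of_int (m\<^sup>2 + n\<^sup>2)" by (rule of_int_le_iff[THEN iffD2])
        then show ?thesis by simp
      qed
      then show ?thesis by (simp add: cmod_def add.commute)
    qed
    then have "1 * 1 \<le> pi * cmod (\<i> * m - n)" using pi_gt3 by (intro mult_mono) auto
    then have "1 * (qw m * qw n) \<le> pi * cmod (\<i> * m - n) * (qw m * qw n)"
      using q by (intro mult_right_mono) (auto intro: less_imp_le)
    then have "1 / (pi * cmod (\<i> * m - n) * (qw m * qw n)) \<le> 1 / (qw m * qw n)"
      using q[of m] q[of n] by (intro divide_left_mono) auto
    then show ?thesis
      using False Pair q[of m] q[of n] by (simp add: \<kappa>_def norm_divide norm_mult mult.assoc)
  qed
qed

private lemma norm_ek2 [simp]: "cmod (ek2 p t) = 1"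
  by (simp add: ek2_def norm_mult)

private lemma uniform_K:
  assumes g: "continuous_on unit_square g"
  shows "uniform_limit unit_square (\<lambda>X t. \<Sum>p\<in>X. \<kappa> p * ek2 p t * g t) (\<lambda>t. K t * g t) (finite_subsets_at_top UNIV)"
proof -
  have "bounded (g ` unit_square)"
    by (intro compact_imp_bounded compact_continuous_image g compact_cbox)
  then obtain C where C: "C > 0" "\<And>t. t \<in> unit_square \<Longrightarrow> cmod (g t) \<le> C"
    unfolding bounded_pos by auto
  have "infsum (\<lambda>p. \<kappa> p * ek2 p t * g t) UNIV = K t * g t" for t
    unfolding K_def by (rule infsum_cmult_left')
  moreover have "uniform_limit unit_square (\<lambda>X t. \<Sum>p\<in>X. \<kappa> p * ek2 p t * g t)
     (\<lambda>t. infsum (\<lambda>p. \<kappa> p * ek2 p t * g t) UNIV) (finite_subsets_at_top UNIV)"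
  proof (rule Weierstrass_m_test_general)
    show "(\<lambda>p. (case p of (m, n) \<Rightarrow> 1 / (qw m * qw n)) * C) summable_on UNIV"
      using summable_on_cmult_right[OF summable_on_qw2, of C] by (simp add: mult.commute)
    show "norm (\<kappa> p * ek2 p t * g t) \<le> (case p of (m, n) \<Rightarrow> 1 / (qw m * qw n)) * C"
      if "t \<in> unit_square" for p t
      unfolding norm_mult norm_ek2 mult_1_right
      by (intro mult_mono \<kappa>_bound C that) (auto simp: order_trans[OF norm_ge_zero \<kappa>_bound])
  qed
  ultimately show ?thesis by simp
qed

private lemma continuous_K: "continuous_on unit_square K"
proof -
  have "uniform_limit unit_square (\<lambda>X t. \<Sum>p\<in>X. \<kappa> p * ek2 p t * 1) (\<lambda>t. K t * 1) (finite_subsets_at_top UNIV)"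
    by (rule uniform_K) auto
  then have "continuous_on unit_square (\<lambda>t. K t * 1)"
    by (rule uniform_limit_theorem[rotated])
      (auto intro!: always_eventually continuous_intros continuous_ek2)
  then show ?thesis by simp
qed

text \<open>Uniform convergence of the series for the kernel allows integration term by
  term.\<close>

private lemma K_sum:
  assumes "smooth g"
  shows "((\<lambda>p. \<kappa> p * FE2 p e g x) has_sum pint unit_square K (tline e) g x) UNIV"
proof -
  let ?f = "\<lambda>X t. \<Sum>p\<in>X. \<kappa> p * ek2 p t * g (x + tline e t)"
  have gc: "continuous_on unit_square (\<lambda>t. g (x + tline e t))" by (rule continuous_on_smooth_tl[OF assms])
  have fc: "continuous_on unit_square (?f X)" for X
    by (intro continuous_intros gc continuous_ek2)
  obtain I J where IJ: "\<And>X. (?f X has_integral I X) unit_square"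
      "((\<lambda>t. K t * g (x + tline e t)) has_integral J) unit_square" "(I \<longlongrightarrow> J) (finite_subsets_at_top UNIV)"
    by (rule uniform_limit_integral_cbox[OF uniform_K[OF gc] fc finite_subsets_at_top_neq_bot]) (rule that)
  have Ieq: "I X = (\<Sum>p\<in>X. \<kappa> p * FE2 p e g x)" if "finite X" for X
  proof (rule has_integral_unique[OF IJ(1)])
    have "((\<lambda>t. ek2 p t * g (x + tline e t)) has_integral FE2 p e g x) unit_square" for p
      unfolding FE2_eq[OF assms] pint_def
      by (intro integrable_integral pint_integrable assms continuous_ek2 continuous_tline)
    then show "(?f X has_integral (\<Sum>p\<in>X. \<kappa> p * FE2 p e g x)) unit_square"
      unfolding mult.assoc by (intro has_integral_sum has_integral_mult_right that)
  qed
  have "((\<lambda>X. \<Sum>p\<in>X. \<kappa> p * FE2 p e g x) \<longlongrightarrow> J) (finite_subsets_at_top UNIV)"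
    by (rule Lim_transform_eventually[OF IJ(3)], rule eventually_finite_subsets_at_top_weakI, rule Ieq)
  moreover have "J = pint unit_square K (tline e) g x"
    unfolding pint_def using IJ(2) by (simp add: integral_unique)
  ultimately show ?thesis by (simp add: has_sum_def)
qed

text \<open>The solution is an integral formula, not an arbitrary choice, hence it inherits every
  symmetry of \<open>f\<close> that commutes with the translations of the torus. The last clause
  records this; it later yields invariance under the lattice.\<close>

lemma torus_dbar:
  obtains c where "smooth c" "\<And>x. dg (1/2) (\<i>/2) e c x = f x - FE2 (0, 0) e f x"
    "\<And>\<phi> x. (\<And>x. f (\<phi> x) = f x) \<Longrightarrow> (\<And>x s. \<phi> (x + s *\<^sub>R e) = \<phi> x + s *\<^sub>R e) \<Longrightarrow>
      (\<And>x s. \<phi> (x + s *\<^sub>R (\<i> *s e)) = \<phi> x + s *\<^sub>R (\<i> *s e)) \<Longrightarrow> c (\<phi> x) = c x"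
proof
  let ?c = "pint unit_square K (tline e) F"
  show "smooth ?c" by (rule smooth_pint[OF F(1) continuous_K continuous_tline])
  show "dg (1/2) (\<i>/2) e ?c x = f x - FE2 (0, 0) e f x" for x
  proof -
    let ?H = "dg (1/2) (\<i>/2) e ?c x"
    have "?H = pint unit_square K (tline e) (dg (1/2) (\<i>/2) e F) x"
      by (rule dg_pint[OF F(1) continuous_K continuous_tline])
    then have H: "((\<lambda>p. \<kappa> p * FE2 p e (dg (1/2) (\<i>/2) e F) x) has_sum ?H) UNIV"
      using K_sum[OF smooth_dg[OF F(1)]] by simp
    have d: "((\<lambda>p :: int \<times> int. if p = (0, 0) then FE2 (0, 0) e f x else 0) has_sum FE2 (0, 0) e f x) UNIV"
    proof -
      have "((\<lambda>p. FE2 (0, 0) e f x) has_sum FE2 (0, 0) e f x) {(0::int, 0::int)}"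
        using has_sum_finite[of "{(0::int, 0::int)}" "\<lambda>p. FE2 (0, 0) e f x"] by simp
      then show ?thesis
        using has_sum_cong_neutral[of UNIV "{(0::int, 0::int)}" "\<lambda>p. if p = (0, 0) then FE2 (0, 0) e f x else 0" "\<lambda>p. FE2 (0, 0) e f x"] by simp
    qed
    have q: "qw m \<noteq> 0" for m using qw_ge_1[of m] by simp
    have "\<kappa> p * FE2 p e (dg (1/2) (\<i>/2) e F) x + (if p = (0, 0) then FE2 (0, 0) e f x else 0) = FE2 p e f x" for p
    proof (cases p)
      case (Pair m n)
      have "\<i> * of_int m - of_int n \<noteq> 0" if "p \<noteq> (0, 0)"
        using that Pair by (auto simp: complex_eq_iff)
      then show ?thesis
        using Pair q by (auto simp: \<kappa>_def FE2_dbar[OF F] FE2_F)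
    qed
    then have "((\<lambda>p. FE2 p e f x) has_sum (?H + FE2 (0, 0) e f x)) UNIV"
      using has_sum_add[OF H d] by simp
    from has_sum_unique[OF this FE2_sum] show ?thesis by (simp add: algebra_simps)
  qed
  show "?c (\<phi> x) = ?c x"
    if "\<And>x. f (\<phi> x) = f x" "\<And>x s. \<phi> (x + s *\<^sub>R e) = \<phi> x + s *\<^sub>R e"
      "\<And>x s. \<phi> (x + s *\<^sub>R (\<i> *s e)) = \<phi> x + s *\<^sub>R (\<i> *s e)" for \<phi> x
  proof -
    have FDe: "FD a g (\<phi> x) = FD a g x" if "smooth g" "\<And>x. g (\<phi> x) = g x" "\<And>x s. \<phi> (x + s *\<^sub>R a) = \<phi> x + s *\<^sub>R a" for a g x
      unfolding FD_def by (simp add: that dd_equivariant[where \<phi> = \<phi>] smooth_dd)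
    have "F (\<phi> y) = F y" for y
      unfolding F_def by (intro FDe smooth_FD f that)
    moreover have "\<phi> x + tline e t = \<phi> (x + tline e t)" for t
      by (simp add: tline_def that add.assoc[symmetric])
    ultimately show ?thesis unfolding pint_def by simp
  qed
qed

end

section \<open>Bidegrees\<close>

lemma finite_lists_3 [simp]: "finite {I :: 3 list. length I = n}"
  using finite_lists_length_eq[of "UNIV :: 3 set" n] by simp

lemma bidegree_add:
  assumes "bidegree p q \<phi>" "bidegree p q \<psi>"
  shows "bidegree p q (\<lambda>v. \<phi> v + \<psi> v)"
proof -
  obtain c d where c: "\<phi> = (\<lambda>v. \<Sum>I | length I = p. \<Sum>J | length J = q. c I J * wedge_covectors (map dz I @ map dzbar J) v)"
    and d: "\<psi> = (\<lambda>v. \<Sum>I | length I = p. \<Sum>J | length J = q. d I J * wedge_covectors (map dz I @ map dzbar J) v)"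
    using assms unfolding bidegree_def by blast
  show ?thesis unfolding bidegree_def c d
    by (rule exI[of _ "\<lambda>I J. c I J + d I J"]) (simp add: sum.distrib distrib_right)
qed

lemma bidegree_cmult:
  assumes "bidegree p q \<phi>"
  shows "bidegree p q (\<lambda>v. k * \<phi> v)"
proof -
  obtain c where c: "\<phi> = (\<lambda>v. \<Sum>I | length I = p. \<Sum>J | length J = q. c I J * wedge_covectors (map dz I @ map dzbar J) v)"
    using assms unfolding bidegree_def by blast
  show ?thesis unfolding bidegree_def c
    by (rule exI[of _ "\<lambda>I J. k * c I J"]) (simp add: sum_distrib_left mult.assoc)
qed

lemma bidegree_zero: "bidegree p q (\<lambda>v. 0)"
  unfolding bidegree_def by (rule exI[of _ "\<lambda>I J. 0"]) simp

lemma bidegree_wedge: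
  assumes "length I = p" "length J = q"
  shows "bidegree p q (wedge_covectors (map dz I @ map dzbar J))"
  unfolding bidegree_def
proof (rule exI[of _ "\<lambda>I' J'. if I' = I then if J' = J then 1 else 0 else 0"], rule ext)
  fix v
  have del: "(if P then 1 else 0) * y = (if P then y else (0::complex))" for P y by simp
  have "(\<Sum>I' | length I' = p. \<Sum>J' | length J' = q. (if I' = I then if J' = J then 1 else 0 else 0) *
      wedge_covectors (map dz I' @ map dzbar J') v) =
    (\<Sum>I' | length I' = p. if I' = I then (\<Sum>J' | length J' = q. if J' = J then wedge_covectors (map dz I' @ map dzbar J') v else 0) else 0)"
    using assms by (intro sum.cong refl) (simp add: del)
  also have "\<dots> = wedge_covectors (map dz I @ map dzbar J) v" using assms by simp
  finally show "wedge_covectors (map dz I @ map dzbar J) v = (\<Sum>I' | length I' = p. \<Sum>J' | length J' = q.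
      (if I' = I then if J' = J then 1 else 0 else 0) * wedge_covectors (map dz I' @ map dzbar J') v)" by simp
qed

lemma fr_coords:
  "fr 0 x = dz 1" "fr (Suc 0) x = dz 2" "fr 1 x = dz 2" "fr 2 x = (\<lambda>v. dz 3 v - x $ 1 * dz 2 v)"
  "fr 3 x = dzbar 1" "fr 4 x = dzbar 2" "fr 5 x = (\<lambda>v. dzbar 3 v - cnj (x $ 1) * dzbar 2 v)"
  by (simp_all add: fr_def form_\<alpha>_def form_\<beta>_def form_\<gamma>_def bar_def dz_def dzbar_def fun_eq_iff)

lemma bidegree_W:
  "bidegree 3 0 (W 0 1 2 x)"
  "bidegree 2 1 (W 0 2 3 x)" "bidegree 2 1 (W 0 2 4 x)" "bidegree 2 1 (W 1 2 3 x)" "bidegree 2 1 (W 1 2 4 x)"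
  "bidegree 1 2 (W 0 3 5 x)" "bidegree 1 2 (W 0 4 5 x)" "bidegree 1 2 (W 1 3 5 x)" "bidegree 1 2 (W 1 4 5 x)"
  "bidegree 0 3 (W 3 4 5 x)"
proof -
  have w: "W a b c x = wedge_covectors [fr a x, fr b x, fr c x]" for a b c by (simp add: wedge_def)
  note s = w wedge_covectors3 fr_coords fun_eq_iff algebra_simps
  note A = bidegree_add[OF _ bidegree_cmult] and B = bidegree_wedge
  have "W 0 1 2 x = wedge_covectors (map dz [1, 2, 3] @ map dzbar [])" by (simp add: s)
  then show "bidegree 3 0 (W 0 1 2 x)" using B[of "[1, 2, 3]" 3 "[]" 0] by simp
  have "W 0 2 3 x = (\<lambda>v. wedge_covectors (map dz [1, 3] @ map dzbar [1]) v + - (x $ 1) * wedge_covectors (map dz [1, 2] @ map dzbar [1]) v)" by (simp add: s)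
  then show "bidegree 2 1 (W 0 2 3 x)" by (simp only:) (intro A B; simp)
  have "W 0 2 4 x = (\<lambda>v. wedge_covectors (map dz [1, 3] @ map dzbar [2]) v + - (x $ 1) * wedge_covectors (map dz [1, 2] @ map dzbar [2]) v)" by (simp add: s)
  then show "bidegree 2 1 (W 0 2 4 x)" by (simp only:) (intro A B; simp)
  have "W 1 2 3 x = wedge_covectors (map dz [2, 3] @ map dzbar [1])" by (simp add: s)
  then show "bidegree 2 1 (W 1 2 3 x)" by (simp only:) (intro B; simp)
  have "W 1 2 4 x = wedge_covectors (map dz [2, 3] @ map dzbar [2])" by (simp add: s)
  then show "bidegree 2 1 (W 1 2 4 x)" by (simp only:) (intro B; simp)
  have "W 0 3 5 x = (\<lambda>v. wedge_covectors (map dz [1] @ map dzbar [1, 3]) v + - cnj (x $ 1) * wedge_covectors (map dz [1] @ map dzbar [1, 2]) v)" by (simp add: s)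
  then show "bidegree 1 2 (W 0 3 5 x)" by (simp only:) (intro A B; simp)
  have "W 0 4 5 x = wedge_covectors (map dz [1] @ map dzbar [2, 3])" by (simp add: s)
  then show "bidegree 1 2 (W 0 4 5 x)" by (simp only:) (intro B; simp)
  have "W 1 3 5 x = (\<lambda>v. wedge_covectors (map dz [2] @ map dzbar [1, 3]) v + - cnj (x $ 1) * wedge_covectors (map dz [2] @ map dzbar [1, 2]) v)" by (simp add: s)
  then show "bidegree 1 2 (W 1 3 5 x)" by (simp only:) (intro A B; simp)
  have "W 1 4 5 x = wedge_covectors (map dz [2] @ map dzbar [2, 3])" by (simp add: s)
  then show "bidegree 1 2 (W 1 4 5 x)" by (simp only:) (intro B; simp)
  have "W 3 4 5 x = wedge_covectors (map dz [] @ map dzbar [1, 2, 3])" by (simp add: s)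
  then show "bidegree 0 3 (W 3 4 5 x)" by (simp only:) (intro B; simp)
qed

text \<open>\<open>W 0 1 2\<close> and \<open>W 3 4 5\<close> take the value 1 here at every point,
  so evaluation at \<open>eee\<close> reads off the coefficient of a form of type (3,0) or
  (0,3).\<close>

abbreviation "eee \<equiv> tri (axis 1 1) (axis 2 1) (axis 3 1)"

text \<open>Both spaces of covectors are one-dimensional. The number \<open>k\<close> is the first
  index of the generating monomial, 0 for type (3,0) and 3 for type (0,3), so that the two types
  share one statement.\<close>

lemma bidegree_top:
  assumes "bidegree 3 0 \<phi> \<and> k = 0 \<or> bidegree 0 3 \<phi> \<and> k = 3"
  shows "\<phi> v = \<phi> eee * W k (Suc k) (Suc (Suc k)) x v"
proof -
  have l3: "\<exists>a b c. I = [a, b, c]" if "length I = 3" for I :: "3 list"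
    using that by (auto simp: numeral_3_eq_3 length_Suc_conv)
  have dzw: "wedge_covectors [dz a, dz b, dz c] v = wedge_covectors [dz a, dz b, dz c] eee * W 0 1 2 x v"
    "wedge_covectors [dzbar a, dzbar b, dzbar c] v = wedge_covectors [dzbar a, dzbar b, dzbar c] eee * W 3 4 5 x v" for a b c
    using exhaust_3[of a] exhaust_3[of b] exhaust_3[of c]
    unfolding wedge_def list.map wedge_covectors3 fr_coords
    by (elim disjE; simp add: dz_def dzbar_def tri_def axis_def algebra_simps)+
  show ?thesis
  proof (cases "bidegree 3 0 \<phi> \<and> k = 0")
    case True
    then obtain c where c: "\<And>v. \<phi> v = (\<Sum>I | length I = 3. \<Sum>J | length J = 0. c I J * wedge_covectors (map dz I @ map dzbar J) v)"
      unfolding bidegree_def fun_eq_iff by blast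
    have "\<phi> v = (\<Sum>I | length I = 3. \<Sum>J | length J = 0. c I J * (wedge_covectors (map dz I @ map dzbar J) eee * W 0 1 2 x v))"
      unfolding c by (intro sum.cong refl) (auto dest!: l3 simp: dzw(1)[symmetric] simp del: One_nat_def mult_cancel_left)
    then show ?thesis using True unfolding c by (simp add: sum_distrib_right mult.assoc numeral_2_eq_2)
  next
    case False
    with assms have F: "bidegree 0 3 \<phi>" "k = 3" by auto
    then obtain c where c: "\<And>v. \<phi> v = (\<Sum>I | length I = 0. \<Sum>J | length J = 3. c I J * wedge_covectors (map dz I @ map dzbar J) v)"
      unfolding bidegree_def fun_eq_iff by blast
    have "\<phi> v = (\<Sum>I | length I = 0. \<Sum>J | length J = 3. c I J * (wedge_covectors (map dz I @ map dzbar J) eee * W 3 4 5 x v))"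
      unfolding c by (intro sum.cong refl) (auto dest!: l3 simp: dzw(2)[symmetric] simp del: One_nat_def mult_cancel_left)
    moreover have "Suc 3 = 4" "Suc (Suc 3) = 5" by simp_all
    ultimately show ?thesis using F unfolding c by (simp only: sum_distrib_right mult.assoc)
  qed
qed

text \<open>The smooth functions on X: invariance under the lattice only, unlike
  \<open>Linv\<close>.\<close>

definition linv_fun :: "(cvec \<Rightarrow> complex) \<Rightarrow> bool" where
  "linv_fun f \<longleftrightarrow> smooth f \<and> (\<forall>w x. gvec w \<longrightarrow> f (x + w + zc (w $ 1 * x $ 2)) = f x)"

lemma top_coefficient:
  assumes \<omega>: "is_form 3 \<omega>" and b: "\<And>x. bidegree 3 0 (\<omega> x) \<and> k = 0 \<or> bidegree 0 3 (\<omega> x) \<and> k = 3"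
  shows "linv_fun (\<lambda>x. \<omega> x eee)" "\<omega> x v = \<omega> x eee * W k (Suc k) (Suc (Suc k)) x v"
proof -
  have e: "\<omega> x v = \<omega> x eee * W k (Suc k) (Suc (Suc k)) x v" for x v
    by (rule bidegree_top[OF b])
  then show "\<omega> x v = \<omega> x eee * W k (Suc k) (Suc (Suc k)) x v" .
  have k: "k = 0 \<or> k = 3" using b by blast
  let ?W = "W k (Suc k) (Suc (Suc k))"
  have W: "is_form 3 ?W" using k by (auto intro!: lframe_wedge3 lframe_fr)
  have W1: "?W x eee = 1" for x
    using k unfolding wedge3 by (elim disjE) (simp_all add: fr_coords dz_def dzbar_def tri_def axis_def flip: numeral_2_eq_2)
  have "\<omega> (x + w + zc (w $ 1 * x $ 2)) eee = \<omega> x eee" if "gvec w" for w x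
  proof -
    let ?y = "x + w + zc (w $ 1 * x $ 2)" and ?v = "\<lambda>i. sh (w $ 1) (eee i)"
    \<comment> \<open>The form and the monomial are both invariant, so at the sheared frame the
      ratio of their values is still the coefficient.\<close>
    have "\<omega> ?y ?v = \<omega> x eee" "?W ?y ?v = ?W x eee"
      using is_formD(3)[OF \<omega>] is_formD(3)[OF W] that unfolding ginv_def by blast+
    then show ?thesis using e[of ?y ?v] by (simp add: W1)
  qed
  then show "linv_fun (\<lambda>x. \<omega> x eee)"
    unfolding linv_fun_def using smoothfD[OF is_formD(2)[OF \<omega>]] by blast
qed

section \<open>Dolbeault cohomology of bidegree (3, 0)\<close>

text \<open>Compactness of X: lattice elements move every point into one fixed box.\<close>

lemma linv_fun_bounded:
  assumes "linv_fun f"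
  shows "bounded (range f)"
proof -
  define B where "B = (cbox (\<chi> i. - 1 - \<i>) (\<chi> i. 1 + \<i>) :: cvec set)"
  have "bounded (f ` B)"
    unfolding B_def using assms
    by (intro compact_imp_bounded compact_continuous_image compact_cbox smooth_continuous_on) (simp add: linv_fun_def)
  moreover have "range f \<subseteq> f ` B"
  proof
    fix y assume "y \<in> range f"
    then obtain x where x: "y = f x" by blast
    define fl where "fl c = Complex (of_int \<lfloor>Re c\<rfloor>) (of_int \<lfloor>Im c\<rfloor>)" for c
    have g: "- fl c \<in> gaussian_ints" for c by (simp add: fl_def gaussian_ints_def)
    \<comment> \<open>The translation adds \<open>w $ 1 * x $ 2\<close> to the third coordinate, so
      that coordinate is rounded only after this shift.\<close>
    define w where "w = (vector [- fl (x $ 1), - fl (x $ 2), - fl (x $ 3 + - fl (x $ 1) * x $ 2)] :: cvec)"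
    have w: "w $ 1 = - fl (x $ 1)" "w $ 2 = - fl (x $ 2)" "w $ 3 = - fl (x $ 3 + - fl (x $ 1) * x $ 2)"
      by (simp_all add: w_def)
    have "gvec w" unfolding gvec_def forall_3 w using g by blast
    moreover have "x + w + zc (w $ 1 * x $ 2) \<in> B"
    proof -
      have fr: "Re (c - fl c) \<ge> - 1 \<and> Re (c - fl c) \<le> 1 \<and> Im (c - fl c) \<ge> - 1 \<and> Im (c - fl c) \<le> 1" for c
        by (simp add: fl_def) linarith
      have cb: "z \<in> B" if "\<And>i. \<exists>c. z $ i = c - fl c" for z :: cvec
      proof -
        have "Re (z $ i) \<ge> - 1 \<and> Re (z $ i) \<le> 1 \<and> Im (z $ i) \<ge> - 1 \<and> Im (z $ i) \<le> 1" for i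
          using that[of i] fr by metis
        then show ?thesis
          by (auto simp: B_def mem_box Basis_vec_def inner_axis Basis_complex_def inner_complex_def)
      qed
      have "(x + w + zc (w $ 1 * x $ 2)) $ i = (\<lambda>c. c - fl c) (if i = 1 then x $ 1 else if i = 2 then x $ 2 else x $ 3 + - fl (x $ 1) * x $ 2)" for i
        using exhaust_3[of i] by (auto simp: w)
      then show ?thesis by (intro cb) blast
    qed
    ultimately show "y \<in> f ` B" using assms x unfolding linv_fun_def by (metis imageI)
  qed
  ultimately show ?thesis by (rule bounded_subset)
qed

text \<open>The Cauchy-Riemann equations hold on every complex line parallel to an axis, so
  Liouville's theorem applies there.\<close>

lemma holomorphic_linv_fun_constant:
  assumes f: "linv_fun f" and h: "\<And>j x. dg (1/2) (\<i>/2) (axis j 1) f x = 0"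
  shows "f x = f 0"
proof -
  have sm: "smooth f" using f by (simp add: linv_fun_def)
  have d: "dd (axis j \<i>) f x = \<i> * dd (axis j 1) f x" for j x
  proof -
    have "dd (axis j 1) f x + \<i> * dd (axis j \<i>) f x = 0"
      using h[of j x] by (simp add: dg_def NL_axis field_simps)
    then have "\<i> * (dd (axis j 1) f x + \<i> * dd (axis j \<i>) f x) = 0" by simp
    then show ?thesis by (simp only: distrib_left) (simp add: algebra_simps)
  qed
  have "f (x + axis j w) = f x" for j x w
  proof -
    let ?g = "\<lambda>w. f (x + axis j w)"
    have ax: "axis j h = Re h *\<^sub>R axis j 1 + Im h *\<^sub>R axis j \<i>" for h
      by (simp add: vec_eq_iff axis_def complex_eq_iff)
    have "linear (axis j :: complex \<Rightarrow> cvec)"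
      by (rule linearI) (simp_all add: vec_eq_iff axis_def)
    then have "((\<lambda>w. x + axis j w) has_derivative axis j) (at w)" for w
      by (auto intro!: derivative_eq_intros bounded_linear_imp_has_derivative simp: linear_conv_bounded_linear)
    from has_derivative_compose[OF this smooth_has_derivative[OF sm]]
    have "(?g has_derivative (\<lambda>h. dd (axis j h) f (x + axis j w))) (at w)" for w .
    moreover have "(\<lambda>h. dd (axis j h) f y) = (*) (dd (axis j 1) f y)" for y
    proof
      fix h
      have "dd (axis j h) f y = Re h * dd (axis j 1) f y + Im h * (\<i> * dd (axis j 1) f y)"
        by (subst ax) (simp only: dd_add_dir[OF sm] dd_scaleR_dir[OF sm] d)
      also have "\<dots> = dd (axis j 1) f y * (Re h + \<i> * Im h)" by (simp add: algebra_simps)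
      finally show "dd (axis j h) f y = dd (axis j 1) f y * h" by (simp only: complex_eq[symmetric])
    qed
    ultimately have "(?g has_field_derivative dd (axis j 1) f (x + axis j w)) (at w)" for w
      by (simp only: has_field_derivative_def)
    then have "?g holomorphic_on UNIV" by (auto simp: holomorphic_on_open)
    moreover have "bounded (range ?g)"
      using linv_fun_bounded[OF f] by (rule bounded_subset) auto
    ultimately have "?g constant_on UNIV" by (rule Liouville_theorem)
    then have "?g w = ?g 0" unfolding constant_on_def by (metis UNIV_I)
    then show ?thesis by (simp add: axis_def flip: zero_vec_def)
  qed
  note c = this
  have "x = 0 + axis 1 (x $ 1) + axis 2 (x $ 2) + axis 3 (x $ 3)"
    by (simp add: vec_eq_iff forall_3 axis_def)
  then show ?thesis using c by metis
qed

text \<open>Tested on a vector \<open>u\<close> and the complex frame, closedness says that the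
  Dolbeault derivative of the coefficient is complex-linear in \<open>u\<close>. It is antilinear by
  construction, hence zero.\<close>

theorem Dolbeault_30_spanning:
  assumes "\<omega> \<in> dbar_closed_forms 3 0"
  shows "\<exists>c. \<forall>x v. \<omega> x v = c * W 0 1 2 x v"
proof -
  have \<omega>: "is_form 3 \<omega>" and b: "bidegree 3 0 (\<omega> x) \<and> (0::nat) = 0 \<or> bidegree 0 3 (\<omega> x) \<and> (0::nat) = 3"
    and cl: "ext_gen (1/2) (\<i>/2) 3 \<omega> = zero_form" for x
    using assms by (auto simp: dbar_closed_forms_def pq_forms_def dbar_eq)
  define f where "f x = \<omega> x eee" for x
  have f: "linv_fun f" using top_coefficient(1)[OF \<omega> b] by (simp add: f_def[abs_def])
  then have sm: "smooth f" by (simp add: linv_fun_def)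
  have e: "\<omega> x v = f x * W 0 1 2 0 v" for x v
  proof -
    have "W 0 1 2 x v = W 0 1 2 0 v" unfolding wedge3 by (simp add: fr_coords algebra_simps)
    then show ?thesis using top_coefficient(2)[OF \<omega> b, of x v] by (simp add: f_def numeral_2_eq_2)
  qed
  let ?D = "\<lambda>u. dg (1/2) (\<i>/2) u f"
  have anti: "?D (axis j \<i>) x = - \<i> * ?D (axis j 1) x" for j x
  proof -
    have "axis j (- 1) = (- 1) *\<^sub>R (axis j 1 :: cvec)" by (simp add: vec_eq_iff axis_def)
    then have "dd (axis j (- 1)) f x = - dd (axis j 1) f x" using dd_scaleR_dir[OF sm, of "- 1"] by simp
    then show ?thesis by (simp add: dg_def NL_axis field_simps)
  qed
  have "?D u x = u $ 1 * ?D (axis 1 1) x + u $ 2 * ?D (axis 2 1) x + u $ 3 * ?D (axis 3 1) x" for u x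
  proof -
    let ?q = "qd u (axis 1 1) (axis 2 1) (axis 3 1)"
    have "0 = ext_gen (1/2) (\<i>/2) 3 \<omega> x ?q" by (simp add: cl zero_form_def)
    also have "\<dots> = (\<Sum>i\<le>3. (- 1) ^ i * (W 0 1 2 0 (omit i ?q) * ?D (?q i) x))"
      unfolding ext_gen_def e[abs_def] by (subst mult.commute) (simp only: dg_cmult[OF sm])
    also have "\<dots> = ?D u x - (u $ 1 * ?D (axis 1 1) x + u $ 2 * ?D (axis 2 1) x + u $ 3 * ?D (axis 3 1) x)"
      unfolding wedge3 fr_coords by (simp add: numeral_3_eq_3 numeral_2_eq_2 omit_def qd_def dz_def axis_def algebra_simps)
    finally show ?thesis by simp
  qed
  from this[of "axis _ \<i>"] have "?D (axis j \<i>) x = \<i> * ?D (axis j 1) x" for j x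
    using exhaust_3[of j] by (auto simp: axis_def)
  with anti have "- \<i> * ?D (axis j 1) x = \<i> * ?D (axis j 1) x" for j x by metis
  then have "?D (axis j 1) x = 0" for j x by (simp add: equation_minus_iff)
  then have "f x = f 0" for x using holomorphic_linv_fun_constant[OF f] by blast
  moreover have "W 0 1 2 x v = W 0 1 2 0 v" for x v unfolding wedge3 by (simp add: fr_coords algebra_simps)
  ultimately show ?thesis using e by metis
qed

section \<open>Dolbeault cohomology of bidegree (0, 3)\<close>

lemma FE2_0_equivariant:
  assumes "\<And>x. f (\<phi> x) = f x" "\<And>x s. \<phi> (x + s *\<^sub>R e) = \<phi> x + s *\<^sub>R e"
    "\<And>x s. \<phi> (x + s *\<^sub>R (\<i> *s e)) = \<phi> x + s *\<^sub>R (\<i> *s e)"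
  shows "FE2 p e f (\<phi> x) = FE2 p e f x"
proof -
  have "FE n (\<i> *s e) f (\<phi> y) = FE n (\<i> *s e) f y" for n y
    unfolding FE_def pint_def by (simp add: assms(1) flip: assms(3))
  then show ?thesis
    unfolding FE2_def FE_def[of "fst p"] pint_def by (simp flip: assms(2))
qed

lemma dd_FE2: "smooth f \<Longrightarrow> dd v (FE2 p e f) = FE2 p e (dd v f)"
  unfolding FE2_def by (simp add: dd_FE)

lemma smooth_FE2 [simp]: "smooth f \<Longrightarrow> smooth (FE2 p e f)"
  unfolding FE2_def by simp

lemma FE_zero: "FE m e (\<lambda>x. 0) = (\<lambda>x. 0)"
  by (simp add: FE_def fun_eq_iff del: box_real)

lemma FE2_zero: "FE2 p e (\<lambda>x. 0) = (\<lambda>x. 0)"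
  by (simp add: FE2_def FE_zero)

lemma dd_FE2_0:
  assumes f: "smooth f" and "\<And>x. f (x + e) = f x" "\<And>x. f (x + \<i> *s e) = f x"
  shows "dd e (FE2 (0, 0) e f) = (\<lambda>x. 0)" "dd (\<i> *s e) (FE2 (0, 0) e f) = (\<lambda>x. 0)"
proof -
  have "FE 0 e (dd e (FE 0 (\<i> *s e) f)) x = 0" for x
    by (subst FE_dd) (simp_all add: f FE_periodic assms)
  then show "dd e (FE2 (0, 0) e f) = (\<lambda>x. 0)"
    by (simp add: FE2_def dd_FE f fun_eq_iff)
  have "FE 0 (\<i> *s e) (dd (\<i> *s e) f) = (\<lambda>x. 0)"
    by (rule ext, subst FE_dd) (simp_all add: f assms)
  then show "dd (\<i> *s e) (FE2 (0, 0) e f) = (\<lambda>x. 0)"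
    by (simp add: FE2_def dd_FE f FE_zero)
qed

lemma zero_dd_line: "smooth f \<Longrightarrow> dd (axis j 1) f = (\<lambda>x. 0) \<Longrightarrow> dd (axis j \<i>) f = (\<lambda>x. 0) \<Longrightarrow> f (x + axis j c) = f x"
proof (rule zero_dd_imp_constant)
  assume f: "smooth f" "dd (axis j 1) f = (\<lambda>x. 0)" "dd (axis j \<i>) f = (\<lambda>x. 0)"
  have "axis j c = Re c *\<^sub>R axis j 1 + Im c *\<^sub>R axis j \<i>"
    by (simp add: vec_eq_iff axis_def complex_eq_iff)
  then show "dd (axis j c) f y = 0" for y
    using f by (simp add: dd_add_dir dd_scaleR_dir)
qed

text \<open>A general lattice vector also shears the third coordinate. After averaging over the
  central torus the shear has no effect, the lattice acts by translations, and the torus equation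
  can be solved along the other two axes. The primitives \<open>c1\<close> and \<open>c2\<close>
  inherit invariance under the center, so their central derivatives vanish.\<close>

lemma linv_fun_dbar_decomposition:
  assumes f: "linv_fun f"
  obtains c1 c2 c3 k where "linv_fun c1" "linv_fun c2" "linv_fun c3"
    "\<And>x. dg (1/2) (\<i>/2) (axis 3 1) c1 x = 0" "\<And>x. dg (1/2) (\<i>/2) (axis 3 1) c2 x = 0"
    "\<And>x. f x = k + dg (1/2) (\<i>/2) (axis 1 1) c1 x + dg (1/2) (\<i>/2) (axis 2 1) c2 x + dg (1/2) (\<i>/2) (axis 3 1) c3 x"
proof -
  let ?e = "\<lambda>j. axis j 1 :: cvec"
  have ie: "\<i> *s ?e j = axis j \<i>" for j by (simp add: NL_axis)
  have gax: "gvec (axis j 1)" "gvec (axis j \<i>)" for j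
    by (auto simp: gvec_def axis_def gaussian_ints_def)
  have sm: "smooth f" and inv: "\<And>w x. gvec w \<Longrightarrow> f (x + w + zc (w $ 1 * x $ 2)) = f x"
    using f by (auto simp: linv_fun_def)
  have p3: "f (x + ?e 3) = f x" "f (x + axis 3 \<i>) = f x" for x
    using inv[OF gax(1)[of 3], of x] inv[OF gax(2)[of 3], of x] by (simp_all add: axis_def)
  define f1 where "f1 = FE2 (0, 0) (?e 3) f"
  obtain c3 where c3: "smooth c3" "\<And>x. dg (1/2) (\<i>/2) (?e 3) c3 x = f x - f1 x"
    "\<And>\<phi> x. (\<And>x. f (\<phi> x) = f x) \<Longrightarrow> (\<And>x s. \<phi> (x + s *\<^sub>R ?e 3) = \<phi> x + s *\<^sub>R ?e 3) \<Longrightarrow>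
      (\<And>x s. \<phi> (x + s *\<^sub>R (\<i> *s ?e 3)) = \<phi> x + s *\<^sub>R (\<i> *s ?e 3)) \<Longrightarrow> c3 (\<phi> x) = c3 x"
    using torus_dbar[OF sm p3(1) p3(2)[folded ie]] unfolding f1_def by metis
  have s1: "smooth f1" by (simp add: f1_def sm)
  have eq3: "x + s *\<^sub>R a + w + zc (w $ 1 * (x + s *\<^sub>R a) $ 2) = x + w + zc (w $ 1 * x $ 2) + s *\<^sub>R a" if "a $ 2 = 0" for x w s and a :: cvec
    using that by (simp add: algebra_simps)
  have a32: "?e 3 $ 2 = 0" "(\<i> *s ?e 3) $ 2 = 0" by (simp_all add: axis_def)
  \<comment> \<open>Translation along the center commutes with the whole lattice action, so the
    symmetry clause gives the invariance of \<open>c3\<close>.\<close>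
  have l3: "linv_fun c3"
    unfolding linv_fun_def using c3(1) by (intro conjI allI impI c3(3) inv eq3 a32) auto
  have i1: "f1 (x + w + zc (w $ 1 * x $ 2)) = f1 x" if "gvec w" for w x
    unfolding f1_def by (rule FE2_0_equivariant) (intro inv that eq3 a32)+
  have d1: "dd (?e 3) f1 = (\<lambda>x. 0)" "dd (axis 3 \<i>) f1 = (\<lambda>x. 0)"
    using dd_FE2_0[OF sm p3(1) p3(2)[folded ie]] unfolding f1_def ie by blast+
  have Z1: "f1 (x + zc c) = f1 x" for x c
    using zero_dd_line[OF s1 d1] unfolding zc_def .
  have t1: "f1 (x + w) = f1 x" if "gvec w" for w x using i1[OF that, of x] Z1 by simp
  define f2 where "f2 = FE2 (0, 0) (?e 1) f1"
  obtain c1 where c1: "smooth c1" "\<And>x. dg (1/2) (\<i>/2) (?e 1) c1 x = f1 x - f2 x"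
    "\<And>\<phi> x. (\<And>x. f1 (\<phi> x) = f1 x) \<Longrightarrow> (\<And>x s. \<phi> (x + s *\<^sub>R ?e 1) = \<phi> x + s *\<^sub>R ?e 1) \<Longrightarrow>
      (\<And>x s. \<phi> (x + s *\<^sub>R (\<i> *s ?e 1)) = \<phi> x + s *\<^sub>R (\<i> *s ?e 1)) \<Longrightarrow> c1 (\<phi> x) = c1 x"
    using torus_dbar[OF s1 t1[OF gax(1)] t1[OF gax(2), folded ie], of 1] unfolding f2_def by metis
  have s2: "smooth f2" by (simp add: f2_def s1)
  have tr: "(\<lambda>x. x + w) (x + s *\<^sub>R a) = (\<lambda>x. x + w) x + s *\<^sub>R a" for x w s and a :: cvec
    by (simp add: algebra_simps)
  have zd: "dg (1/2) (\<i>/2) (?e 3) h x = 0" if "smooth h" "\<And>x c. h (x + zc c) = h x" for h x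
  proof -
    have "Zinv (\<lambda>x v. h x)" "smoothf (\<lambda>x v. h x)" using that by (auto simp: Zinv_def smoothf_def)
    from dg_central_dir[OF this, of "1/2" "\<i>/2" 1 x] show ?thesis by (simp add: zc_def)
  qed
  have ct1: "c1 (x + w) = c1 x" if "\<And>x. f1 (x + w) = f1 x" for x w
    using c1(3)[of "\<lambda>x. x + w", OF that tr tr] .
  have l1: "linv_fun c1"
  proof -
    have "c1 (x + w + zc c) = c1 x" if "gvec w" for w x c
      using ct1[OF Z1] ct1[OF t1[OF that]] by simp
    then show ?thesis using c1(1) by (simp add: linv_fun_def)
  qed
  have t2: "f2 (x + w) = f2 x" if "\<And>x. f1 (x + w) = f1 x" for x w
    unfolding f2_def by (rule FE2_0_equivariant[of f1 "\<lambda>x. x + w"]) (simp_all add: that tr)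
  have d2: "dd (?e 1) f2 = (\<lambda>x. 0)" "dd (axis 1 \<i>) f2 = (\<lambda>x. 0)"
    using dd_FE2_0[OF s1 t1[OF gax(1)] t1[OF gax(2), folded ie], of 1] unfolding f2_def ie by blast+
  define f3 where "f3 = FE2 (0, 0) (?e 2) f2"
  obtain c2 where c2: "smooth c2" "\<And>x. dg (1/2) (\<i>/2) (?e 2) c2 x = f2 x - f3 x"
    "\<And>\<phi> x. (\<And>x. f2 (\<phi> x) = f2 x) \<Longrightarrow> (\<And>x s. \<phi> (x + s *\<^sub>R ?e 2) = \<phi> x + s *\<^sub>R ?e 2) \<Longrightarrow>
      (\<And>x s. \<phi> (x + s *\<^sub>R (\<i> *s ?e 2)) = \<phi> x + s *\<^sub>R (\<i> *s ?e 2)) \<Longrightarrow> c2 (\<phi> x) = c2 x"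
    using torus_dbar[OF s2 t2[OF t1[OF gax(1)]] t2[OF t1[OF gax(2)], folded ie], of 2] unfolding f3_def by metis
  have s3: "smooth f3" by (simp add: f3_def s2)
  have ct2: "c2 (x + w) = c2 x" if "\<And>x. f2 (x + w) = f2 x" for x w
    using c2(3)[of "\<lambda>x. x + w", OF that tr tr] .
  have l2: "linv_fun c2"
  proof -
    have "c2 (x + w + zc c) = c2 x" if "gvec w" for w x c
      using ct2[OF t2[OF Z1]] ct2[OF t2[OF t1[OF that]]] by simp
    then show ?thesis using c2(1) by (simp add: linv_fun_def)
  qed
  \<comment> \<open>Derivatives commute with averages, so the directions in which an earlier average
    is constant remain so.\<close>
  have d3: "dd (axis j c) f3 = (\<lambda>x. 0)" if "c = 1 \<or> c = \<i>" for j c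
  proof -
    have "dd (axis 2 1) f3 = (\<lambda>x. 0)" "dd (axis 2 \<i>) f3 = (\<lambda>x. 0)"
      using dd_FE2_0[OF s2 t2[OF t1[OF gax(1)]] t2[OF t1[OF gax(2)], folded ie], of 2] unfolding f3_def ie by blast+
    moreover have "dd (axis 1 c) f3 = (\<lambda>x. 0)"
      unfolding f3_def dd_FE2[OF s2] using d2 that by (auto simp: FE2_zero)
    moreover have "dd (axis 3 c) f3 = (\<lambda>x. 0)"
      unfolding f3_def f2_def dd_FE2[OF s2[unfolded f2_def]] dd_FE2[OF s1] using d1 that by (auto simp: FE2_zero)
    ultimately show ?thesis using exhaust_3[of j] that by auto
  qed
  have "f3 x = f3 0" for x
  proof -
    have "f3 (x + axis j c) = f3 x" for x j c
      by (rule zero_dd_line[OF s3 d3 d3]) auto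
    moreover have "x = 0 + axis 1 (x $ 1) + axis 2 (x $ 2) + axis 3 (x $ 3)"
      by (simp add: vec_eq_iff forall_3 axis_def)
    ultimately show ?thesis by metis
  qed
  note k = this
  have fe: "f x = f3 0 + dg (1/2) (\<i>/2) (?e 1) c1 x + dg (1/2) (\<i>/2) (?e 2) c2 x + dg (1/2) (\<i>/2) (?e 3) c3 x" for x
    using c1(2)[of x] c2(2)[of x] c3(2)[of x] k[of x] by simp
  show ?thesis by (rule that[OF l1 l2 l3 zd[OF c1(1) ct1[OF Z1]] zd[OF c2(1) ct2[OF t2[OF Z1]]] fe])
qed

lemma is_form_fmult:
  assumes "linv_fun f" "is_form k \<omega>"
  shows "is_form k (\<lambda>x v. f x * \<omega> x v)"
  unfolding is_form_iff
proof (intro conjI allI)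
  show "is_covector k (\<lambda>v. f x * \<omega> x v)" for x by (rule is_covector_cmult[OF is_formD(1)[OF assms(2)]])
  show "smoothf (\<lambda>x v. f x * \<omega> x v)"
    using assms is_formD(2)[OF assms(2)] by (auto simp: smoothf_def linv_fun_def)
  show "ginv (\<lambda>x v. f x * \<omega> x v)"
    using assms is_formD(3)[OF assms(2)] by (simp add: ginv_def linv_fun_def)
qed

lemma ext_gen_fmult:
  assumes "smooth f" "smoothf \<omega>"
  shows "ext_gen p q k (\<lambda>x v. f x * \<omega> x v) x v =
    f x * ext_gen p q k \<omega> x v + (\<Sum>i\<le>k. (- 1) ^ i * (dg p q (v i) f x * \<omega> x (omit i v)))"
  by (simp add: ext_gen_def dg_mult assms smoothfD sum.distrib sum_distrib_left algebra_simps)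

lemma dbar_fun_expand:
  assumes "smooth f"
  shows "dg (1/2) (\<i>/2) u f x = cnj (u $ 1) * dg (1/2) (\<i>/2) (axis 1 1) f x +
    cnj (u $ 2) * dg (1/2) (\<i>/2) (axis 2 1) f x + cnj (u $ 3) * dg (1/2) (\<i>/2) (axis 3 1) f x"
proof -
  have e: "u = Re (u$1) *\<^sub>R axis 1 1 + Im (u$1) *\<^sub>R axis 1 \<i> + Re (u$2) *\<^sub>R axis 2 1 + Im (u$2) *\<^sub>R axis 2 \<i>
      + Re (u$3) *\<^sub>R axis 3 1 + Im (u$3) *\<^sub>R axis 3 \<i>" for u :: cvec
    by (simp add: vec_eq_iff forall_3 axis_def complex_eq_iff)
  have d: "dd u f x = Re (u$1) * dd (axis 1 1) f x + Im (u$1) * dd (axis 1 \<i>) f x + Re (u$2) * dd (axis 2 1) f x +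
      Im (u$2) * dd (axis 2 \<i>) f x + Re (u$3) * dd (axis 3 1) f x + Im (u$3) * dd (axis 3 \<i>) f x" for u
    by (subst e[of u]) (simp only: dd_add_dir[OF assms] dd_scaleR_dir[OF assms])
  have c: "cnj z = complex_of_real (Re z) - \<i> * complex_of_real (Im z)" for z
    by (simp add: complex_eq_iff)
  show ?thesis
    unfolding dg_def d[of u] d[of "\<i> *s u"] c NL_axis
    by (simp add: field_simps)
qed

theorem Dolbeault_03_spanning:
  assumes "\<omega> \<in> dbar_closed_forms 0 3"
  shows "\<exists>c. \<exists>\<eta>\<in>pq_forms 0 2. \<forall>x v. \<omega> x v = c * W 3 4 5 x v + dbar 2 \<eta> x v"
proof -
  have \<omega>: "is_form 3 \<omega>" and b: "bidegree 3 0 (\<omega> x) \<and> (3::nat) = 0 \<or> bidegree 0 3 (\<omega> x) \<and> (3::nat) = 3" for x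
    using assms by (auto simp: dbar_closed_forms_def pq_forms_def)
  have n: "Suc 3 = 4" "Suc 4 = 5" by simp_all
  note top = top_coefficient[OF \<omega> b, unfolded n]
  obtain c1 c2 c3 k where c: "linv_fun c1" "linv_fun c2" "linv_fun c3"
    "\<And>x. dg (1/2) (\<i>/2) (axis 3 1) c1 x = 0" "\<And>x. dg (1/2) (\<i>/2) (axis 3 1) c2 x = 0"
    "\<And>x. \<omega> x eee = k + dg (1/2) (\<i>/2) (axis 1 1) c1 x + dg (1/2) (\<i>/2) (axis 2 1) c2 x + dg (1/2) (\<i>/2) (axis 3 1) c3 x"
    using linv_fun_dbar_decomposition[OF top(1)] by metis
  have s: "smooth c1" "smooth c2" "smooth c3" using c by (auto simp: linv_fun_def)
  let ?w = "\<lambda>a b. wedge [fr a, fr b]"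
  \<comment> \<open>Each coefficient multiplies the two-form that omits one conjugate frame element,
    with the sign that makes the wedge with this element equal to \<open>W 3 4 5\<close>. Since
    \<open>dzbar 3\<close> is \<open>bar \<gamma>\<close> plus a multiple of
    \<open>bar \<beta>\<close>, a central derivative of \<open>c2\<close> would contribute as well;
    the decomposition provides that it is zero.\<close>
  let ?\<eta> = "\<lambda>x v. c1 x * ?w 4 5 x v + - 1 * (c2 x * ?w 3 5 x v) + c3 x * ?w 3 4 x v"
  have wf: "is_form 2 (?w a b)" "Linv 2 (?w a b)" "smoothf (?w a b)" if "a < 6" "b < 6" for a b
    using lframe_wedge2[OF lframe_fr lframe_fr, OF that] is_formD(2) by blast+
  have "is_form 2 ?\<eta>"
    by (intro is_form_add is_form_cmult is_form_fmult c wf) auto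
  moreover have "bidegree 0 2 (?\<eta> x)" for x
  proof -
    have "?w 4 5 x = wedge_covectors (map dz [] @ map dzbar [2, 3])"
      "?w 3 5 x = (\<lambda>v. wedge_covectors (map dz [] @ map dzbar [1, 3]) v + - cnj (x $ 1) * wedge_covectors (map dz [] @ map dzbar [1, 2]) v)"
      "?w 3 4 x = wedge_covectors (map dz [] @ map dzbar [1, 2])"
      by (simp_all add: wedge_def wedge_covectors2 fr_coords fun_eq_iff algebra_simps)
    then show ?thesis by (simp only:) (intro bidegree_add bidegree_cmult bidegree_wedge; simp)
  qed
  ultimately have mem: "?\<eta> \<in> pq_forms 0 2" by (simp add: pq_forms_def numeral_2_eq_2)
  have z: "ext_gen (1/2) (\<i>/2) 2 (?w a b) x v = 0" if "(a, b) \<in> {(4, 5), (3, 5), (3, 4)}" for a b x v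
  proof -
    have ab: "a < 6" "b < 6" using that by auto
    show ?thesis
      unfolding Linv_ext_gen[OF wf(2)[OF ab]]
        ins2'[where \<omega> = "?w a b" and x = x, OF is_formD(1)[OF wf(1)[OF ab]]]
      using that
      by (auto simp: wedge2 pr_def fr_coords dzbar_def NL_def omit_def numeral_2_eq_2 algebra_simps)
  qed
  have z45: "ext_gen (1/2) (\<i>/2) 2 (?w 4 5) x v = 0" "ext_gen (1/2) (\<i>/2) 2 (?w 3 5) x v = 0" "ext_gen (1/2) (\<i>/2) 2 (?w 3 4) x v = 0" for x v
    by (rule z; simp)+
  have "dbar 2 ?\<eta> x v = (dg (1/2) (\<i>/2) (axis 1 1) c1 x + dg (1/2) (\<i>/2) (axis 2 1) c2 x + dg (1/2) (\<i>/2) (axis 3 1) c3 x) * W 3 4 5 x v" for x v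
  proof -
    have sm: "smoothf (\<lambda>x v. f x * \<omega> x v)" if "smooth f" "smoothf \<omega>" for f \<omega> using that by (simp add: smoothf_def)
    have smc: "smoothf (\<lambda>x v. c * \<omega> x v)" if "smoothf \<omega>" for c \<omega> using that by (simp add: smoothf_def)
    have "dbar 2 ?\<eta> x v = ext_gen (1/2) (\<i>/2) 2 (\<lambda>x v. c1 x * ?w 4 5 x v) x v
        + - 1 * ext_gen (1/2) (\<i>/2) 2 (\<lambda>x v. c2 x * ?w 3 5 x v) x v + ext_gen (1/2) (\<i>/2) 2 (\<lambda>x v. c3 x * ?w 3 4 x v) x v"
      unfolding dbar_eq by (simp only: ext_gen_add ext_gen_cmult sm smc smoothf_add s wf(3)[of 4 5, simplified] wf(3)[of 3 5, simplified] wf(3)[of 3 4, simplified])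
    also have "\<dots> = (dg (1/2) (\<i>/2) (axis 1 1) c1 x + dg (1/2) (\<i>/2) (axis 2 1) c2 x + dg (1/2) (\<i>/2) (axis 3 1) c3 x) * W 3 4 5 x v"
      unfolding ext_gen_fmult[OF s(1) wf(3)[of 4 5, simplified]] ext_gen_fmult[OF s(2) wf(3)[of 3 5, simplified]]
        ext_gen_fmult[OF s(3) wf(3)[of 3 4, simplified]]
        dbar_fun_expand[OF s(1), of "v _"] dbar_fun_expand[OF s(2), of "v _"] dbar_fun_expand[OF s(3), of "v _"] c(4,5) z45
      by (simp add: wedge2 wedge3 fr_coords dzbar_def omit_def numeral_2_eq_2) (simp add: algebra_simps)
    finally show ?thesis .
  qed
  then have "\<omega> x v = k * W 3 4 5 x v + dbar 2 ?\<eta> x v" for x v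
    using top(2)[of x v] c(6)[of x] by (simp add: algebra_simps)
  with mem show ?thesis by blast
qed

section \<open>Coordinates on complex vector spaces\<close>

text \<open>Coordinates are sequences of which only the first \<open>n\<close> entries count:
  \<open>q\<close> is linear and onto, with kernel the sequences vanishing there. This expresses a
  basis of \<open>M\<close> without first proving its module axioms.\<close>

definition coord :: "(complex, 'a) module \<Rightarrow> nat \<Rightarrow> ((nat \<Rightarrow> complex) \<Rightarrow> 'a) \<Rightarrow> bool" where
  "coord M n q \<longleftrightarrow> carrier M = range q \<and> (\<forall>c d. q (\<lambda>i. c i + d i) = q c \<oplus>\<^bsub>M\<^esub> q d) \<and>
     (\<forall>k c. q (\<lambda>i. k * c i) = k \<odot>\<^bsub>M\<^esub> q c) \<and> (\<forall>c d. q c = q d \<longleftrightarrow> (\<forall>i<n. c i = d i))"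

definition dl :: "nat \<Rightarrow> nat \<Rightarrow> complex" where
  "dl i = (\<lambda>j. if j = i then 1 else 0)"

text \<open>Truncations allow inductions that add one basis vector \<open>dl m\<close> at a
  time.\<close>

definition tr :: "nat \<Rightarrow> (nat \<Rightarrow> complex) \<Rightarrow> nat \<Rightarrow> complex" where
  "tr m c = (\<lambda>i. if i < m then c i else 0)"

lemma tr_simps: "tr 0 c = (\<lambda>i. 0 * c i)" "tr (Suc m) c = (\<lambda>i. tr m c i + c m * dl m i)"
  by (auto simp: tr_def dl_def fun_eq_iff less_Suc_eq)

lemma coordD:
  assumes "coord M n q"
  shows "carrier M = range q" "q (\<lambda>i. c i + d i) = q c \<oplus>\<^bsub>M\<^esub> q d" "q (\<lambda>i. k * c i) = k \<odot>\<^bsub>M\<^esub> q c"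
    "q c = q d \<longleftrightarrow> (\<forall>i<n. c i = d i)"
  using assms unfolding coord_def by metis+

definition coord_linear :: "nat \<Rightarrow> nat \<Rightarrow> ((nat \<Rightarrow> complex) \<Rightarrow> nat \<Rightarrow> complex) \<Rightarrow> bool" where
  "coord_linear n n' A \<longleftrightarrow> (\<forall>c d. A (\<lambda>i. c i + d i) = (\<lambda>i. A c i + A d i)) \<and> (\<forall>k c. A (\<lambda>i. k * c i) = (\<lambda>i. k * A c i)) \<and>
     (\<forall>c d. (\<forall>i<n. c i = d i) \<longrightarrow> (\<forall>i<n'. A c i = A d i))"

text \<open>The linear map with coordinate expression \<open>A\<close>. The chosen coordinates are
  determined up to entries that do not affect the result when \<open>A\<close> is
  \<open>coord_linear\<close>.\<close>

definition cmap :: "((nat \<Rightarrow> complex) \<Rightarrow> 'a) \<Rightarrow> ((nat \<Rightarrow> complex) \<Rightarrow> 'b) \<Rightarrow> ((nat \<Rightarrow> complex) \<Rightarrow> nat \<Rightarrow> complex) \<Rightarrow> 'a \<Rightarrow> 'b" where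
  "cmap q q' A a = q' (A (SOME c. q c = a))"

lemma cmap_apply:
  assumes "coord M n q" "coord N n' q'" "coord_linear n n' A"
  shows "cmap q q' A (q c) = q' (A c)"
proof -
  have "q (SOME d. q d = q c) = q c" by (rule someI[of "\<lambda>d. q d = q c" c]) simp
  then show ?thesis
    unfolding cmap_def using assms(3) unfolding coordD(4)[OF assms(1)] coordD(4)[OF assms(2)] coord_linear_def by blast
qed

lemma linear_maps_coord:
  assumes M: "coord M n q" and N: "coord N n' q'" and A: "coord_linear n n' A" and F: "\<And>c. F (q c) = q' (A c)"
  shows "F \<in> linear_maps M N"
  unfolding linear_maps_def coordD(1)[OF M] coordD(1)[OF N]
proof (intro CollectI conjI allI ballI)
  show "F \<in> range q \<rightarrow> range q'" by (auto simp: F)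
  show "F (a \<oplus>\<^bsub>M\<^esub> b) = F a \<oplus>\<^bsub>N\<^esub> F b" if "a \<in> range q" "b \<in> range q" for a b
    using that A by (auto simp: F coord_linear_def simp flip: coordD(2)[OF M] coordD(2)[OF N])
  show "F (k \<odot>\<^bsub>M\<^esub> a) = k \<odot>\<^bsub>N\<^esub> F a" if "a \<in> range q" for a k
    using that A by (auto simp: F coord_linear_def simp flip: coordD(3)[OF M] coordD(3)[OF N])
qed

lemma inj_on_coord:
  assumes M: "coord M n q" and N: "coord N n' q'" and F: "\<And>c. F (q c) = q' (A c)"
    and inj: "\<And>c d. \<forall>i<n'. A c i = A d i \<Longrightarrow> \<forall>i<n. c i = d i"
  shows "inj_on F (carrier M)"
  unfolding coordD(1)[OF M]
proof (rule inj_onI)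
  fix a b assume "a \<in> range q" "b \<in> range q" "F a = F b"
  then obtain c d where cd: "a = q c" "b = q d" by blast
  with \<open>F a = F b\<close> have "\<forall>i<n'. A c i = A d i" by (simp add: F coordD(4)[OF N])
  from inj[OF this] show "a = b" unfolding cd coordD(4)[OF M] .
qed

lemma linear_isos_coord:
  assumes M: "coord M n q" and N: "coord N n' q'" and A: "coord_linear n n' A" and F: "\<And>c. F (q c) = q' (A c)"
    and inj: "\<And>c d. \<forall>i<n'. A c i = A d i \<Longrightarrow> \<forall>i<n. c i = d i"
    and surj: "\<And>c'. \<exists>c. \<forall>i<n'. A c i = c' i"
  shows "F \<in> linear_isos M N"
proof -
  have "F ` range q = range q'"
  proof -
    have "q' c' \<in> F ` range q" for c'
    proof -
      obtain c where "\<forall>i<n'. A c i = c' i" using surj by blast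
      then have "q' c' = F (q c)" unfolding F coordD(4)[OF N] by simp
      then show ?thesis by blast
    qed
    then show ?thesis by (auto simp: F)
  qed
  then show ?thesis
    using linear_maps_coord[OF M N A F] inj_on_coord[where A = A, OF M N F inj]
    by (simp add: linear_isos_def bij_betw_def coordD(1)[OF M] coordD(1)[OF N])
qed

text \<open>The classes of the generating forms are exactly the coordinate basis, so a linear map is
  determined by its values on them.\<close>

lemma canonical_map_coord:
  assumes M: "coord M n q" and N: "coord N n' q'" and A: "coord_linear n n' A"
    and S1: "\<And>\<omega>. \<omega> \<in> S \<Longrightarrow> \<exists>i<n. clM \<omega> = q (dl i) \<and> clN (T \<omega>) = q' (A (dl i))"
    and S2: "\<And>i. i < n \<Longrightarrow> \<exists>\<omega>\<in>S. clM \<omega> = q (dl i) \<and> clN (T \<omega>) = q' (A (dl i))"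
  shows "canonical_map M N S T clM clN (cmap q q' A)"
  unfolding canonical_map_def
proof (intro conjI ballI impI)
  note F = cmap_apply[OF M N A]
  note L = linear_maps_coord[OF M N A F]
  show "cmap q q' A \<in> linear_maps M N" by (rule L)
  show "cmap q q' A (clM \<omega>) = clN (T \<omega>)" if "\<omega> \<in> S" for \<omega>
    using S1[OF that] F by auto
  fix g a assume g: "g \<in> linear_maps M N" and gS: "\<forall>\<omega>\<in>S. g (clM \<omega>) = clN (T \<omega>)" and a: "a \<in> carrier M"
  have gd: "g (q (dl i)) = q' (A (dl i))" if "i < n" for i using S2[OF that] gS by metis
  have mem: "q c \<in> carrier M" for c by (simp add: coordD(1)[OF M])
  have g1: "g (x \<oplus>\<^bsub>M\<^esub> y) = g x \<oplus>\<^bsub>N\<^esub> g y" "g (k \<odot>\<^bsub>M\<^esub> x) = k \<odot>\<^bsub>N\<^esub> g x" if "x \<in> carrier M" "y \<in> carrier M" for x y k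
    using g that unfolding linear_maps_def by blast+
  have gm: "g (q (tr m c)) = q' (A (tr m c))" if "m \<le> n" for m c
    using that
  proof (induction m)
    case 0
    \<comment> \<open>The image of zero is computed through multiplication by 0, since additivity
      alone would need cancellation in \<open>N\<close>.\<close>
    obtain c' where c': "g (q c) = q' c'" using g mem[of c] unfolding linear_maps_def coordD(1)[OF N] by blast
    have "g (q (tr 0 c)) = 0 \<odot>\<^bsub>N\<^esub> g (q c)"
      unfolding tr_simps coordD(3)[OF M] by (rule g1(2)[OF mem mem])
    also have "\<dots> = q' (\<lambda>i. 0 * c' i)" unfolding c' coordD(3)[OF N] ..
    also have "\<dots> = q' (A (tr 0 c))"
    proof -
      have "A (\<lambda>i. 0 * c i) = (\<lambda>i. 0 * A c i)" using A unfolding coord_linear_def by blast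
      then show ?thesis unfolding tr_simps by simp
    qed
    finally show ?case .
  next
    case (Suc m)
    have "g (q (tr (Suc m) c)) = g (q (tr m c)) \<oplus>\<^bsub>N\<^esub> c m \<odot>\<^bsub>N\<^esub> g (q (dl m))"
      unfolding tr_simps coordD(2)[OF M] g1(1)[OF mem mem] unfolding coordD(3)[OF M] g1(2)[OF mem mem] ..
    also have "\<dots> = q' (A (tr (Suc m) c))"
      using Suc A gd[of m] unfolding tr_simps coord_linear_def by (simp add: coordD(2,3)[OF N])
    finally show ?case .
  qed
  obtain c where c: "a = q c" using a unfolding coordD(1)[OF M] by blast
  have "q c = q (tr n c)" unfolding coordD(4)[OF M] by (simp add: tr_def)
  then show "g a = cmap q q' A a" using F[of "tr n c"] gm[of n c] c by simp
qed

text \<open>Conjugating the coordinates makes up for the conjugated action of scalars.\<close>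

lemma coord_conjugate:
  assumes "coord M n q"
  shows "coord (conjugate_module M) n (\<lambda>c. q (\<lambda>i. cnj (c i)))"
  unfolding coord_def
proof (intro conjI allI)
  have "range q \<subseteq> range (\<lambda>c. q (\<lambda>i. cnj (c i)))"
  proof
    fix y assume "y \<in> range q"
    then obtain c where "y = q c" by blast
    then show "y \<in> range (\<lambda>c. q (\<lambda>i. cnj (c i)))" by (intro range_eqI[where x = "\<lambda>i. cnj (c i)"]) simp
  qed
  then show "carrier (conjugate_module M) = range (\<lambda>c. q (\<lambda>i. cnj (c i)))"
    using coordD(1)[OF assms] by (auto simp: conjugate_module_def)
qed (use coordD(2-4)[OF assms] in \<open>simp_all add: conjugate_module_def\<close>)

lemma coord_direct_sum:
  assumes M: "coord M m q" and N: "coord N n q'"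
  shows "coord (M \<oplus>\<^sub>m N) (m + n) (\<lambda>c. (q c, q' (\<lambda>i. c (m + i))))"
  unfolding coord_def
proof (intro conjI allI)
  show "carrier (M \<oplus>\<^sub>m N) = range (\<lambda>c. (q c, q' (\<lambda>i. c (m + i))))"
  proof -
    have "(q a, q' b) \<in> range (\<lambda>c. (q c, q' (\<lambda>i. c (m + i))))" for a b
    proof -
      let ?c = "\<lambda>i. if i < m then a i else b (i - m)"
      have "q a = q ?c" "q' b = q' (\<lambda>i. ?c (m + i))"
        unfolding coordD(4)[OF M] coordD(4)[OF N] by auto
      then show ?thesis by blast
    qed
    then show ?thesis by (auto simp: direct_sum_def coordD(1)[OF M] coordD(1)[OF N])
  qed
  show "(q c, q' (\<lambda>i. c (m + i))) = (q d, q' (\<lambda>i. d (m + i))) \<longleftrightarrow> (\<forall>i<m + n. c i = d i)" for c d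
  proof -
    have "(\<forall>i<m + n. c i = d i) \<longleftrightarrow> (\<forall>i<m. c i = d i) \<and> (\<forall>i<n. c (m + i) = d (m + i))"
    proof (intro iffI conjI allI impI)
      fix i assume *: "(\<forall>i<m. c i = d i) \<and> (\<forall>i<n. c (m + i) = d (m + i))" "i < m + n"
      then show "c i = d i" by (cases "i < m") (auto dest!: spec[of _ "i - m"])
    qed auto
    then show ?thesis by (simp add: coordD(4)[OF M] coordD(4)[OF N])
  qed
qed (simp_all add: direct_sum_def coordD(2,3)[OF M] coordD(2,3)[OF N])

section \<open>Quotients of spaces of forms\<close>

definition fsub :: "form set \<Rightarrow> bool" where
  "fsub B \<longleftrightarrow> zero_form \<in> B \<and> (\<forall>\<omega>\<in>B. \<forall>\<eta>\<in>B. (\<lambda>x v. \<omega> x v + \<eta> x v) \<in> B) \<and> (\<forall>c. \<forall>\<omega>\<in>B. (\<lambda>x v. c * \<omega> x v) \<in> B)"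

abbreviation Qm :: "form set \<Rightarrow> form set \<Rightarrow> (complex, form set) module" where
  "Qm Z B \<equiv> quotient_module (form_space\<lparr>carrier := Z\<rparr>) B"

abbreviation cls :: "form set \<Rightarrow> form \<Rightarrow> form set" where
  "cls B \<omega> \<equiv> B +>\<^bsub>form_space\<^esub> \<omega>"

definition lincomb :: "(nat \<Rightarrow> form) \<Rightarrow> nat \<Rightarrow> (nat \<Rightarrow> complex) \<Rightarrow> form" where
  "lincomb g n c = (\<lambda>x v. \<Sum>i<n. c i * g i x v)"

lemma cls_def: "cls B \<omega> = {\<lambda>x v. b x v + \<omega> x v | b. b \<in> B}"
  by (auto simp: a_r_coset_def' form_space_def)

lemma fsubD:
  assumes "fsub B"
  shows "zero_form \<in> B" "\<omega> \<in> B \<Longrightarrow> \<eta> \<in> B \<Longrightarrow> (\<lambda>x v. \<omega> x v + \<eta> x v) \<in> B" "\<omega> \<in> B \<Longrightarrow> (\<lambda>x v. c * \<omega> x v) \<in> B"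
  using assms unfolding fsub_def by blast+

lemma clsI: "b \<in> B \<Longrightarrow> \<sigma> = (\<lambda>x v. b x v + \<omega> x v) \<Longrightarrow> \<sigma> \<in> cls B \<omega>"
  by (auto simp: cls_def)

lemma clsE:
  assumes "\<sigma> \<in> cls B \<omega>"
  obtains b where "b \<in> B" "\<sigma> = (\<lambda>x v. b x v + \<omega> x v)"
  using assms by (auto simp: cls_def)

lemma cls_self: "fsub B \<Longrightarrow> \<omega> \<in> cls B \<omega>"
  by (rule clsI[OF fsubD(1)]) (simp_all add: zero_form_def)

lemma cls_eq_iff:
  assumes B: "fsub B"
  shows "cls B \<omega> = cls B \<eta> \<longleftrightarrow> (\<lambda>x v. \<omega> x v - \<eta> x v) \<in> B"
proof
  assume eq: "cls B \<omega> = cls B \<eta>"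
  have "\<omega> \<in> cls B \<eta>" using cls_self[OF B, of \<omega>] unfolding eq .
  then obtain b where "b \<in> B" "\<omega> = (\<lambda>x v. b x v + \<eta> x v)" by (rule clsE)
  then show "(\<lambda>x v. \<omega> x v - \<eta> x v) \<in> B" by simp
next
  have sub: "cls B \<omega> \<subseteq> cls B \<eta>" if "(\<lambda>x v. \<omega> x v - \<eta> x v) \<in> B" for \<omega> \<eta>
  proof
    fix \<sigma> assume "\<sigma> \<in> cls B \<omega>"
    then obtain b where b: "b \<in> B" "\<sigma> = (\<lambda>x v. b x v + \<omega> x v)" by (rule clsE)
    have "\<sigma> = (\<lambda>x v. (b x v + (\<omega> x v - \<eta> x v)) + \<eta> x v)" by (simp add: b(2))
    then show "\<sigma> \<in> cls B \<eta>" by (rule clsI[OF fsubD(2)[OF B b(1) that]])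
  qed
  assume d: "(\<lambda>x v. \<omega> x v - \<eta> x v) \<in> B"
  have "(\<lambda>x v. \<eta> x v - \<omega> x v) \<in> B" using fsubD(3)[OF B d, of "- 1"] by simp
  with sub d show "cls B \<omega> = cls B \<eta>" by blast
qed

lemma Qm_simps:
  "carrier (Qm Z B) = cls B ` Z" "\<zero>\<^bsub>Qm Z B\<^esub> = B"
  by (auto simp: quotient_module_def A_RCOSETS_def' a_r_coset_def' form_space_def)

lemma Qm_add:
  assumes B: "fsub B"
  shows "cls B \<omega> \<oplus>\<^bsub>Qm Z B\<^esub> cls B \<eta> = cls B (\<lambda>x v. \<omega> x v + \<eta> x v)"
proof -
  have "cls B \<omega> \<oplus>\<^bsub>Qm Z B\<^esub> cls B \<eta> = (\<Union>h\<in>cls B \<omega>. \<Union>k\<in>cls B \<eta>. {\<lambda>x v. h x v + k x v})"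
    by (simp add: quotient_module_def set_add_def') (simp add: form_space_def)
  also have "\<dots> = cls B (\<lambda>x v. \<omega> x v + \<eta> x v)"
  proof (intro equalityI subsetI)
    fix \<sigma> assume "\<sigma> \<in> (\<Union>h\<in>cls B \<omega>. \<Union>k\<in>cls B \<eta>. {\<lambda>x v. h x v + k x v})"
    then obtain h k where hk: "\<sigma> = (\<lambda>x v. h x v + k x v)" "h \<in> cls B \<omega>" "k \<in> cls B \<eta>"
      by (elim UN_E singletonE)
    obtain b where b: "b \<in> B" "h = (\<lambda>x v. b x v + \<omega> x v)" using hk(2) by (rule clsE)
    obtain b' where b': "b' \<in> B" "k = (\<lambda>x v. b' x v + \<eta> x v)" using hk(3) by (rule clsE)
    have "\<sigma> = (\<lambda>x v. (b x v + b' x v) + (\<omega> x v + \<eta> x v))" unfolding hk(1) b(2) b'(2) by (simp add: algebra_simps)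
    then show "\<sigma> \<in> cls B (\<lambda>x v. \<omega> x v + \<eta> x v)" by (rule clsI[OF fsubD(2)[OF B b(1) b'(1)]])
  next
    fix \<sigma> assume "\<sigma> \<in> cls B (\<lambda>x v. \<omega> x v + \<eta> x v)"
    then obtain b where b: "b \<in> B" "\<sigma> = (\<lambda>x v. b x v + (\<omega> x v + \<eta> x v))" by (rule clsE)
    have s: "\<sigma> = (\<lambda>x v. (b x v + \<omega> x v) + \<eta> x v)" unfolding b(2) by (simp add: add.assoc)
    show "\<sigma> \<in> (\<Union>h\<in>cls B \<omega>. \<Union>k\<in>cls B \<eta>. {\<lambda>x v. h x v + k x v})"
      by (rule UN_I[OF clsI[OF b(1) refl]], rule UN_I[OF cls_self[OF B]]) (simp add: s)
  qed
  finally show ?thesis .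
qed

text \<open>The union over representatives in \<open>quotient_module\<close> collapses: the scaled
  representatives differ by elements of \<open>B\<close>, so all members of the union are the same
  coset.\<close>

lemma Qm_smult:
  assumes B: "fsub B"
  shows "c \<odot>\<^bsub>Qm Z B\<^esub> cls B \<omega> = cls B (\<lambda>x v. c * \<omega> x v)"
proof -
  have e: "cls B (\<lambda>x v. c * a x v) = cls B (\<lambda>x v. c * \<omega> x v)" if a: "a \<in> cls B \<omega>" for a
  proof -
    obtain b where b: "b \<in> B" "a = (\<lambda>x v. b x v + \<omega> x v)" using a by (rule clsE)
    have "(\<lambda>x v. c * a x v - c * \<omega> x v) = (\<lambda>x v. c * b x v)" unfolding b(2) by (simp add: algebra_simps)
    then show ?thesis unfolding cls_eq_iff[OF B] using fsubD(3)[OF B b(1), of c] by simp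
  qed
  have "c \<odot>\<^bsub>Qm Z B\<^esub> cls B \<omega> = (\<Union>a\<in>cls B \<omega>. cls B (\<lambda>x v. c * a x v))"
    by (simp add: quotient_module_def a_r_coset_def') (simp add: form_space_def)
  also have "\<dots> = (\<Union>a\<in>cls B \<omega>. cls B (\<lambda>x v. c * \<omega> x v))"
    by (rule SUP_cong[OF refl e])
  also have "\<dots> = cls B (\<lambda>x v. c * \<omega> x v)"
    using cls_self[OF B, of \<omega>] by auto
  finally show ?thesis .
qed

lemma lincomb_add: "lincomb g n (\<lambda>i. c i + d i) = (\<lambda>x v. lincomb g n c x v + lincomb g n d x v)"
  by (simp add: lincomb_def distrib_right sum.distrib fun_eq_iff)

lemma lincomb_cmult: "lincomb g n (\<lambda>i. k * c i) = (\<lambda>x v. k * lincomb g n c x v)"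
  by (simp add: lincomb_def sum_distrib_left mult.assoc fun_eq_iff)

lemma lincomb_dl: "i < n \<Longrightarrow> lincomb g n (dl i) = g i"
  by (simp add: lincomb_def dl_def fun_eq_iff if_distrib[of "\<lambda>z. z * _"] cong: if_cong)

lemma lincomb_mem:
  assumes Z: "fsub Z" and g: "\<And>i. i < n \<Longrightarrow> g i \<in> Z"
  shows "lincomb g n c \<in> Z"
  using g
proof (induction n)
  case 0
  then show ?case using fsubD(1)[OF Z] by (simp add: lincomb_def zero_form_def)
next
  case (Suc n)
  have "lincomb g (Suc n) c = (\<lambda>x v. lincomb g n c x v + c n * g n x v)" by (simp add: lincomb_def)
  then show ?case using Suc fsubD(2)[OF Z _ fsubD(3)[OF Z]] by simp
qed

context
  fixes Z B :: "form set" and g :: "nat \<Rightarrow> form" and n :: nat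
  assumes Z: "fsub Z" and B: "fsub B" and g: "\<And>i. i < n \<Longrightarrow> g i \<in> Z"
    and ind: "\<And>c i. lincomb g n c \<in> B \<Longrightarrow> i < n \<Longrightarrow> c i = 0"
begin

private abbreviation "qq c \<equiv> cls B (lincomb g n c)"

private lemma qq_add: "qq (\<lambda>i. c i + d i) = qq c \<oplus>\<^bsub>Qm Z B\<^esub> qq d"
  by (simp add: Qm_add[OF B] lincomb_add)

private lemma qq_smult: "qq (\<lambda>i. k * c i) = k \<odot>\<^bsub>Qm Z B\<^esub> qq c"
  by (simp add: Qm_smult[OF B] lincomb_cmult)

private lemma qq_eq: "qq c = qq d \<longleftrightarrow> (\<forall>i<n. c i = d i)"
proof
  assume "qq c = qq d"
  then have "(\<lambda>x v. lincomb g n c x v - lincomb g n d x v) \<in> B" by (simp add: cls_eq_iff[OF B])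
  moreover have "(\<lambda>x v. lincomb g n c x v - lincomb g n d x v) = lincomb g n (\<lambda>i. c i - d i)"
    by (simp add: lincomb_def sum_subtractf left_diff_distrib fun_eq_iff)
  ultimately have "lincomb g n (\<lambda>i. c i - d i) \<in> B" by simp
  from ind[OF this] show "\<forall>i<n. c i = d i" by simp
qed (simp add: lincomb_def)

lemma coord_quotient:
  assumes "\<And>\<omega>. \<omega> \<in> Z \<Longrightarrow> \<exists>c. (\<lambda>x v. \<omega> x v - lincomb g n c x v) \<in> B"
  shows "coord (Qm Z B) n (\<lambda>c. cls B (lincomb g n c))"
  unfolding coord_def
proof (intro conjI allI qq_add qq_smult qq_eq)
  show "carrier (Qm Z B) = range (\<lambda>c. qq c)"
    unfolding Qm_simps
  proof (intro equalityI subsetI)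
    fix y assume "y \<in> cls B ` Z"
    then obtain \<omega> where \<omega>: "y = cls B \<omega>" "\<omega> \<in> Z" by (rule imageE)
    from assms[OF \<omega>(2)] obtain c where "(\<lambda>x v. \<omega> x v - lincomb g n c x v) \<in> B" by blast
    then have "y = qq c" unfolding \<omega>(1) cls_eq_iff[OF B] .
    then show "y \<in> range (\<lambda>c. qq c)" by auto
  next
    fix y assume "y \<in> range (\<lambda>c. qq c)"
    then show "y \<in> cls B ` Z" using lincomb_mem[OF Z g] by auto
  qed
qed

text \<open>The classes of linear combinations form a submodule, and by induction over truncations
  every submodule containing the generators contains them.\<close>

lemma coord_span:
  assumes S: "S = (\<lambda>i. cls B (g i)) ` {..<n}"
  shows "coord (span_module (Qm Z B) S) n (\<lambda>c. cls B (lincomb g n c))"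
proof -
  have mem: "qq c \<in> carrier (Qm Z B)" for c
    unfolding Qm_simps by (rule imageI) (rule lincomb_mem[OF Z g])
  have z: "qq (\<lambda>i. 0) = B"
  proof -
    have "lincomb g n (\<lambda>i. 0) = zero_form" by (simp add: lincomb_def zero_form_def)
    then show ?thesis by (auto simp: cls_def zero_form_def)
  qed
  have "submodule (range (\<lambda>c. qq c)) complex_ring (Qm Z B)"
  proof (intro submodule.intro subgroup.intro submodule_axioms.intro)
    show "range (\<lambda>c. qq c) \<subseteq> carrier (add_monoid (Qm Z B))" using mem by auto
    show "x \<otimes>\<^bsub>add_monoid (Qm Z B)\<^esub> y \<in> range (\<lambda>c. qq c)" if "x \<in> range (\<lambda>c. qq c)" "y \<in> range (\<lambda>c. qq c)" for x y
      using that by (auto simp flip: qq_add)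
    show "\<one>\<^bsub>add_monoid (Qm Z B)\<^esub> \<in> range (\<lambda>c. qq c)"
      using z by (auto simp: Qm_simps)
    show "inv\<^bsub>add_monoid (Qm Z B)\<^esub> x \<in> range (\<lambda>c. qq c)" if "x \<in> range (\<lambda>c. qq c)" for x
    proof -
      from that obtain c where c: "x = qq c" by (rule imageE)
      \<comment> \<open>The inverse is identified from its defining description, because the
        additive monoid of the quotient has not been shown to be a group.\<close>
      have "inv\<^bsub>add_monoid (Qm Z B)\<^esub> x = qq (\<lambda>i. - c i)"
        unfolding m_inv_def
      proof (rule the_equality)
        have "x \<oplus>\<^bsub>Qm Z B\<^esub> qq (\<lambda>i. - c i) = B" "qq (\<lambda>i. - c i) \<oplus>\<^bsub>Qm Z B\<^esub> x = B"
          unfolding c qq_add[symmetric] using z by simp_all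
        then show "qq (\<lambda>i. - c i) \<in> carrier (add_monoid (Qm Z B)) \<and>
            x \<otimes>\<^bsub>add_monoid (Qm Z B)\<^esub> qq (\<lambda>i. - c i) = \<one>\<^bsub>add_monoid (Qm Z B)\<^esub> \<and>
            qq (\<lambda>i. - c i) \<otimes>\<^bsub>add_monoid (Qm Z B)\<^esub> x = \<one>\<^bsub>add_monoid (Qm Z B)\<^esub>"
          using mem by (simp add: Qm_simps)
      next
        fix y
        assume y: "y \<in> carrier (add_monoid (Qm Z B)) \<and>
            x \<otimes>\<^bsub>add_monoid (Qm Z B)\<^esub> y = \<one>\<^bsub>add_monoid (Qm Z B)\<^esub> \<and>
            y \<otimes>\<^bsub>add_monoid (Qm Z B)\<^esub> x = \<one>\<^bsub>add_monoid (Qm Z B)\<^esub>"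
        then obtain \<eta> where \<eta>: "y = cls B \<eta>" by (auto simp: Qm_simps)
        have "cls B (\<lambda>x v. lincomb g n c x v + \<eta> x v) = qq (\<lambda>i. 0)"
          using y unfolding \<eta> c by (simp add: Qm_simps Qm_add[OF B] z)
        then have "(\<lambda>x v. \<eta> x v - lincomb g n (\<lambda>i. - c i) x v) \<in> B"
          unfolding cls_eq_iff[OF B] by (simp add: lincomb_def sum_negf add.commute)
        then show "y = qq (\<lambda>i. - c i)" unfolding \<eta> cls_eq_iff[OF B] .
      qed
      then show ?thesis by blast
    qed
    show "a \<odot>\<^bsub>Qm Z B\<^esub> x \<in> range (\<lambda>c. qq c)" if "a \<in> carrier complex_ring" "x \<in> range (\<lambda>c. qq c)" for a x
      using that by (auto simp flip: qq_smult)
  qed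
  moreover have "S \<subseteq> range (\<lambda>c. qq c)"
    unfolding S by (auto simp: lincomb_dl[symmetric, of _ n g] simp del: lincomb_dl)
  moreover have "range (\<lambda>c. qq c) \<subseteq> N" if N: "submodule N complex_ring (Qm Z B)" and SN: "S \<subseteq> N" for N
  proof -
    interpret N: submodule N complex_ring "Qm Z B" by (rule N)
    have t: "qq (tr m c) \<in> N" if "m \<le> n" for m c
      using that
    proof (induction m)
      case 0
      have "tr 0 c = (\<lambda>i. 0)" by (simp add: tr_def)
      then show ?case using N.one_closed z by (simp add: Qm_simps)
    next
      case (Suc m)
      have "qq (dl m) \<in> N" using SN Suc.prems unfolding S by (auto simp: lincomb_dl)
      then have "c m \<odot>\<^bsub>Qm Z B\<^esub> qq (dl m) \<in> N" by (simp add: complex_ring_def)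
      with Suc N.m_closed[of "qq (tr m c)" "c m \<odot>\<^bsub>Qm Z B\<^esub> qq (dl m)"] show ?case
        unfolding tr_simps qq_add qq_smult by simp
    qed
    show ?thesis
    proof
      fix y assume "y \<in> range (\<lambda>c. qq c)"
      then obtain c where "y = qq c" by (rule imageE)
      also have "qq c = qq (tr n c)" unfolding qq_eq by (simp add: tr_def)
      finally show "y \<in> N" using t[of n c] by simp
    qed
  qed
  ultimately have "\<Inter>{N. submodule N complex_ring (Qm Z B) \<and> S \<subseteq> N} = range (\<lambda>c. qq c)" by blast
  then show ?thesis
    unfolding coord_def span_module_def using qq_add qq_smult qq_eq by simp
qed

end

section \<open>The cohomology of the Iwasawa manifold\<close>

lemma fsub_forms:
  assumes "\<And>\<omega>. \<omega> \<in> P \<Longrightarrow> smoothf \<omega>" "fsub P"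
  shows "fsub {\<omega> \<in> P. ext_gen p q k \<omega> = zero_form}" "fsub (ext_gen p q k ` P)"
proof -
  have z: "ext_gen p q k zero_form = zero_form" by (simp add: zero_form_def ext_gen_zero)
  have a: "ext_gen p q k (\<lambda>x v. \<omega> x v + \<eta> x v) = (\<lambda>x v. ext_gen p q k \<omega> x v + ext_gen p q k \<eta> x v)"
    if "\<omega> \<in> P" "\<eta> \<in> P" for \<omega> \<eta> by (rule ext_gen_add[OF assms(1)[OF that(1)] assms(1)[OF that(2)]])
  have c: "ext_gen p q k (\<lambda>x v. c * \<omega> x v) = (\<lambda>x v. c * ext_gen p q k \<omega> x v)" if "\<omega> \<in> P" for c \<omega>
    by (rule ext_gen_cmult[OF assms(1)[OF that]])
  note P = fsubD[OF assms(2)]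
  show "fsub {\<omega> \<in> P. ext_gen p q k \<omega> = zero_form}"
    unfolding fsub_def by (auto simp: P z a c) (simp_all add: zero_form_def)
  show "fsub (ext_gen p q k ` P)"
    unfolding fsub_def
  proof (intro conjI ballI allI)
    show "zero_form \<in> ext_gen p q k ` P" by (rule image_eqI[where x = zero_form]) (simp_all add: z P(1))
    fix \<omega> assume "\<omega> \<in> ext_gen p q k ` P"
    then obtain \<omega>' where \<omega>: "\<omega> = ext_gen p q k \<omega>'" "\<omega>' \<in> P" by (rule imageE)
    show "(\<lambda>x v. c * \<omega> x v) \<in> ext_gen p q k ` P" for c
      unfolding \<omega>(1) by (rule image_eqI[where f = "ext_gen p q k", OF c[OF \<omega>(2), symmetric] P(3)[OF \<omega>(2)]])
    fix \<eta> assume "\<eta> \<in> ext_gen p q k ` P"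
    then obtain \<eta>' where \<eta>: "\<eta> = ext_gen p q k \<eta>'" "\<eta>' \<in> P" by (rule imageE)
    show "(\<lambda>x v. \<omega> x v + \<eta> x v) \<in> ext_gen p q k ` P"
      unfolding \<omega>(1) \<eta>(1) by (rule image_eqI[where f = "ext_gen p q k", OF a[OF \<omega>(2) \<eta>(2), symmetric] P(2)[OF \<omega>(2) \<eta>(2)]])
  qed
qed

lemma fsub_is_form: "fsub {\<omega>. is_form k \<omega>}"
  unfolding fsub_def by (auto simp: is_form_add is_form_cmult zero_form_def is_form_zero)

lemma fsub_pq_forms: "fsub (pq_forms p q)"
  unfolding fsub_def pq_forms_def
  by (auto simp: is_form_add is_form_cmult zero_form_def is_form_zero bidegree_add bidegree_cmult bidegree_zero)

lemma pq_forms_smoothf: "\<omega> \<in> pq_forms p q \<Longrightarrow> smoothf \<omega>"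
  by (auto simp: pq_forms_def is_form_iff)

lemma fsub_closed: "fsub (closed_forms k)"
  unfolding closed_forms_def ext_deriv_eq
  using fsub_forms(1)[OF _ fsub_is_form[of k], of 1 0 k] is_formD(2) by fastforce

lemma fsub_dbar_closed: "fsub (dbar_closed_forms p q)"
  unfolding dbar_closed_forms_def dbar_eq
  by (rule fsub_forms(1)[OF pq_forms_smoothf fsub_pq_forms])

lemma fsub_exact: "fsub (exact_forms 3)"
proof -
  have "exact_forms 3 = ext_gen 1 0 2 ` {\<eta>. is_form 2 \<eta>}"
    by (simp add: exact_forms_def ext_deriv_eq numeral_3_eq_3 numeral_2_eq_2)
  then show ?thesis using fsub_forms(2)[OF _ fsub_is_form, of 2] is_formD(2) by simp
qed

lemma fsub_dbar_exact: "fsub (dbar_exact_forms p q)"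
proof (cases q)
  case 0
  then show ?thesis by (simp add: dbar_exact_forms_def fsub_def zero_form_def)
next
  case (Suc r)
  then show ?thesis
    using fsub_forms(2)[OF pq_forms_smoothf fsub_pq_forms] by (simp add: dbar_exact_forms_def dbar_eq)
qed

text \<open>Places \<open>n\<close> coordinates as a block starting at \<open>a\<close>, in
  accordance with the order of the labels in \<open>lab\<close>.\<close>

definition pad :: "nat \<Rightarrow> nat \<Rightarrow> (nat \<Rightarrow> complex) \<Rightarrow> nat \<Rightarrow> complex" where
  "pad a n c = (\<lambda>j. if a \<le> j \<and> j < a + n then c (j - a) else 0)"

lemma sum_pad:
  assumes "a + n \<le> N"
  shows "(\<Sum>j<N. pad a n c j * h j) = (\<Sum>i<n. c i * h (a + i))"
proof -
  have "(\<Sum>j<N. pad a n c j * h j) = (\<Sum>j\<in>(+) a ` {..<n}. pad a n c j * h j)"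
  proof (rule sum.mono_neutral_right)
    show "\<forall>i\<in>{..<N} - (+) a ` {..<n}. pad a n c i * h i = 0"
    proof
      fix j assume j: "j \<in> {..<N} - (+) a ` {..<n}"
      have "\<not> (a \<le> j \<and> j < a + n)"
      proof
        assume "a \<le> j \<and> j < a + n"
        then have "j = a + (j - a)" "j - a < n" by auto
        then show False using j by blast
      qed
      then show "pad a n c j * h j = 0" by (auto simp: pad_def)
    qed
  qed (use assms in auto)
  also have "\<dots> = (\<Sum>i<n. c i * h (a + i))"
    by (subst sum.reindex) (auto simp: pad_def)
  finally show ?thesis .
qed

lemma independent_pad:
  assumes n: "a + n \<le> 10" and \<eta>: "is_form 2 \<eta>" and eq: "lincomb (\<lambda>i. G (a + i)) n c = ext_gen p q 2 \<eta>" and i: "i < n"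
  shows "c i = 0"
proof -
  have "pad a n c (a + i) = 0"
  proof (rule independent[OF \<eta>])
    show "(\<Sum>j<10. pad a n c j * G j x v) = ext_gen p q 2 \<eta> x v" for x v
      unfolding sum_pad[OF n] eq[symmetric] lincomb_def ..
  qed (use n i in simp)
  then show ?thesis using i by (simp add: pad_def)
qed

lemma G_simps:
  "G 0 = W 0 1 2" "G 1 = W 0 2 3" "G 2 = W 0 2 4" "G 3 = W 1 2 3" "G 4 = W 1 2 4"
  "G 5 = W 0 3 5" "G 6 = W 0 4 5" "G 7 = W 1 3 5" "G 8 = W 1 4 5" "G 9 = W 3 4 5"
  by (simp_all add: G_def lab_def)

lemma fr_names: "fr 0 = \<alpha>" "fr 1 = \<beta>" "fr 2 = \<gamma>" "fr 3 = bar \<alpha>" "fr 4 = bar \<beta>" "fr 5 = bar \<gamma>"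
  by (simp_all add: fr_def)

lemma gens_eq:
  "gens30 = {G 0}" "gens21 = {G 1, G 2, G 3, G 4}" "gens12 = {G 5, G 6, G 7, G 8}" "gens03 = {G 9}"
  unfolding gens30_def gens21_def gens12_def gens03_def G_simps fr_names by (rule refl)+

text \<open>Conjugating a generator of type (2,1) puts its holomorphic factor last; moving it to the
  front is a cyclic permutation of three factors, which is even, so no sign appears.\<close>

lemma cnj_W:
  "cnj_form (G 0) = G 9" "cnj_form (G 1) = G 5" "cnj_form (G 2) = G 7" "cnj_form (G 3) = G 6" "cnj_form (G 4) = G 8"
  unfolding G_simps fr_names by (simp_all add: cnj_form_def wedge3 bar_def fun_eq_iff algebra_simps)

text \<open>Keeps \<open>simp\<close> from normalising the index of \<open>G\<close> to \<open>Suc\<close> terms.\<close>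

lemma shift_numerals:
  "1 + 0 = (1::nat)" "1 + 1 = (2::nat)" "1 + 2 = (3::nat)" "1 + 3 = (4::nat)"
  "5 + 0 = (5::nat)" "5 + 1 = (6::nat)" "5 + 2 = (7::nat)" "5 + 3 = (8::nat)"
  by simp_all

lemma G_dbar_closed:
  "G 0 \<in> dbar_closed_forms 3 0" "i < 4 \<Longrightarrow> G (1 + i) \<in> dbar_closed_forms 2 1"
  "i < 4 \<Longrightarrow> G (5 + i) \<in> dbar_closed_forms 1 2" "G 9 \<in> dbar_closed_forms 0 3"
proof -
  have e: "ext_gen p q 3 (G j) = zero_form" if "j < 10" for j p q
    using ext_gen_G[OF that] by (simp add: zero_form_def)
  have m: "G j \<in> dbar_closed_forms p q" if "j < 10" "p + q = 3" "\<And>x. bidegree p q (G j x)" for j p q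
    using that by (simp add: dbar_closed_forms_def pq_forms_def G_form dbar_eq e)
  have i4: "i = 0 \<or> i = 1 \<or> i = 2 \<or> i = 3" if "i < 4" for i :: nat using that by auto
  show "G 0 \<in> dbar_closed_forms 3 0" "G 9 \<in> dbar_closed_forms 0 3"
    by (rule m; simp only: G_simps bidegree_W; simp)+
  show "G (1 + i) \<in> dbar_closed_forms 2 1" if "i < 4"
  proof (rule m)
    show "bidegree 2 1 (G (1 + i) x)" for x
      using i4[OF that] by (elim disjE) (simp_all only: shift_numerals G_simps bidegree_W)
  qed (use that in simp_all)
  show "G (5 + i) \<in> dbar_closed_forms 1 2" if "i < 4"
  proof (rule m)
    show "bidegree 1 2 (G (5 + i) x)" for x
      using i4[OF that] by (elim disjE) (simp_all only: shift_numerals G_simps bidegree_W)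
  qed (use that in simp_all)
qed

section \<open>Coordinates on the cohomology spaces\<close>

lemma coord_30: "coord (H_Dolb 3 0) 1 (\<lambda>c. class_Dolb 3 0 (lincomb (\<lambda>i. G (0 + i)) 1 c))"
  unfolding H_Dolb_def class_Dolb_def
proof (rule coord_quotient[OF fsub_dbar_closed fsub_dbar_exact])
  show "G (0 + i) \<in> dbar_closed_forms 3 0" if "i < 1" for i using that G_dbar_closed(1) by simp
  show "c i = 0" if "lincomb (\<lambda>i. G (0 + i)) 1 c \<in> dbar_exact_forms 3 0" "i < 1" for c i
  \<comment> \<open>There are no forms of type (3,-1), so exactness means vanishing; zero is written
    as the derivative of the zero form to fit \<open>independent_pad\<close>.\<close>
  proof (rule independent_pad[of 0 1 "\<lambda>x v. 0" c 1 0])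
    show "lincomb (\<lambda>i. G (0 + i)) 1 c = ext_gen 1 0 2 (\<lambda>x v. 0)"
      using that by (simp add: dbar_exact_forms_def ext_gen_zero zero_form_def)
  qed (use that is_form_zero in auto)
  show "\<exists>c. (\<lambda>x v. \<omega> x v - lincomb (\<lambda>i. G (0 + i)) 1 c x v) \<in> dbar_exact_forms 3 0" if "\<omega> \<in> dbar_closed_forms 3 0" for \<omega>
  proof -
    from Dolbeault_30_spanning[OF that] obtain k where k: "\<And>x v. \<omega> x v = k * W 0 1 2 x v" by blast
    have "(\<lambda>x v. \<omega> x v - lincomb (\<lambda>i. G (0 + i)) 1 (\<lambda>i. k) x v) = zero_form"
      unfolding k by (simp add: lincomb_def G_simps(1) zero_form_def)
    then show ?thesis by (intro exI[of _ "\<lambda>i. k"]) (simp add: dbar_exact_forms_def)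
  qed
qed

lemma dbar_exact_primitive:
  assumes "\<sigma> \<in> dbar_exact_forms p q" "p + q = 3" "q > 0"
  obtains \<eta> where "is_form 2 \<eta>" "\<sigma> = ext_gen (1/2) (\<i>/2) 2 \<eta>"
proof -
  obtain r where r: "q = Suc r" using assms(3) by (cases q) auto
  then have "p + r = 2" using assms(2) by simp
  then show ?thesis using assms(1) that unfolding r dbar_exact_forms_def pq_forms_def dbar_eq by auto
qed

lemma coord_03: "coord (H_Dolb 0 3) 1 (\<lambda>c. class_Dolb 0 3 (lincomb (\<lambda>i. G (9 + i)) 1 c))"
  unfolding H_Dolb_def class_Dolb_def
proof (rule coord_quotient[OF fsub_dbar_closed fsub_dbar_exact])
  show "G (9 + i) \<in> dbar_closed_forms 0 3" if "i < 1" for i using that G_dbar_closed(4) by simp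
  show "c i = 0" if "lincomb (\<lambda>i. G (9 + i)) 1 c \<in> dbar_exact_forms 0 3" "i < 1" for c i
  proof -
    from that(1) obtain \<eta> where "is_form 2 \<eta>" "lincomb (\<lambda>i. G (9 + i)) 1 c = ext_gen (1/2) (\<i>/2) 2 \<eta>"
      by (rule dbar_exact_primitive) auto
    then show ?thesis by (rule independent_pad[rotated]) (use that in auto)
  qed
  show "\<exists>c. (\<lambda>x v. \<omega> x v - lincomb (\<lambda>i. G (9 + i)) 1 c x v) \<in> dbar_exact_forms 0 3" if "\<omega> \<in> dbar_closed_forms 0 3" for \<omega>
  proof -
    from Dolbeault_03_spanning[OF that] obtain k \<eta> where k: "\<eta> \<in> pq_forms 0 2" "\<And>x v. \<omega> x v = k * W 3 4 5 x v + dbar 2 \<eta> x v"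
      by blast
    have "(\<lambda>x v. \<omega> x v - lincomb (\<lambda>i. G (9 + i)) 1 (\<lambda>i. k) x v) = dbar 2 \<eta>"
      unfolding k(2) by (simp add: lincomb_def G_simps(10)[symmetric])
    moreover have "dbar 2 \<eta> \<in> dbar_exact_forms 0 3"
      using k(1) by (simp add: dbar_exact_forms_def numeral_3_eq_3 numeral_2_eq_2)
    ultimately show ?thesis by (intro exI[of _ "\<lambda>i. k"]) simp
  qed
qed

lemma coord_21: "coord H21_\<gamma> 4 (\<lambda>c. class_Dolb 2 1 (lincomb (\<lambda>i. G (1 + i)) 4 c))"
  unfolding H21_\<gamma>_def H_Dolb_def class_Dolb_def
proof (rule coord_span[OF fsub_dbar_closed fsub_dbar_exact])
  show "G (1 + i) \<in> dbar_closed_forms 2 1" if "i < 4" for i by (rule G_dbar_closed(2)[OF that])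
  show "c i = 0" if "lincomb (\<lambda>i. G (1 + i)) 4 c \<in> dbar_exact_forms 2 1" "i < 4" for c i
  proof -
    from that(1) obtain \<eta> where "is_form 2 \<eta>" "lincomb (\<lambda>i. G (1 + i)) 4 c = ext_gen (1/2) (\<i>/2) 2 \<eta>"
      by (rule dbar_exact_primitive) auto
    then show ?thesis by (rule independent_pad[rotated]) (use that in auto)
  qed
  show "(\<lambda>\<omega>. cls (dbar_exact_forms 2 1) \<omega>) ` gens21 = (\<lambda>i. cls (dbar_exact_forms 2 1) (G (1 + i))) ` {..<4}"
    unfolding gens_eq by (simp add: eval_nat_numeral lessThan_Suc insert_commute)
qed

lemma coord_12: "coord H12_\<gamma> 4 (\<lambda>c. class_Dolb 1 2 (lincomb (\<lambda>i. G (5 + i)) 4 c))"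
  unfolding H12_\<gamma>_def H_Dolb_def class_Dolb_def
proof (rule coord_span[OF fsub_dbar_closed fsub_dbar_exact])
  show "G (5 + i) \<in> dbar_closed_forms 1 2" if "i < 4" for i by (rule G_dbar_closed(3)[OF that])
  show "c i = 0" if "lincomb (\<lambda>i. G (5 + i)) 4 c \<in> dbar_exact_forms 1 2" "i < 4" for c i
  proof -
    from that(1) obtain \<eta> where "is_form 2 \<eta>" "lincomb (\<lambda>i. G (5 + i)) 4 c = ext_gen (1/2) (\<i>/2) 2 \<eta>"
      by (rule dbar_exact_primitive) auto
    then show ?thesis by (rule independent_pad[rotated]) (use that in auto)
  qed
  show "(\<lambda>\<omega>. cls (dbar_exact_forms 1 2) \<omega>) ` gens12 = (\<lambda>i. cls (dbar_exact_forms 1 2) (G (5 + i))) ` {..<4}"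
    unfolding gens_eq by (simp add: eval_nat_numeral lessThan_Suc insert_commute)
qed

lemma coord_DR: "coord (H_DR 3) 10 (\<lambda>c. class_DR 3 (lincomb G 10 c))"
  unfolding H_DR_def class_DR_def
proof (rule coord_quotient[OF fsub_closed fsub_exact])
  have ex: "exact_forms 3 = ext_gen 1 0 2 ` {\<eta>. is_form 2 \<eta>}"
    by (simp add: exact_forms_def ext_deriv_eq numeral_3_eq_3 numeral_2_eq_2)
  show "G i \<in> closed_forms 3" if "i < 10" for i
    using G_form(1)[OF that] ext_gen_G[OF that] by (simp add: closed_forms_def ext_deriv_eq zero_form_def)
  show "c i = 0" if c: "lincomb G 10 c \<in> exact_forms 3" "i < 10" for c i
  proof -
    from c(1) obtain \<eta> where \<eta>: "lincomb G 10 c = ext_gen 1 0 2 \<eta>" "is_form 2 \<eta>" unfolding ex by auto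
    show ?thesis by (rule independent_pad[of 0 10 \<eta> c 1 0]) (use \<eta> c in auto)
  qed
  show "\<exists>c. (\<lambda>x v. \<omega> x v - lincomb G 10 c x v) \<in> exact_forms 3" if "\<omega> \<in> closed_forms 3" for \<omega>
  proof -
    have "is_form 3 \<omega>" "ext_gen 1 0 3 \<omega> = (\<lambda>x v. 0)"
      using that by (auto simp: closed_forms_def ext_deriv_eq zero_form_def)
    from DR_spanning[OF this] obtain c \<eta> where \<eta>: "is_form 2 \<eta>" "\<And>x v. \<omega> x v = (\<Sum>i<10. c i * G i x v) + ext_gen 1 0 2 \<eta> x v"
      by blast
    have "(\<lambda>x v. \<omega> x v - lincomb G 10 c x v) = ext_gen 1 0 2 \<eta>" unfolding \<eta>(2) by (simp add: lincomb_def)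
    then show ?thesis using \<eta>(1) unfolding ex by (intro exI[of _ c]) simp
  qed
qed

section \<open>The canonical maps in coordinates\<close>

lemma coord_linear_pad: "a + n \<le> N \<Longrightarrow> coord_linear n N (pad a n)"
  by (auto simp: coord_linear_def pad_def fun_eq_iff)

lemma coord_linear_perm: "(\<And>i. i < n' \<Longrightarrow> \<pi> i < n) \<Longrightarrow> coord_linear n n' (\<lambda>c i. c (\<pi> i))"
  by (auto simp: coord_linear_def)

lemma pad_dl: "i < n \<Longrightarrow> pad a n (dl i) = dl (a + i)"
  by (auto simp: pad_def dl_def fun_eq_iff)

lemma inj_pad: "a + n \<le> N \<Longrightarrow> \<forall>i<N. pad a n c i = pad a n d i \<Longrightarrow> \<forall>i<n. c i = d i"
proof (intro allI impI)
  fix i assume *: "a + n \<le> N" "\<forall>i<N. pad a n c i = pad a n d i" "i < n"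
  then have "pad a n c (a + i) = pad a n d (a + i)" by simp
  then show "c i = d i" using *(3) by (simp add: pad_def)
qed

lemma canonical_pad:
  assumes M: "coord M n (\<lambda>c. cl (lincomb (\<lambda>i. G (a + i)) n c))" and n: "a + n \<le> 10" and S: "S = (\<lambda>i. G (a + i)) ` {..<n}"
  shows "canonical_map M (H_DR 3) S id cl (class_DR 3)
    (cmap (\<lambda>c. cl (lincomb (\<lambda>i. G (a + i)) n c)) (\<lambda>c. class_DR 3 (lincomb G 10 c)) (pad a n))"
proof (rule canonical_map_coord[OF M coord_DR coord_linear_pad[OF n]])
  have k: "cl (G (a + i)) = cl (lincomb (\<lambda>i. G (a + i)) n (dl i)) \<and>
      class_DR 3 (id (G (a + i))) = class_DR 3 (lincomb G 10 (pad a n (dl i)))" if "i < n" for i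
    using that n lincomb_dl[OF that, of "\<lambda>i. G (a + i)"] lincomb_dl[of "a + i" 10 G] by (simp add: pad_dl)
  show "\<exists>i<n. cl \<omega> = cl (lincomb (\<lambda>i. G (a + i)) n (dl i)) \<and> class_DR 3 (id \<omega>) = class_DR 3 (lincomb G 10 (pad a n (dl i)))"
    if "\<omega> \<in> S" for \<omega>
    using that k unfolding S by blast
  show "\<exists>\<omega>\<in>S. cl \<omega> = cl (lincomb (\<lambda>i. G (a + i)) n (dl i)) \<and> class_DR 3 (id \<omega>) = class_DR 3 (lincomb G 10 (pad a n (dl i)))"
    if "i < n" for i
    unfolding S using k[OF that] that by blast
qed

theorem proposition4p3:
  shows "\<exists>j30 j21 j12 j03 c30 c21.
     canonical_map (H_Dolb 3 0) (H_DR 3) gens30 id (class_Dolb 3 0) (class_DR 3) j30 \<and>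
     canonical_map H21_\<gamma> (H_DR 3) gens21 id (class_Dolb 2 1) (class_DR 3) j21 \<and>
     canonical_map H12_\<gamma> (H_DR 3) gens12 id (class_Dolb 1 2) (class_DR 3) j12 \<and>
     canonical_map (H_Dolb 0 3) (H_DR 3) gens03 id (class_Dolb 0 3) (class_DR 3) j03 \<and>
     inj_on j21 (carrier H21_\<gamma>) \<and>
     inj_on j12 (carrier H12_\<gamma>) \<and>
     (\<lambda>(a, b, c, d). j30 a \<oplus>\<^bsub>H_DR 3\<^esub> (j21 b \<oplus>\<^bsub>H_DR 3\<^esub> (j12 c \<oplus>\<^bsub>H_DR 3\<^esub> j03 d)))
       \<in> linear_isos (H_Dolb 3 0 \<oplus>\<^sub>m H21_\<gamma> \<oplus>\<^sub>m H12_\<gamma> \<oplus>\<^sub>m H_Dolb 0 3) (H_DR 3) \<and>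
     canonical_map (H_Dolb 3 0) (conjugate_module (H_Dolb 0 3)) gens30 cnj_form
       (class_Dolb 3 0) (class_Dolb 0 3) c30 \<and>
     c30 \<in> linear_isos (H_Dolb 3 0) (conjugate_module (H_Dolb 0 3)) \<and>
     canonical_map H21_\<gamma> (conjugate_module H12_\<gamma>) gens21 cnj_form
       (class_Dolb 2 1) (class_Dolb 1 2) c21 \<and>
     c21 \<in> linear_isos H21_\<gamma> (conjugate_module H12_\<gamma>)"
proof -
  let ?q30 = "\<lambda>c. class_Dolb 3 0 (lincomb (\<lambda>i. G (0 + i)) 1 c)"
  let ?q21 = "\<lambda>c. class_Dolb 2 1 (lincomb (\<lambda>i. G (1 + i)) 4 c)"
  let ?q12 = "\<lambda>c. class_Dolb 1 2 (lincomb (\<lambda>i. G (5 + i)) 4 c)"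
  let ?q03 = "\<lambda>c. class_Dolb 0 3 (lincomb (\<lambda>i. G (9 + i)) 1 c)"
  let ?q = "\<lambda>c. class_DR 3 (lincomb G 10 c)"
  let ?j30 = "cmap ?q30 ?q (pad 0 1)" and ?j21 = "cmap ?q21 ?q (pad 1 4)"
    and ?j12 = "cmap ?q12 ?q (pad 5 4)" and ?j03 = "cmap ?q03 ?q (pad 9 1)"
  have p: "coord_linear 1 10 (pad 0 1)" "coord_linear 4 10 (pad 1 4)" "coord_linear 4 10 (pad 5 4)" "coord_linear 1 10 (pad 9 1)"
    by (simp_all add: coord_linear_pad)
  note F30 = cmap_apply[OF coord_30 coord_DR p(1)] and F21 = cmap_apply[OF coord_21 coord_DR p(2)]
    and F12 = cmap_apply[OF coord_12 coord_DR p(3)] and F03 = cmap_apply[OF coord_03 coord_DR p(4)]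
  have S: "gens30 = (\<lambda>i. G (0 + i)) ` {..<1}" "gens21 = (\<lambda>i. G (1 + i)) ` {..<4}"
      "gens12 = (\<lambda>i. G (5 + i)) ` {..<4}" "gens03 = (\<lambda>i. G (9 + i)) ` {..<1}"
    unfolding gens_eq by (simp_all add: eval_nat_numeral lessThan_Suc insert_commute)
  have can: "canonical_map (H_Dolb 3 0) (H_DR 3) gens30 id (class_Dolb 3 0) (class_DR 3) ?j30"
    "canonical_map H21_\<gamma> (H_DR 3) gens21 id (class_Dolb 2 1) (class_DR 3) ?j21"
    "canonical_map H12_\<gamma> (H_DR 3) gens12 id (class_Dolb 1 2) (class_DR 3) ?j12"
    "canonical_map (H_Dolb 0 3) (H_DR 3) gens03 id (class_Dolb 0 3) (class_DR 3) ?j03"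
    by (rule canonical_pad[OF coord_30 _ S(1)], simp) (rule canonical_pad[OF coord_21 _ S(2)], simp,
      rule canonical_pad[OF coord_12 _ S(3)], simp, rule canonical_pad[OF coord_03 _ S(4)], simp)
  have inj: "inj_on ?j21 (carrier H21_\<gamma>)" "inj_on ?j12 (carrier H12_\<gamma>)"
    by (rule inj_on_coord[where A = "pad 1 4", OF coord_21 coord_DR F21 inj_pad]; simp)
      (rule inj_on_coord[where A = "pad 5 4", OF coord_12 coord_DR F12 inj_pad]; simp)
  note sum = coord_direct_sum[OF coord_30 coord_direct_sum[OF coord_21 coord_direct_sum[OF coord_12 coord_03]]]
  have iso: "(\<lambda>(a, b, c, d). ?j30 a \<oplus>\<^bsub>H_DR 3\<^esub> (?j21 b \<oplus>\<^bsub>H_DR 3\<^esub> (?j12 c \<oplus>\<^bsub>H_DR 3\<^esub> ?j03 d)))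
       \<in> linear_isos (H_Dolb 3 0 \<oplus>\<^sub>m H21_\<gamma> \<oplus>\<^sub>m H12_\<gamma> \<oplus>\<^sub>m H_Dolb 0 3) (H_DR 3)"
  \<comment> \<open>In coordinates the map is the identity: the four blocks of lengths 1, 4, 4 and 1
    fill the ten coordinates.\<close>
  proof (rule linear_isos_coord[where A = "\<lambda>c. c", OF sum coord_DR])
    show "coord_linear (1 + (4 + (4 + 1))) 10 (\<lambda>c. c)" by (simp add: coord_linear_def)
    show "(\<lambda>(a, b, c, d). ?j30 a \<oplus>\<^bsub>H_DR 3\<^esub> (?j21 b \<oplus>\<^bsub>H_DR 3\<^esub> (?j12 c \<oplus>\<^bsub>H_DR 3\<^esub> ?j03 d)))
       (?q30 c, ?q21 (\<lambda>i. c (1 + i)), ?q12 (\<lambda>i. c (1 + (4 + i))), ?q03 (\<lambda>i. c (1 + (4 + (4 + i))))) = ?q c" for c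
    proof -
      have "(\<lambda>(a, b, c, d). ?j30 a \<oplus>\<^bsub>H_DR 3\<^esub> (?j21 b \<oplus>\<^bsub>H_DR 3\<^esub> (?j12 c \<oplus>\<^bsub>H_DR 3\<^esub> ?j03 d)))
       (?q30 c, ?q21 (\<lambda>i. c (1 + i)), ?q12 (\<lambda>i. c (1 + (4 + i))), ?q03 (\<lambda>i. c (1 + (4 + (4 + i))))) =
         ?q (\<lambda>i. pad 0 1 c i + (pad 1 4 (\<lambda>i. c (1 + i)) i + (pad 5 4 (\<lambda>i. c (1 + (4 + i))) i + pad 9 1 (\<lambda>i. c (1 + (4 + (4 + i)))) i)))"
        unfolding prod.case F30 F21 F12 F03 coordD(2)[OF coord_DR, symmetric] ..
      also have "\<dots> = ?q c"
        unfolding coordD(4)[OF coord_DR] by (auto simp: pad_def intro!: arg_cong[of _ _ c])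
      finally show ?thesis .
    qed
  qed auto
  \<comment> \<open>Conjugation sends \<open>G 2\<close> to \<open>G 7\<close> and
    \<open>G 3\<close> to \<open>G 6\<close>, so it interchanges the two middle positions of the
    blocks.\<close>
  define \<pi> :: "nat \<Rightarrow> nat" where "\<pi> i = (if i = 1 then 2 else if i = 2 then 1 else i)" for i
  have \<pi>: "\<pi> i < 4" "\<pi> (\<pi> i) = i" if "i < 4" for i using that by (auto simp: \<pi>_def)
  have A: "coord_linear 4 4 (\<lambda>c i. c (\<pi> i))" "coord_linear 1 1 (\<lambda>c i. c i)"
    by (auto intro: coord_linear_perm \<pi>)
  let ?c30 = "cmap ?q30 (\<lambda>c. ?q03 (\<lambda>i. cnj (c i))) (\<lambda>c i. c i)"
  let ?c21 = "cmap ?q21 (\<lambda>c. ?q12 (\<lambda>i. cnj (c i))) (\<lambda>c i. c (\<pi> i))"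
  note C03 = coord_conjugate[OF coord_03] and C12 = coord_conjugate[OF coord_12]
  have cdl: "(\<lambda>i. cnj (dl j i)) = dl j" for j by (simp add: dl_def fun_eq_iff)
  have can30: "canonical_map (H_Dolb 3 0) (conjugate_module (H_Dolb 0 3)) gens30 cnj_form (class_Dolb 3 0) (class_Dolb 0 3) ?c30"
    by (rule canonical_map_coord[OF coord_30 C03 A(2)])
      (simp_all add: gens_eq cdl lincomb_dl cnj_W)
  have can21: "canonical_map H21_\<gamma> (conjugate_module H12_\<gamma>) gens21 cnj_form (class_Dolb 2 1) (class_Dolb 1 2) ?c21"
  proof (rule canonical_map_coord[OF coord_21 C12 A(1)])
    have \<pi>dl: "lincomb (\<lambda>i. G (5 + i)) 4 (\<lambda>i. cnj (dl j (\<pi> i))) = G (5 + \<pi> j)" if "j < 4" for j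
    proof -
      have "lincomb (\<lambda>i. G (5 + i)) 4 (\<lambda>i. cnj (dl j (\<pi> i))) = lincomb (\<lambda>i. G (5 + i)) 4 (dl (\<pi> j))"
        unfolding lincomb_def by (intro ext sum.cong) (use \<pi> that in \<open>auto simp: dl_def\<close>)
      then show ?thesis by (simp add: lincomb_dl \<pi> that)
    qed
    have j4: "j = 0 \<or> j = 1 \<or> j = 2 \<or> j = 3" if "j < 4" for j :: nat using that by auto
    have \<pi>v: "\<pi> 0 = 0" "\<pi> 1 = 2" "\<pi> 2 = 1" "\<pi> 3 = 3" by (simp_all add: \<pi>_def)
    have k: "cnj_form (G (1 + j)) = G (5 + \<pi> j)" if "j < 4" for j
      using j4[OF that] by (elim disjE) (simp_all only: \<pi>v shift_numerals cnj_W)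
    have e: "class_Dolb 2 1 (G (1 + j)) = ?q21 (dl j) \<and> class_Dolb 1 2 (cnj_form (G (1 + j))) = ?q12 (\<lambda>i. cnj (dl j (\<pi> i)))" if "j < 4" for j
      using lincomb_dl[OF that, of "\<lambda>i. G (1 + i)"] \<pi>dl[OF that] k[OF that] by simp
    show "\<exists>i<4. class_Dolb 2 1 \<omega> = ?q21 (dl i) \<and> class_Dolb 1 2 (cnj_form \<omega>) = ?q12 (\<lambda>j. cnj (dl i (\<pi> j)))"
      if "\<omega> \<in> gens21" for \<omega>
      using that e unfolding S by blast
    show "\<exists>\<omega>\<in>gens21. class_Dolb 2 1 \<omega> = ?q21 (dl i) \<and> class_Dolb 1 2 (cnj_form \<omega>) = ?q12 (\<lambda>j. cnj (dl i (\<pi> j)))"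
      if "i < 4" for i
      unfolding S using that e[OF that] by blast
  qed
  have iso30: "?c30 \<in> linear_isos (H_Dolb 3 0) (conjugate_module (H_Dolb 0 3))"
    by (rule linear_isos_coord[OF coord_30 C03 A(2) cmap_apply[OF coord_30 C03 A(2)]]) auto
  have iso21: "?c21 \<in> linear_isos H21_\<gamma> (conjugate_module H12_\<gamma>)"
  proof (rule linear_isos_coord[OF coord_21 C12 A(1) cmap_apply[OF coord_21 C12 A(1)]])
    show "\<forall>i<4. c i = d i" if "\<forall>i<4. c (\<pi> i) = d (\<pi> i)" for c d :: "nat \<Rightarrow> complex"
      using that \<pi> by metis
    show "\<exists>c. \<forall>i<4. c (\<pi> i) = c' i" for c' :: "nat \<Rightarrow> complex"
      by (rule exI[of _ "\<lambda>i. c' (\<pi> i)"]) (simp add: \<pi>)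
  qed
  show ?thesis
    by (intro exI conjI) (rule can inj iso can30 iso30 can21 iso21)+
qed

end
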